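(* Let $d\ge3$ and let $\mu=\mu_1+\mu_2$ be a finite measure on $\mathbb{R}^d$, where $\mu_1$ is the arc length measure on a nonempty open subset of a smooth curve in $\mathbb{R}^d$, and $\mu_2$ is the area measure on a nonempty open subset $\Omega$ of a smooth hypersurface in $\mathbb{R}^d$ such that $\Omega$ contains a point of non-zero Gaussian curvature. Then $L^2(\mu)$ does not admit a Fourier frame.
   Context: "Smooth" means $C^\infty$; the arc length/area measures are the surface measures induced by the embedding in $\mathbb{R}^d$, assumed finite. For $\lambda\in\mathbb{R}^d$, $e_\lambda(x)=e^{2\pi i\langle\lambda,x\rangle}$. A countable $\Lambda\subset\mathbb{R}^d$ gives a Fourier frame $E(\Lambda)=\{e_\lambda\}_{\lambda\in\Lambda}$ for $L^2(\mu)$ if there are $0<A,B<\infty$ with $A\|f\|^2_{L^2(\mu)}\le\sum_{\lambda\in\Lambda}|\langle f,e_\lambda\rangle_{L^2(\mu)}|^2\le B\|f\|^2_{L^2(\mu)}$ for all $f\in L^2(\mu)$; "$L^2(\mu)$ admits a Fourier frame" means such a $\Lambda$ exists. *)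

theory Defs
  imports "HOL-Analysis.Analysis"
begin

fun Ck_on :: "nat \<Rightarrow> 'a::real_normed_vector set \<Rightarrow> ('a \<Rightarrow> 'b::real_normed_vector) \<Rightarrow> bool" where
  "Ck_on 0 S f = continuous_on S f"
| "Ck_on (Suc k) S f =
     ((\<forall>x\<in>S. f differentiable (at x)) \<and>
      (\<forall>v. Ck_on k S (\<lambda>x. frechet_derivative f (at x) v)))"

definition smooth_on :: "'a::real_normed_vector set \<Rightarrow> ('a \<Rightarrow> 'b::real_normed_vector) \<Rightarrow> bool" where
  "smooth_on S f \<longleftrightarrow> (\<forall>k. Ck_on k S f)"

definition smooth_curve :: "(real^'n) set \<Rightarrow> bool" where
  "smooth_curve C \<longleftrightarrow>
    (\<forall>p\<in>C. \<exists>U I (\<gamma>::real \<Rightarrow> real^'n) g.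
        open U \<and> p \<in> U \<and> open I \<and> smooth_on I \<gamma> \<and>
        (\<forall>t\<in>I. vector_derivative \<gamma> (at t) \<noteq> 0) \<and>
        homeomorphism I (C \<inter> U) \<gamma> g)"

definition grad :: "(real^'n \<Rightarrow> real) \<Rightarrow> real^'n \<Rightarrow> real^'n" where
  "grad F x = (\<chi> i. frechet_derivative F (at x) (axis i 1))"

definition local_defining_function :: "(real^'n) set \<Rightarrow> (real^'n) set \<Rightarrow> (real^'n \<Rightarrow> real) \<Rightarrow> real^'n \<Rightarrow> bool" where
  "local_defining_function M U F p \<longleftrightarrow>
     open U \<and> p \<in> U \<and> smooth_on U F \<and> (\<forall>x\<in>U. grad F x \<noteq> 0) \<and>
     M \<inter> U = {x\<in>U. F x = 0}"

definition smooth_hypersurface :: "(real^'n) set \<Rightarrow> bool" where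
  "smooth_hypersurface M \<longleftrightarrow> (\<forall>p\<in>M. \<exists>U F. local_defining_function M U F p)"

definition unit_normal :: "(real^'n \<Rightarrow> real) \<Rightarrow> real^'n \<Rightarrow> real^'n" where
  "unit_normal F x = grad F x /\<^sub>R norm (grad F x)"

text \<open>Gaussian (Gauss-Kronecker) curvature at p: the determinant of the shape
  operator dN_p restricted to the tangent space T_p = N(p)^perp.  It is computed as
  the determinant of the linear map of R^d that equals dN_p on T_p and the identity on
  the normal line (this has the same determinant).  Only the vanishing or not of this
  quantity is used, so the sign convention is irrelevant.\<close>
definition gauss_curvature :: "(real^'n \<Rightarrow> real) \<Rightarrow> real^'n \<Rightarrow> real" where
  "gauss_curvature F p =
     (let n = unit_normal F p;
          L = (\<lambda>v. frechet_derivative (unit_normal F) (at p) (v - (v \<bullet> n) *\<^sub>R n) + (v \<bullet> n) *\<^sub>R n)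
      in det (matrix L))"

definition nonzero_gauss_curvature_at :: "(real^'n) set \<Rightarrow> real^'n \<Rightarrow> bool" where
  "nonzero_gauss_curvature_at M p \<longleftrightarrow>
     (\<exists>U F. local_defining_function M U F p \<and> gauss_curvature F p \<noteq> 0)"

section \<open>Hausdorff measure (normalised so that it equals arc length / surface area)\<close>

definition hausdorff_const :: "real \<Rightarrow> real" where
  "hausdorff_const s = unit_ball_vol s / 2 powr s"

definition hausdorff_outer :: "real \<Rightarrow> 'a::metric_space set \<Rightarrow> ennreal" where
  "hausdorff_outer s A =
     (SUP \<delta>\<in>{0<..}. INF C\<in>{C :: nat \<Rightarrow> 'a set. A \<subseteq> (\<Union>i. C i) \<and>
                                 (\<forall>i. bounded (C i) \<and> diameter (C i) \<le> \<delta>)}.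
        (\<Sum>i. ennreal (hausdorff_const s * diameter (C i) powr s)))"

definition hausdorff_measure :: "real \<Rightarrow> 'a::metric_space measure" where
  "hausdorff_measure s = measure_of UNIV (sets borel) (hausdorff_outer s)"

text \<open>Arc length (s = 1) / area (s = d-1) measure on a set A: Hausdorff measure restricted to A.\<close>
definition surface_measure_on :: "real \<Rightarrow> 'a::metric_space set \<Rightarrow> 'a measure" where
  "surface_measure_on s A = density (hausdorff_measure s) (indicator A)"

definition add_measure :: "'a measure \<Rightarrow> 'a measure \<Rightarrow> 'a measure" where
  "add_measure M N = measure_of (space M) (sets M) (\<lambda>A. emeasure M A + emeasure N A)"

definition exp_fun :: "real^'n \<Rightarrow> real^'n \<Rightarrow> complex" where
  "exp_fun l x = cis (2 * pi * (l \<bullet> x))"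

definition L2 :: "'a measure \<Rightarrow> ('a \<Rightarrow> complex) set" where
  "L2 M = {f. f \<in> borel_measurable M \<and> integrable M (\<lambda>x. (cmod (f x))\<^sup>2)}"

definition L2_inner :: "'a measure \<Rightarrow> ('a \<Rightarrow> complex) \<Rightarrow> ('a \<Rightarrow> complex) \<Rightarrow> complex" where
  "L2_inner M f g = (LINT x|M. f x * cnj (g x))"

definition L2_norm_sq :: "'a measure \<Rightarrow> ('a \<Rightarrow> complex) \<Rightarrow> real" where
  "L2_norm_sq M f = (LINT x|M. (cmod (f x))\<^sup>2)"

definition fourier_frame :: "(real^'n) measure \<Rightarrow> (real^'n) set \<Rightarrow> bool" where
  "fourier_frame M \<Lambda> \<longleftrightarrow> countable \<Lambda> \<and>
     (\<exists>A B. 0 < A \<and> 0 < B \<and>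
        (\<forall>f\<in>L2 M.
           (\<lambda>l. (cmod (L2_inner M f (exp_fun l)))\<^sup>2) summable_on \<Lambda> \<and>
           A * L2_norm_sq M f \<le> (\<Sum>\<^sub>\<infinity>l\<in>\<Lambda>. (cmod (L2_inner M f (exp_fun l)))\<^sup>2) \<and>
           (\<Sum>\<^sub>\<infinity>l\<in>\<Lambda>. (cmod (L2_inner M f (exp_fun l)))\<^sup>2) \<le> B * L2_norm_sq M f))"

definition admits_fourier_frame :: "(real^'n) measure \<Rightarrow> bool" where
  "admits_fourier_frame M \<longleftrightarrow> (\<exists>\<Lambda>. fourier_frame M \<Lambda>)"

end

(*
Write mu for the sum of the two measures and suppose that E(Lambda) is a frame. Testing the upper
frame bound on modulated indicators of balls of radius 1/(8R) about a point of the curve, whose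
mu-measure is at least of order 1/R, shows that every ball of radius R contains at most O(R) points
of Lambda. Near a point of non-zero curvature there is a bounded density g on the hypersurface
whose Fourier transform is O(|xi|^(-2/3)); since 2 * 2/3 > 1, the contribution to
sum |(g e_xi, e_lambda)|^2 of the lambda with |lambda - xi| > R tends to 0 as R grows, uniformly
in xi. So the lower frame bound for g e_xi forces Lambda to be relatively dense, and then large
balls contain too many points of Lambda.

The area measure is never computed: it suffices that it dominates a multiple of the push-forward
of Lebesgue measure under a graph parametrization Phi, because g is then obtained as a
Radon-Nikodym derivative. To avoid a type for R^(d-1), Phi is defined on an open subset of R^d
and ignores the k-th coordinate. The decay comes from expanding the square of the
oscillatory integral into an integral over differences u and integrating by parts twice, in a
coordinate direction depending on u in which the non-degenerate second fundamental form makes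
the derivative of the phase at least of order |xi| |u|.
*)
theory Submission
  imports Defs
begin

section \<open>Hausdorff measure\<close>

text \<open>The squared decay only has to beat the exponent 1: with O(R) frequencies in a ball of
  radius R, the dyadic shells around xi then add up like a geometric series. For a curved surface in
  R^3 the square really decays like |xi|^(-2), so there is room to be crude, and 4/3 is what two
  cuts in the autocorrelation integral yield. Dimension at least 3 supplies two tangential
  coordinates, in which small increments fill a small area. The final contradiction is read off in
  one coordinate plane: relative density produces n^2 distinct frequencies in a ball of radius
  proportional to n, where only O(n) are allowed.

  The function g should charge the surface only, while inner products are taken in L^2(mu). Taking
  the density of the push-forward with respect to mu itself, not to the area measure, settles this:
  the integral of g e_xi against mu is exactly an oscillatory integral over the parameter domain,
  however the curve meets the surface.\<close>

definition hausdorff_pre :: "real \<Rightarrow> real \<Rightarrow> 'a::metric_space set \<Rightarrow> ennreal" where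
  "hausdorff_pre s \<delta> A = (INF C\<in>{C :: nat \<Rightarrow> 'a set. A \<subseteq> (\<Union>i. C i) \<and>
                                 (\<forall>i. bounded (C i) \<and> diameter (C i) \<le> \<delta>)}.
        (\<Sum>i. ennreal (hausdorff_const s * diameter (C i) powr s)))"

lemma hausdorff_outer_eq: "hausdorff_outer s A = (SUP \<delta>\<in>{0<..}. hausdorff_pre s \<delta> A)"
  unfolding hausdorff_outer_def hausdorff_pre_def ..

lemma hausdorff_pre_leI:
  assumes "A \<subseteq> (\<Union>i. C i)" "\<And>i. bounded (C i)" "\<And>i. diameter (C i) \<le> \<delta>"
  shows "hausdorff_pre s \<delta> A \<le> (\<Sum>i. ennreal (hausdorff_const s * diameter (C i) powr s))"
  unfolding hausdorff_pre_def by (rule INF_lower) (use assms in auto)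

lemma hausdorff_pre_geI:
  assumes "\<And>C. A \<subseteq> (\<Union>i. C i) \<Longrightarrow> (\<And>i. bounded (C i)) \<Longrightarrow> (\<And>i. diameter (C i) \<le> \<delta>) \<Longrightarrow>
     x \<le> (\<Sum>i. ennreal (hausdorff_const s * diameter (C i) powr s))"
  shows "x \<le> hausdorff_pre s \<delta> A"
  unfolding hausdorff_pre_def by (rule INF_greatest) (use assms in auto)

lemma hausdorff_pre_le_outer: "0 < \<delta> \<Longrightarrow> hausdorff_pre s \<delta> A \<le> hausdorff_outer s A"
  unfolding hausdorff_outer_eq by (rule SUP_upper) auto

lemma hausdorff_pre_mono: "A \<subseteq> B \<Longrightarrow> hausdorff_pre s \<delta> A \<le> hausdorff_pre s \<delta> B"
  by (rule hausdorff_pre_geI, rule hausdorff_pre_leI) auto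

lemma hausdorff_pre_antimono: "\<delta> \<le> \<epsilon> \<Longrightarrow> hausdorff_pre s \<epsilon> A \<le> hausdorff_pre s \<delta> A"
  by (rule hausdorff_pre_geI, rule hausdorff_pre_leI) (auto intro: order_trans)

lemma hausdorff_outer_mono: "A \<subseteq> B \<Longrightarrow> hausdorff_outer s A \<le> hausdorff_outer s B"
  unfolding hausdorff_outer_eq by (rule SUP_mono) (auto intro: hausdorff_pre_mono)

lemma hausdorff_pre_empty: "0 \<le> \<delta> \<Longrightarrow> hausdorff_pre s \<delta> {} = 0"
  using hausdorff_pre_leI[of "{}" "\<lambda>_. {}" \<delta> s] by (simp add: diameter_def)

lemma hausdorff_outer_empty: "hausdorff_outer s {} = 0"
proof -
  have "hausdorff_outer s {} \<le> 0"
    unfolding hausdorff_outer_eq by (rule SUP_least) (simp add: hausdorff_pre_empty)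
  then show ?thesis by simp
qed

lemma hausdorff_pre_countable_subadd:
  fixes A :: "nat \<Rightarrow> 'a::metric_space set"
  shows "hausdorff_pre s \<delta> (\<Union>i. A i) \<le> (\<Sum>i. hausdorff_pre s \<delta> (A i))"
\<comment> \<open>Coverings that exceed the infimum by at most e / 2^(i+1) are guaranteed only where
  the infimum is finite, so an infinite term is split off.\<close>
proof (cases "\<exists>i. hausdorff_pre s \<delta> (A i) = \<infinity>")
  case True
  then obtain i where i: "hausdorff_pre s \<delta> (A i) = \<infinity>" by blast
  have "hausdorff_pre s \<delta> (A i) \<le> (\<Sum>i. hausdorff_pre s \<delta> (A i))"
    using sum_le_suminf[of "\<lambda>i. hausdorff_pre s \<delta> (A i)" "{i}"] by simp
  then show ?thesis using i by (simp add: top_unique)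
next
  case False
  let ?w = "\<lambda>C. ennreal (hausdorff_const s * diameter C powr s)"
  show ?thesis
  proof (rule ennreal_le_epsilon)
    fix e :: real assume e: "0 < e"
    have "\<exists>C. A i \<subseteq> (\<Union>j. C j) \<and> (\<forall>j. bounded (C j) \<and> diameter (C j) \<le> \<delta>) \<and>
        (\<Sum>j. ?w (C j)) \<le> hausdorff_pre s \<delta> (A i) + ennreal (e * (1/2) ^ Suc i)" for i
    proof -
      have lt: "hausdorff_pre s \<delta> (A i) < hausdorff_pre s \<delta> (A i) + ennreal (e * (1/2) ^ Suc i)"
        using False e by (simp add: less_top)
      have "\<exists>C\<in>{C. A i \<subseteq> (\<Union>j. C j) \<and> (\<forall>j. bounded (C j) \<and> diameter (C j) \<le> \<delta>)}.
         (\<Sum>j. ?w (C j)) < hausdorff_pre s \<delta> (A i) + ennreal (e * (1/2) ^ Suc i)"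
        using lt unfolding hausdorff_pre_def[of s \<delta> "A i"] INF_less_iff by simp
      then show ?thesis by (auto intro: less_imp_le)
    qed
    then obtain C where C: "\<And>i. A i \<subseteq> (\<Union>j. C i j)" "\<And>i j. bounded (C i j)"
        "\<And>i j. diameter (C i j) \<le> \<delta>"
        "\<And>i. (\<Sum>j. ?w (C i j)) \<le> hausdorff_pre s \<delta> (A i) + ennreal (e * (1/2) ^ Suc i)"
      by metis
    define D where "D n = (case prod_decode n of (i, j) \<Rightarrow> C i j)" for n
    have "hausdorff_pre s \<delta> (\<Union>i. A i) \<le> (\<Sum>n. ?w (D n))"
    proof (rule hausdorff_pre_leI)
      show "(\<Union>i. A i) \<subseteq> (\<Union>i. D i)"
      proof
        fix x assume "x \<in> (\<Union>i. A i)"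
        then obtain i j where "x \<in> C i j" using C(1) by blast
        then have "x \<in> D (prod_encode (i, j))" by (simp add: D_def)
        then show "x \<in> (\<Union>i. D i)" by blast
      qed
    qed (use C in \<open>auto simp: D_def split: prod.split\<close>)
    also have "\<dots> = (\<Sum>i. \<Sum>j. ?w (C i j))"
      using suminf_ennreal_2dimen[of "\<lambda>i. \<Sum>j. ?w (C i j)" "\<lambda>(i, j). ?w (C i j)"]
      by (simp add: D_def comp_def case_prod_unfold)
    also have "\<dots> \<le> (\<Sum>i. hausdorff_pre s \<delta> (A i) + ennreal (e * (1/2) ^ Suc i))"
      by (rule suminf_le) (use C(4) in auto)
    also have "\<dots> = (\<Sum>i. hausdorff_pre s \<delta> (A i)) + (\<Sum>i. ennreal (e * (1/2) ^ Suc i))"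
      by (simp add: suminf_add)
    also have "(\<Sum>i. ennreal (e * (1/2) ^ Suc i)) = ennreal e"
      using sums_mult[OF power_half_series, of e] e
      by (intro suminf_ennreal_eq) auto
    finally show "hausdorff_pre s \<delta> (\<Union>i. A i) \<le> (\<Sum>i. hausdorff_pre s \<delta> (A i)) + ennreal e" .
  qed
qed

lemma hausdorff_outer_countable_subadd:
  "hausdorff_outer s (\<Union>i. A i) \<le> (\<Sum>i. hausdorff_outer s (A (i::nat)))"
  unfolding hausdorff_outer_eq[of s "\<Union>i. A i"]
proof (rule SUP_least)
  fix \<delta> :: real assume "\<delta> \<in> {0<..}"
  then show "hausdorff_pre s \<delta> (\<Union>i. A i) \<le> (\<Sum>i. hausdorff_outer s (A i))"
    by (intro order_trans[OF hausdorff_pre_countable_subadd] suminf_le hausdorff_pre_le_outer) auto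
qed

lemma hausdorff_outer_Un: "hausdorff_outer s (A \<union> B) \<le> hausdorff_outer s A + hausdorff_outer s B"
proof -
  let ?X = "\<lambda>i::nat. if i = 0 then A else if i = 1 then B else {}"
  have "(\<Union>i. ?X i) = A \<union> B" by (auto split: if_splits)
  moreover have "(\<Sum>i. hausdorff_outer s (?X i)) = (\<Sum>i\<in>{0,1}. hausdorff_outer s (?X i))"
    by (rule suminf_finite) (auto simp: hausdorff_outer_empty)
  ultimately show ?thesis using hausdorff_outer_countable_subadd[of s ?X] by simp
qed

text \<open>A covering set of diameter at most \<delta> cannot meet both sets, so every covering of
  the union splits into a covering of each.\<close>

lemma hausdorff_pre_Un_separated:
  fixes A B :: "'a::metric_space set"
  assumes "0 < \<delta>" and sep: "\<And>x y. x \<in> A \<Longrightarrow> y \<in> B \<Longrightarrow> \<delta> < dist x y"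
  shows "hausdorff_pre s \<delta> A + hausdorff_pre s \<delta> B \<le> hausdorff_pre s \<delta> (A \<union> B)"
proof (rule hausdorff_pre_geI)
  fix C :: "nat \<Rightarrow> 'a set"
  let ?w = "\<lambda>C::'a set. ennreal (hausdorff_const s * diameter C powr s)"
  assume C: "A \<union> B \<subseteq> (\<Union>i. C i)" "\<And>i. bounded (C i)" "\<And>i. diameter (C i) \<le> \<delta>"
  \<comment> \<open>Covering sets that miss X are replaced by the empty set, which costs nothing:
    its diameter is 0 and \<open>0 powr s = 0\<close>.\<close>
  define P where "P X i = (if C i \<inter> X = {} then {} else C i)" for X i
  have le: "hausdorff_pre s \<delta> X \<le> (\<Sum>i. ?w (P X i))" if "X \<subseteq> A \<union> B" for X
  proof (rule hausdorff_pre_leI)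
    show "X \<subseteq> (\<Union>i. P X i)" using that C(1) by (fastforce simp: P_def)
  qed (use C \<open>0 < \<delta>\<close> in \<open>auto simp: P_def diameter_def[of "{}"]\<close>)
  have w: "?w (P A i) + ?w (P B i) \<le> ?w (C i)" for i
  proof -
    have "C i \<inter> A = {} \<or> C i \<inter> B = {}"
    proof (rule ccontr)
      assume "\<not> ?thesis"
      then obtain x y where "x \<in> A" "y \<in> B" "x \<in> C i" "y \<in> C i" by blast
      then show False
        using sep[of x y] diameter_bounded_bound[OF C(2), of x i y] C(3)[of i] by simp
    qed
    then show ?thesis by (auto simp: P_def diameter_def[of "{}"])
  qed
  have "hausdorff_pre s \<delta> A + hausdorff_pre s \<delta> B \<le> (\<Sum>i. ?w (P A i)) + (\<Sum>i. ?w (P B i))"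
    by (intro add_mono le) auto
  also have "\<dots> = (\<Sum>i. ?w (P A i) + ?w (P B i))" by (simp add: suminf_add)
  also have "\<dots> \<le> (\<Sum>i. ?w (C i))" by (rule suminf_le) (use w in auto)
  finally show "hausdorff_pre s \<delta> A + hausdorff_pre s \<delta> B \<le> (\<Sum>i. ?w (C i))" .
qed

text \<open>The two outer measures are suprema over independent scales; by antimonotonicity both are
  moved to one scale below e, where coverings split.\<close>

lemma hausdorff_outer_Un_separated:
  fixes A B :: "'a::metric_space set"
  assumes "0 < e" and sep: "\<And>x y. x \<in> A \<Longrightarrow> y \<in> B \<Longrightarrow> e \<le> dist x y"
  shows "hausdorff_outer s A + hausdorff_outer s B \<le> hausdorff_outer s (A \<union> B)"
proof -
  have "hausdorff_pre s \<delta> A + hausdorff_pre s \<epsilon> B \<le> hausdorff_outer s (A \<union> B)"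
    if "0 < \<delta>" "0 < \<epsilon>" for \<delta> \<epsilon>
  proof -
    define \<eta> where "\<eta> = min (e/2) (min \<delta> \<epsilon>)"
    have \<eta>: "0 < \<eta>" "\<eta> < e" "\<eta> \<le> \<delta>" "\<eta> \<le> \<epsilon>" using that assms(1) by (auto simp: \<eta>_def)
    have "hausdorff_pre s \<delta> A + hausdorff_pre s \<epsilon> B \<le> hausdorff_pre s \<eta> A + hausdorff_pre s \<eta> B"
      using \<eta> by (intro add_mono hausdorff_pre_antimono)
    also have "\<dots> \<le> hausdorff_pre s \<eta> (A \<union> B)"
      by (rule hausdorff_pre_Un_separated) (use \<eta> sep in force)+
    also have "\<dots> \<le> hausdorff_outer s (A \<union> B)" by (rule hausdorff_pre_le_outer) fact
    finally show ?thesis .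
  qed
  then have "(SUP \<delta>\<in>{0<..}. hausdorff_pre s \<delta> A) + hausdorff_pre s \<epsilon> B \<le> hausdorff_outer s (A \<union> B)"
    if "0 < \<epsilon>" for \<epsilon>
    using that
    by (subst ennreal_SUP_add_left[symmetric]) (auto intro!: SUP_least)
  then show ?thesis
    unfolding hausdorff_outer_eq[of s A] hausdorff_outer_eq[of s B]
    by (subst ennreal_SUP_add_right) (auto intro!: SUP_least)
qed

text \<open>Caratheodory's argument for metric outer measures. The parts \<open>B n\<close> of X at
  distance at least 1/(n+1) from F are separated from F. The rest of X - F is covered by the shells
  \<open>D j\<close>, whose outer measures have a finite sum because a shell is separated from the
  earlier shells of the same parity.\<close>

lemma closed_hausdorff_caratheodory:
  fixes F X :: "'a::metric_space set"
  assumes "closed F"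
  shows "hausdorff_outer s (F \<inter> X) + hausdorff_outer s (X - F) \<le> hausdorff_outer s X"
proof (cases "F = {} \<or> hausdorff_outer s X = \<infinity>")
  case True
  then show ?thesis by (auto simp: hausdorff_outer_empty)
next
  case False
  let ?H = "hausdorff_outer s :: 'a set \<Rightarrow> ennreal"
  have ne: "F \<noteq> {}" and fin: "?H X < \<infinity>" using False by (auto simp: less_top)
  define B where "B n = {x\<in>X. 1 / real (Suc n) \<le> infdist x F}" for n
  define D where "D n = B (Suc n) - B n" for n
  have inf_le: "infdist x F \<le> dist x y + infdist y F" for x y
    using infdist_triangle[of x F y] by simp
  have monoB: "B m \<subseteq> B n" if "m \<le> n" for m n
  proof -
    have "1 / real (Suc n) \<le> 1 / real (Suc m)" using that by (intro divide_left_mono) auto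
    then show ?thesis unfolding B_def by force
  qed
  have UB: "(\<Union>n. B n) = X - F"
  proof safe
    fix x assume "x \<in> X" "x \<notin> F"
    then have "0 < infdist x F" using assms ne by (simp add: infdist_pos_not_in_closed)
    then obtain n where "1 / real (Suc n) < infdist x F"
      by (rule nat_approx_posE)
    then have "x \<in> B n" using \<open>x \<in> X\<close> by (simp add: B_def)
    then show "x \<in> (\<Union>n. B n)" by blast
  qed (auto simp: B_def)
  have FB: "?H (F \<inter> X) + ?H (B n) \<le> ?H X" for n
  proof -
    have "?H (F \<inter> X) + ?H (B n) \<le> ?H (F \<inter> X \<union> B n)"
    proof (rule hausdorff_outer_Un_separated[where e = "1 / real (Suc n)"])
      fix x y assume "x \<in> F \<inter> X" "y \<in> B n"
      then show "1 / real (Suc n) \<le> dist x y"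
        using infdist_le[of x F y] by (auto simp: B_def dist_commute)
    qed simp
    also have "\<dots> \<le> ?H X" by (rule hausdorff_outer_mono) (auto simp: B_def)
    finally show ?thesis .
  qed
  \<comment> \<open>With the parity c fixed, the shells before \<open>D (2*n + c)\<close> lie in
    \<open>B (2*n + c - 1)\<close>, at distance at least 1/(2n+c) from F, while points of
    \<open>D (2*n + c)\<close> are closer to F than 1/(2n+c+1). The difference is the separation.
    For n = 0 the union is empty, which also disposes of the truncated subtraction.\<close>
  have part: "(\<Sum>j<n. ?H (D (2*j + c))) \<le> ?H (\<Union>j<n. D (2*j + c))" for n c
  proof (induction n)
    case (Suc n)
    let ?U = "\<Union>j<n. D (2*j + c)"
    have sub: "?U \<subseteq> B (2*n + c - 1)"
    proof (rule UN_least)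
      fix j assume "j \<in> {..<n}"
      then have "B (Suc (2*j + c)) \<subseteq> B (2*n + c - 1)" by (intro monoB) auto
      then show "D (2*j + c) \<subseteq> B (2*n + c - 1)" by (auto simp: D_def)
    qed
    have "?H ?U + ?H (D (2*n + c)) \<le> ?H (?U \<union> D (2*n + c))"
    proof (cases "n = 0")
      case False
      let ?e = "1 / real (2*n + c) - 1 / real (Suc (2*n + c))"
      show ?thesis
      proof (rule hausdorff_outer_Un_separated[where e = ?e])
        show "0 < ?e" using False by (simp add: divide_strict_left_mono)
        fix x y assume x: "x \<in> ?U" and y: "y \<in> D (2*n + c)"
        have "1 / real (2*n + c) \<le> infdist x F"
        proof -
          have "Suc (2*n + c - 1) = 2*n + c" using False by simp
          moreover have "x \<in> B (2*n + c - 1)" using sub x by blast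
          ultimately show ?thesis unfolding B_def by simp
        qed
        moreover have "infdist y F < 1 / real (Suc (2*n + c))"
          using y by (auto simp: D_def B_def)
        ultimately show "?e \<le> dist x y" using inf_le[of x y] by linarith
      qed
    qed (simp add: hausdorff_outer_empty)
    with add_right_mono[OF Suc.IH, of "?H (D (2*n + c))"]
    have "(\<Sum>j<Suc n. ?H (D (2*j + c))) \<le> ?H (?U \<union> D (2*n + c))"
      unfolding sum.lessThan_Suc by (rule order_trans)
    also have "?U \<union> D (2*n + c) = (\<Union>j<Suc n. D (2*j + c))"
      by (auto simp: lessThan_Suc)
    finally show ?case .
  qed simp
  have part': "(\<Sum>j. ?H (D (2*j + c))) \<le> ?H X" for c
  proof (rule suminf_le_const)
    fix n show "(\<Sum>j<n. ?H (D (2*j + c))) \<le> ?H X"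
      by (rule order_trans[OF part]) (auto intro!: hausdorff_outer_mono simp: D_def B_def)
  qed simp
  have tot: "(\<Sum>j. ?H (D j)) \<le> ?H X + ?H X"
  proof (rule suminf_le_const)
    fix n
    have "(\<Sum>j<n. ?H (D j)) \<le> (\<Sum>j<2*n. ?H (D j))" by (rule sum_mono2) auto
    also have "\<dots> = (\<Sum>j<n. ?H (D (2*j + 0))) + (\<Sum>j<n. ?H (D (2*j + 1)))"
      by (induction n) (simp_all add: algebra_simps)
    also have "\<dots> \<le> (\<Sum>j. ?H (D (2*j + 0))) + (\<Sum>j. ?H (D (2*j + 1)))"
      by (intro add_mono sum_le_suminf) auto
    also have "\<dots> \<le> ?H X + ?H X" by (intro add_mono part')
    finally show "(\<Sum>j<n. ?H (D j)) \<le> ?H X + ?H X" .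
  qed simp
  have fintot: "(\<Sum>j. ?H (D j)) < \<infinity>"
    using tot fin by (auto simp: less_top[symmetric] top_unique)
  have tail: "?H (X - F) \<le> ?H (B n) + (\<Sum>j. ?H (D (j + n)))" for n
  proof -
    have "B (n + m) \<subseteq> B n \<union> (\<Union>j. D (j + n))" for m
    proof (induction m)
      case (Suc m)
      have "B (n + Suc m) \<subseteq> B (n + m) \<union> D (m + n)" by (auto simp: D_def add.commute)
      then show ?case using Suc by blast
    qed simp
    then have "X - F \<subseteq> B n \<union> (\<Union>j. D (j + n))"
    proof -
      assume *: "\<And>m. B (n + m) \<subseteq> B n \<union> (\<Union>j. D (j + n))"
      have "B m \<subseteq> B n \<union> (\<Union>j. D (j + n))" for m
        using monoB[of m "n + m"] *[of m] by simp
      then show ?thesis unfolding UB[symmetric] by blast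
    qed
    then have "?H (X - F) \<le> ?H (B n \<union> (\<Union>j. D (j + n)))" by (rule hausdorff_outer_mono)
    also have "\<dots> \<le> ?H (B n) + ?H (\<Union>j. D (j + n))" by (rule hausdorff_outer_Un)
    also have "\<dots> \<le> ?H (B n) + (\<Sum>j. ?H (D (j + n)))"
      by (intro add_mono hausdorff_outer_countable_subadd) auto
    finally show ?thesis .
  qed
  let ?T = "\<Sum>j. ?H (D j)"
  \<comment> \<open>Adding the first n shells on the left completes the tail on the right to the
    full sum \<open>?T\<close>. As \<open>?T\<close> is finite it cancels after the supremum over n,
    so no limit of tails is taken.\<close>
  have "?H (F \<inter> X) + ?H (X - F) + (\<Sum>j<n. ?H (D j)) \<le> ?H X + ?T" for n
  proof -
    have "?H (F \<inter> X) + ?H (X - F) \<le> (?H (F \<inter> X) + ?H (B n)) + (\<Sum>j. ?H (D (j + n)))"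
      using add_left_mono[OF tail[of n], of "?H (F \<inter> X)"] by (simp add: add.assoc)
    also have "\<dots> \<le> ?H X + (\<Sum>j. ?H (D (j + n)))" by (intro add_right_mono FB)
    finally have "?H (F \<inter> X) + ?H (X - F) + (\<Sum>j<n. ?H (D j))
        \<le> ?H X + (\<Sum>j. ?H (D (j + n))) + (\<Sum>j<n. ?H (D j))"
      by (rule add_right_mono)
    also have "\<dots> = ?H X + ?T"
      using suminf_offset[of "\<lambda>j. ?H (D j)" n] by (simp add: add.assoc)
    finally show ?thesis .
  qed
  then have "(SUP n. ?H (F \<inter> X) + ?H (X - F) + (\<Sum>j<n. ?H (D j))) \<le> ?H X + ?T"
    by (intro SUP_least)
  then have "?H (F \<inter> X) + ?H (X - F) + ?T \<le> ?H X + ?T"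
    by (simp add: ennreal_SUP_add_right suminf_eq_SUP)
  then show ?thesis using fintot by (simp add: less_top[symmetric] add.commute[of _ ?T] ennreal_add_left_cancel_le)
qed

text \<open>\<open>measure_of\<close> yields the null measure unless its function is a measure, so
  \<open>hausdorff_measure\<close> has content only through this lemma. Closed sets satisfy
  Caratheodory's condition, hence so do all Borel sets.\<close>

lemma measure_space_hausdorff: "measure_space UNIV (sets (borel::'a::metric_space measure)) (hausdorff_outer s)"
proof -
  let ?H = "hausdorff_outer s :: 'a set \<Rightarrow> ennreal"
  interpret sigma_algebra UNIV "Pow (UNIV::'a set)" by (rule sigma_algebra_Pow)
  let ?L = "lambda_system UNIV (Pow UNIV) ?H"
  have oms: "outer_measure_space (Pow UNIV) ?H"
    unfolding outer_measure_space_def positive_def increasing_def countably_subadditive_def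
    by (auto intro: hausdorff_outer_mono hausdorff_outer_countable_subadd simp: hausdorff_outer_empty)
  have ms: "measure_space UNIV ?L ?H" by (rule caratheodory_lemma[OF oms])
  have cl: "{S. closed S} \<subseteq> ?L"
  proof (clarsimp simp: lambda_system_def)
    fix F X :: "'a set" assume "closed F"
    have "F \<inter> X \<union> (X - F) = X" by auto
    then have "?H X \<le> ?H (F \<inter> X) + ?H (X - F)"
      using hausdorff_outer_Un[of s "F \<inter> X" "X - F"] by simp
    then show "?H (F \<inter> X) + ?H ((UNIV - F) \<inter> X) = ?H X"
      using closed_hausdorff_caratheodory[OF \<open>closed F\<close>, of s X]
      by (metis Diff_Int_distrib2 Diff_Int2 Int_commute Int_UNIV_left antisym)
  qed
  have sa: "sigma_algebra UNIV ?L" using ms by (simp add: measure_space_def)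
  have "sets borel = sigma_sets UNIV {S::'a set. closed S}"
    by (subst borel_eq_closed) simp
  then have "sets borel \<subseteq> ?L"
    using sigma_algebra.sigma_sets_subset[OF sa cl] by simp
  moreover have "sigma_algebra UNIV (sets (borel::'a measure))"
    using sets.sigma_algebra_axioms[of "borel::'a measure"] by simp
  ultimately show ?thesis using measure_down[OF ms] by blast
qed

section \<open>Surface measures and their sum on Borel sets\<close>

lemma sets_hausdorff_measure [simp, measurable_cong]: "sets (hausdorff_measure s) = sets borel"
  unfolding hausdorff_measure_def using sets.sigma_sets_eq[of borel] by (simp add: sets_measure_of_conv)

lemma space_hausdorff_measure [simp]: "space (hausdorff_measure s) = UNIV"
  unfolding hausdorff_measure_def by (simp add: space_measure_of_conv)

lemma emeasure_hausdorff_measure: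
  assumes "E \<in> sets borel"
  shows "emeasure (hausdorff_measure s) E = hausdorff_outer s E"
  unfolding hausdorff_measure_def
  using measure_space_hausdorff[of s] assms
  by (intro emeasure_measure_of_sigma) (auto simp: measure_space_def)

lemma sets_surface_measure_on [simp, measurable_cong]: "sets (surface_measure_on s A) = sets borel"
  by (simp add: surface_measure_on_def)

lemma space_surface_measure_on [simp]: "space (surface_measure_on s A) = UNIV"
  by (simp add: surface_measure_on_def)

lemma emeasure_surface_measure_on:
  assumes "A \<in> sets borel" "E \<in> sets borel"
  shows "emeasure (surface_measure_on s A) E = hausdorff_outer s (E \<inter> A)"
proof -
  have "emeasure (surface_measure_on s A) E = (\<integral>\<^sup>+x. indicator A x * indicator E x \<partial>hausdorff_measure s)"
    unfolding surface_measure_on_def using assms by (intro emeasure_density borel_measurable_indicator) auto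
  also have "\<dots> = (\<integral>\<^sup>+x. indicator (E \<inter> A) x \<partial>hausdorff_measure s)"
    by (intro nn_integral_cong) (auto split: split_indicator)
  also have "\<dots> = hausdorff_outer s (E \<inter> A)"
    using assms by (simp add: emeasure_hausdorff_measure)
  finally show ?thesis .
qed

lemma sets_add_measure [simp, measurable_cong]: "sets (add_measure M N) = sets M"
  unfolding add_measure_def by simp

lemma space_add_measure [simp]: "space (add_measure M N) = space M"
  unfolding add_measure_def by simp

lemma emeasure_add_measure:
  assumes "sets N = sets M" "E \<in> sets M"
  shows "emeasure (add_measure M N) E = emeasure M E + emeasure N E"
  unfolding add_measure_def
proof (rule emeasure_measure_of_sigma)
  show "countably_additive (sets M) (\<lambda>A. emeasure M A + emeasure N A)"
    unfolding countably_additive_def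
  proof safe
    fix A :: "nat \<Rightarrow> 'a set" assume "range A \<subseteq> sets M" "disjoint_family A"
    then show "(\<Sum>i. emeasure M (A i) + emeasure N (A i)) = emeasure M (\<Union>i. A i) + emeasure N (\<Union>i. A i)"
      using suminf_emeasure[of A M] suminf_emeasure[of A N] assms(1) by (simp add: suminf_add[symmetric])
  qed
qed (use assms in \<open>auto simp: positive_def sets.sigma_algebra_axioms\<close>)

section \<open>Borel measurability of hypersurfaces and curves\<close>

lemma locally_borel_imp_borel:
  fixes S :: "'a::second_countable_topology set"
  assumes "\<And>p. p \<in> S \<Longrightarrow> \<exists>U. open U \<and> p \<in> U \<and> S \<inter> U \<in> sets borel"
  shows "S \<in> sets borel"
proof -
  define \<U> where "\<U> = {U. open U \<and> S \<inter> U \<in> sets borel}"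
  obtain \<V> where \<V>: "\<V> \<subseteq> \<U>" "countable \<V>" "\<Union>\<V> = \<Union>\<U>"
    using Lindelof[of \<U>] by (auto simp: \<U>_def)
  have "S = (\<Union>U\<in>\<V>. S \<inter> U)"
    using assms \<V>(3) unfolding \<U>_def by blast
  moreover have "(\<Union>U\<in>\<V>. S \<inter> U) \<in> sets borel"
    using \<V> by (intro sets.countable_UN') (auto simp: \<U>_def)
  ultimately show ?thesis by simp
qed

lemma smooth_hypersurface_borel:
  fixes S :: "(real^'n) set"
  assumes "smooth_hypersurface S"
  shows "S \<in> sets borel"
proof (rule locally_borel_imp_borel)
  fix p assume "p \<in> S"
  then obtain U F where U: "local_defining_function S U F p"
    using assms unfolding smooth_hypersurface_def by blast
  then have "Ck_on 0 U F" unfolding local_defining_function_def smooth_on_def by blast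
  then have cont: "continuous_on U F" by simp
  have "{x\<in>U. F x = 0} = U \<inter> F -` {0}" by auto
  moreover have "closedin (top_of_set U) (U \<inter> F -` {0})"
    by (rule continuous_closedin_preimage[OF cont]) simp
  then obtain T where "closed T" "U \<inter> F -` {0} = U \<inter> T"
    by (auto simp: closedin_closed)
  ultimately show "\<exists>U. open U \<and> p \<in> U \<and> S \<inter> U \<in> sets borel"
    using U unfolding local_defining_function_def by (intro exI[of _ U]) auto
qed

text \<open>A continuous image of a Borel set need not be Borel, so the open parameter set is
  exhausted by countably many compact boxes, whose images are compact.\<close>

lemma smooth_curve_borel:
  fixes C :: "(real^'n) set"
  assumes "smooth_curve C"
  shows "C \<in> sets borel"
proof (rule locally_borel_imp_borel)
  fix p assume "p \<in> C"
  then obtain U I and \<gamma> :: "real \<Rightarrow> real^'n" and g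
    where U: "open U" "p \<in> U" "open I" "homeomorphism I (C \<inter> U) \<gamma> g"
    using assms unfolding smooth_curve_def by meson
  then have im: "C \<inter> U = \<gamma> ` I" and cont: "continuous_on I \<gamma>"
    by (auto simp: homeomorphism_def)
  obtain K :: "nat \<Rightarrow> real set" where K: "\<And>n. compact (K n)" "I = (\<Union>n. K n)"
  proof -
    obtain \<D> where \<D>: "countable \<D>" "\<And>X. X \<in> \<D> \<Longrightarrow> \<exists>a b. X = cbox a b" "\<Union>\<D> = I"
      using open_countable_Union_open_cbox[OF \<open>open I\<close>] by metis
    \<comment> \<open>Inserting the empty set keeps the enumerated family non-empty, as
      \<open>from_nat_into\<close> requires.\<close>
    show thesis
    proof (rule that[of "from_nat_into (insert {} \<D>)"])
      show "compact (from_nat_into (insert {} \<D>) n)" for n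
        using from_nat_into[of "insert {} \<D>" n] \<D>(2) by (metis compact_cbox compact_empty insertE insert_not_empty)
      show "I = (\<Union>n. from_nat_into (insert {} \<D>) n)"
        using range_from_nat_into[of "insert {} \<D>"] \<D> by simp
    qed
  qed
  have "\<gamma> ` I = (\<Union>n. \<gamma> ` K n)" using K by auto
  moreover have "compact (\<gamma> ` K n)" for n
    using K by (intro compact_continuous_image continuous_on_subset[OF cont]) auto
  then have "(\<Union>n. \<gamma> ` K n) \<in> sets borel"
    by (intro sets.countable_UN) (auto intro: borel_compact)
  ultimately have "C \<inter> U \<in> sets borel" unfolding im by simp
  then show "\<exists>U. open U \<and> p \<in> U \<and> C \<inter> U \<in> sets borel" using U by blast
qed

lemma openin_borel:
  assumes "openin (top_of_set S) A" "S \<in> sets borel"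
  shows "A \<in> sets borel"
  using assms by (auto simp: openin_open)

text \<open>The distance to p is 1-Lipschitz, so it maps each covering set into an interval as long
  as its diameter; Lebesgue measure then bounds the sum of the diameters from below.\<close>

lemma hausdorff_outer_1_ge:
  fixes E :: "'a::metric_space set"
  assumes sub: "{0..<r} \<subseteq> dist p ` E"
  shows "ennreal r \<le> hausdorff_outer 1 E"
proof -
  have "ennreal r \<le> hausdorff_pre 1 1 E"
  proof (rule hausdorff_pre_geI)
    fix C :: "nat \<Rightarrow> 'a set"
    assume C: "E \<subseteq> (\<Union>i. C i)" "\<And>i. bounded (C i)" "\<And>i. diameter (C i) \<le> 1"
    define a where "a i = Inf (dist p ` C i)" for i
    define J where "J i = {a i..a i + diameter (C i)}" for i
    have inJ: "dist p x \<in> J i" if x: "x \<in> C i" for x i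
    proof -
      have "a i \<le> dist p x"
        unfolding a_def using x by (intro cInf_lower bdd_belowI[of _ 0]) auto
      moreover have "dist p x - diameter (C i) \<le> a i"
        unfolding a_def
      proof (rule cInf_greatest)
        fix v assume "v \<in> dist p ` C i"
        then obtain y where y: "y \<in> C i" "v = dist p y" by blast
        have "dist y x \<le> diameter (C i)" using C(2) x y by (intro diameter_bounded_bound)
        then show "dist p x - diameter (C i) \<le> v" using dist_triangle[of p x y] y by simp
      qed (use x in auto)
      ultimately show ?thesis by (simp add: J_def)
    qed
    have "ennreal r \<le> emeasure lborel {0..<r}" by (cases "0 \<le> r") (auto simp: ennreal_neg)
    also have "\<dots> \<le> emeasure lborel (\<Union>i. J i)"
    proof (rule emeasure_mono)
      show "{0..<r} \<subseteq> (\<Union>i. J i)"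
      proof
        fix v assume "v \<in> {0..<r}"
        then obtain x where "x \<in> E" "v = dist p x" using sub by blast
        moreover from this obtain i where "x \<in> C i" using C(1) by blast
        ultimately show "v \<in> (\<Union>i. J i)" using inJ by blast
      qed
    qed (auto simp: J_def)
    also have "\<dots> \<le> (\<Sum>i. emeasure lborel (J i))"
      by (rule emeasure_subadditive_countably) (auto simp: J_def)
    \<comment> \<open>\<open>hausdorff_const 1\<close> equals 1, the unit ball of the line having
      length 2.\<close>
    also have "\<dots> = (\<Sum>i. ennreal (hausdorff_const 1 * diameter (C i) powr 1))"
      using C(2) by (simp add: J_def hausdorff_const_def diameter_ge_0)
    finally show "ennreal r \<le> (\<Sum>i. ennreal (hausdorff_const 1 * diameter (C i) powr 1))" .
  qed
  also have "\<dots> \<le> hausdorff_outer 1 E" by (rule hausdorff_pre_le_outer) simp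
  finally show ?thesis .
qed

text \<open>By the intermediate value theorem the distance from p takes every value between 0 and
  its value at the end of a short arc starting at p, so no formula for arc length is involved. That
  end value is r0; it is positive because the parametrization is injective.\<close>

lemma smooth_curve_ball_length_ge:
  fixes C A :: "(real^'n) set"
  assumes "smooth_curve C" "openin (top_of_set C) A" "A \<noteq> {}"
  obtains q r0 where "0 < r0" "\<And>r. r \<le> r0 \<Longrightarrow> ennreal r \<le> hausdorff_outer 1 (ball q r \<inter> A)"
proof -
  obtain p where p: "p \<in> A" using assms by blast
  obtain T where T: "open T" "A = C \<inter> T" using assms(2) by (auto simp: openin_open)
  obtain U I and \<gamma> :: "real \<Rightarrow> real^'n" and g
    where U: "open U" "p \<in> U" "open I" "homeomorphism I (C \<inter> U) \<gamma> g"
  proof -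
    have "p \<in> C" using p T by blast
    show thesis
      using bspec[OF assms(1)[unfolded smooth_curve_def] \<open>p \<in> C\<close>]
      by (elim exE conjE) (rule that)
  qed
  have cont: "continuous_on I \<gamma>" and im: "\<gamma> ` I = C \<inter> U" and inv: "\<And>t. t \<in> I \<Longrightarrow> g (\<gamma> t) = t"
    using U(4) unfolding homeomorphism_def by simp_all
  have "p \<in> \<gamma> ` I" unfolding im using p T U(2) by simp
  then obtain t0 where t0: "t0 \<in> I" "\<gamma> t0 = p" by (auto simp: image_iff)
  have "open (I \<inter> \<gamma> -` T)" using cont U(3) T(1) by (rule continuous_open_preimage)
  moreover have "t0 \<in> I \<inter> \<gamma> -` T" using t0 p T by auto
  ultimately obtain e where e: "0 < e" "cball t0 e \<subseteq> I \<inter> \<gamma> -` T"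
    unfolding open_contains_cball by blast
  then have sub: "{t0..t0 + e} \<subseteq> I \<inter> \<gamma> -` T" by (force simp: dist_real_def)
  let ?\<phi> = "\<lambda>t. dist p (\<gamma> t)"
  have c\<phi>: "continuous_on {t0..t0+e} ?\<phi>"
    by (intro continuous_intros continuous_on_subset[OF cont]) (use sub in auto)
  have "\<gamma> (t0 + e) \<noteq> p"
  proof
    assume "\<gamma> (t0 + e) = p"
    moreover have "t0 + e \<in> I" using sub e(1) by auto
    ultimately show False using inv[of t0] inv[of "t0 + e"] t0 e(1) by simp
  qed
  then have pos: "0 < ?\<phi> (t0 + e)" by simp
  show thesis
  proof (rule that[OF pos, of p])
    fix r assume r: "r \<le> ?\<phi> (t0 + e)"
    show "ennreal r \<le> hausdorff_outer 1 (ball p r \<inter> A)"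
    proof (rule hausdorff_outer_1_ge[where p = p])
      show "{0..<r} \<subseteq> dist p ` (ball p r \<inter> A)"
      proof
        fix v assume v: "v \<in> {0..<r}"
        obtain t where t: "t0 \<le> t" "t \<le> t0 + e" "?\<phi> t = v"
          using IVT'[OF _ _ _ c\<phi>, of v] v r e(1) t0 by auto
        then have "t \<in> I \<inter> \<gamma> -` T" using sub by (simp add: subset_iff)
        then have "\<gamma> t \<in> A" using im T by blast
        then show "v \<in> dist p ` (ball p r \<inter> A)" using t v by auto
      qed
    qed
  qed
qed

section \<open>Frames and Fourier decay\<close>

lemma norm_exp_fun [simp]: "cmod (exp_fun l x) = 1"
  by (simp add: exp_fun_def)

lemma cnj_exp_fun: "cnj (exp_fun l x) = exp_fun (- l) x"
  by (simp add: exp_fun_def cis_cnj inner_minus_left)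

lemma exp_fun_add: "exp_fun (l + m) x = exp_fun l x * exp_fun m x"
  by (simp add: exp_fun_def cis_mult inner_add_left algebra_simps)

lemma exp_fun_add_right: "exp_fun l (x + y) = exp_fun l x * exp_fun l y"
  by (simp add: exp_fun_def cis_mult inner_add_right algebra_simps)

lemma continuous_exp_fun [continuous_intros]: "continuous_on S (exp_fun l)"
  unfolding exp_fun_def by (intro continuous_intros)

lemma borel_measurable_exp_fun [measurable]: "exp_fun l \<in> borel_measurable borel"
  by (intro borel_measurable_continuous_onI continuous_intros)

text \<open>For r = 1/(8R) and |x - l| < R the phase deviates from its value at q by at most 2 pi R
  r = pi/4, so its cosine stays above 1/2 and the inner product has modulus at least m/2. The upper
  bound gives card F * m^2/4 <= B m, and m >= r = 1/(8R) leads to the constant 32.\<close>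

lemma frame_card_ball_le:
  fixes \<mu> :: "(real^'n) measure" and \<Lambda> F :: "(real^'n) set"
  assumes "finite_measure \<mu>" and sets: "sets \<mu> = sets borel"
    and bessel: "\<And>f. f \<in> L2 \<mu> \<Longrightarrow> (\<lambda>l. (cmod (L2_inner \<mu> f (exp_fun l)))\<^sup>2) summable_on \<Lambda> \<and>
           (\<Sum>\<^sub>\<infinity>l\<in>\<Lambda>. (cmod (L2_inner \<mu> f (exp_fun l)))\<^sup>2) \<le> B * L2_norm_sq \<mu> f"
    and lower: "\<And>r. r \<le> r0 \<Longrightarrow> ennreal r \<le> emeasure \<mu> (ball q r)"
    and R: "0 < R" "1 / (8 * R) \<le> r0" and F: "finite F" "F \<subseteq> \<Lambda> \<inter> ball x R" and "0 < B"
  shows "real (card F) \<le> 32 * B * R"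
proof -
  interpret finite_measure \<mu> by fact
  have space [simp]: "space \<mu> = UNIV" using sets_eq_imp_space_eq[OF sets] by simp
  define r where "r = 1 / (8 * R)"
  have r: "0 < r" "r \<le> r0" using R by (auto simp: r_def)
  define m where "m = measure \<mu> (ball q r)"
  have rm: "r \<le> m" using lower[OF r(2)] r unfolding m_def by (simp add: emeasure_eq_measure)
  have m: "0 < m" using r rm by simp
  define f where "f y = (indicator (ball q r) y :: complex) * exp_fun x y" for y
  have mE: "borel_measurable \<mu> = borel_measurable borel" by (rule measurable_cong_sets[OF sets refl])
  have fm: "f \<in> borel_measurable \<mu>" unfolding f_def mE
    by (intro borel_measurable_times borel_measurable_indicator borel_measurable_exp_fun) auto
  have f2: "(cmod (f y))\<^sup>2 = indicator (ball q r) y" for y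
    by (simp add: f_def norm_mult split: split_indicator)
  have fL: "f \<in> L2 \<mu>" unfolding L2_def mem_Collect_eq f2 using fm by (auto simp: emeasure_eq_measure sets)
  have fN: "L2_norm_sq \<mu> f = m" unfolding L2_norm_sq_def f2 by (simp add: m_def sets)
  have each: "m / 2 \<le> cmod (L2_inner \<mu> f (exp_fun l))" if l: "l \<in> F" for l
  proof -
    have lR: "norm (x - l) < R" using l F by (auto simp: dist_norm)
    \<comment> \<open>A unimodular constant that recentres the phase at q, so that the real part of
      the integrand can be estimated.\<close>
    let ?c = "exp_fun (l - x) q"
    let ?k = "\<lambda>y. indicator (ball q r) y *\<^sub>R exp_fun (x - l) (y - q)"
    have km: "?k \<in> borel_measurable \<mu>"
      unfolding mE by (intro borel_measurable_scaleR borel_measurable_indicator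
          measurable_compose[OF _ borel_measurable_exp_fun]) auto
    have int: "integrable \<mu> ?k"
      by (rule integrable_const_bound[of _ 1, OF _ km]) (auto split: split_indicator)
    have eq: "?c * (f y * cnj (exp_fun l y)) = ?k y" for y
    proof -
      have "exp_fun (x - l) (y - q) = exp_fun (x - l) y * exp_fun (x - l) (- q)"
        using exp_fun_add_right[of "x - l" y "- q"] by simp
      also have "exp_fun (x - l) (- q) = ?c" by (simp add: exp_fun_def inner_diff_left)
      also have "exp_fun (x - l) y = exp_fun x y * cnj (exp_fun l y)"
        using exp_fun_add[of x "- l" y] by (simp add: cnj_exp_fun)
      finally show ?thesis by (simp add: f_def split: split_indicator)
    qed
    have "m / 2 = (LINT y|\<mu>. indicator (ball q r) y * (1/2))"
      by (simp add: m_def sets)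
    also have "\<dots> \<le> (LINT y|\<mu>. Re (?k y))"
    proof (rule integral_mono)
      show "integrable \<mu> (\<lambda>y. Re (?k y))" using int by (rule integrable_Re)
      show "integrable \<mu> (\<lambda>y. indicator (ball q r) y * (1/2::real))"
        by (rule integrable_const_bound[of _ 1])
           (auto simp: mE split: split_indicator intro!: borel_measurable_divide borel_measurable_indicator)
      fix y
      show "indicator (ball q r) y * (1/2) \<le> Re (?k y)"
      proof (cases "y \<in> ball q r")
        case True
        define \<theta> where "\<theta> = 2 * pi * ((x - l) \<bullet> (y - q))"
        have "\<bar>(x - l) \<bullet> (y - q)\<bar> \<le> norm (x - l) * norm (y - q)" by (rule Cauchy_Schwarz_ineq2)
        also have "\<dots> \<le> R * r"
          using lR True R by (intro mult_mono) (auto simp: dist_norm norm_minus_commute)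
        finally have "\<bar>\<theta>\<bar> \<le> 2 * pi * (R * r)" by (simp add: \<theta>_def abs_mult)
        then have "\<bar>\<theta>\<bar> \<le> pi / 3" using R pi_gt_zero by (simp add: r_def)
        then have "cos (pi / 3) \<le> cos \<bar>\<theta>\<bar>" by (intro cos_monotone_0_pi_le) auto
        then show ?thesis using True by (simp add: exp_fun_def \<theta>_def cos_60)
      qed simp
    qed
    also have "\<dots> = Re (LINT y|\<mu>. ?k y)" by (rule integral_Re[OF int])
    also have "\<dots> \<le> cmod (LINT y|\<mu>. ?k y)" by (rule complex_Re_le_cmod)
    also have "(LINT y|\<mu>. ?k y) = ?c * L2_inner \<mu> f (exp_fun l)"
      unfolding L2_inner_def eq[symmetric] by simp
    finally show ?thesis by (simp add: norm_mult)
  qed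
  have "real (card F) * (m/2)\<^sup>2 = (\<Sum>l\<in>F. (m/2)\<^sup>2)" by simp
  also have "\<dots> \<le> (\<Sum>l\<in>F. (cmod (L2_inner \<mu> f (exp_fun l)))\<^sup>2)"
    using m by (intro sum_mono power_mono each) auto
  also have "\<dots> \<le> (\<Sum>\<^sub>\<infinity>l\<in>\<Lambda>. (cmod (L2_inner \<mu> f (exp_fun l)))\<^sup>2)"
    using bessel[OF fL] F by (intro finite_sum_le_infsum) auto
  also have "\<dots> \<le> B * m" using bessel[OF fL] fN by simp
  finally have "real (card F) * m \<le> 4 * B" using m by (simp add: power2_eq_square field_simps)
  then have "real (card F) * r \<le> 4 * B"
    using rm by (meson mult_left_mono of_nat_0_le_iff order_trans)
  then show ?thesis using R by (simp add: r_def field_simps)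
qed

lemma dyadic_interval:
  assumes "1 \<le> (x::real)"
  shows "\<exists>k::nat. 2 ^ k \<le> x \<and> x < 2 ^ Suc k"
proof -
  obtain n where "x < 2 ^ n" using real_arch_pow[of 2 x] by auto
  define k where "k = (LEAST n. x < 2 ^ n)"
  have "x < 2 ^ k" unfolding k_def by (rule LeastI) fact
  moreover have "k \<noteq> 0" using assms calculation by (cases k) auto
  moreover have "\<not> x < 2 ^ (k - 1)" using not_less_Least[of "k - 1" "\<lambda>n. x < 2 ^ n"] \<open>k \<noteq> 0\<close> by (simp add: k_def)
  ultimately show ?thesis by (intro exI[of _ "k - 1"]) auto
qed

text \<open>Shell k holds at most C * 2^(k+1) points, each of weight at most D * 2^(-b k). The
  shells form a geometric series of ratio 2^(1-b), which is below 1 because b > 1.\<close>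

lemma sum_decay_le:
  fixes F :: "'a::real_normed_vector set"
  assumes F: "finite F" and far: "\<And>l. l \<in> F \<Longrightarrow> 2 ^ K \<le> norm (l - \<xi>)"
    and card: "\<And>k. K \<le> k \<Longrightarrow> real (card (F \<inter> ball \<xi> (2 ^ Suc k))) \<le> C * 2 ^ Suc k"
    and dec: "\<And>l. l \<in> F \<Longrightarrow> w l \<le> D * norm (l - \<xi>) powr (- b)"
    and "0 \<le> C" "0 \<le> D" "1 < b"
  shows "sum w F \<le> 2 * C * D * ((2 powr (1 - b)) ^ K / (1 - 2 powr (1 - b)))"
proof -
  define \<rho> where "\<rho> = (2::real) powr (1 - b)"
  have \<rho>: "0 < \<rho>" "\<rho> < 1" using \<open>1 < b\<close> by (auto simp: \<rho>_def powr_less_one)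
  have "\<exists>k::nat. 2 ^ k \<le> norm (l - \<xi>) \<and> norm (l - \<xi>) < 2 ^ Suc k" if "l \<in> F" for l
    using far[OF that] by (intro dyadic_interval) (meson one_le_numeral one_le_power order_trans)
  then obtain \<kappa> :: "'a \<Rightarrow> nat" where \<kappa>: "\<And>l. l \<in> F \<Longrightarrow> 2 ^ \<kappa> l \<le> norm (l - \<xi>) \<and> norm (l - \<xi>) < 2 ^ Suc (\<kappa> l)"
    by metis
  have \<kappa>K: "K \<le> \<kappa> l" if "l \<in> F" for l
  proof -
    have "(2::real) ^ K < 2 ^ Suc (\<kappa> l)" using far[OF that] \<kappa>[OF that] by linarith
    then have "K < Suc (\<kappa> l)" by (subst (asm) power_strict_increasing_iff) auto
    then show ?thesis by simp
  qed
  obtain M where M: "\<kappa> ` F \<subseteq> {K..<M}"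
  proof -
    have "finite (\<kappa> ` F)" using F by simp
    then obtain M where "\<forall>k\<in>\<kappa> ` F. k < M" by (meson finite_nat_set_iff_bounded)
    then show thesis using \<kappa>K by (intro that[of M]) auto
  qed
  have "sum w F = (\<Sum>k\<in>{K..<M}. \<Sum>l\<in>{l\<in>F. \<kappa> l = k}. w l)"
    using M F by (intro sum.group[symmetric]) auto
  also have "\<dots> \<le> (\<Sum>k\<in>{K..<M}. 2 * C * D * \<rho> ^ k)"
  proof (rule sum_mono)
    fix k assume k: "k \<in> {K..<M}"
    let ?G = "{l\<in>F. \<kappa> l = k}"
    have "(\<Sum>l\<in>?G. w l) \<le> (\<Sum>l\<in>?G. D * (2 ^ k) powr (- b))"
    proof (rule sum_mono)
      fix l assume l: "l \<in> ?G"
      have "w l \<le> D * norm (l - \<xi>) powr (- b)" using l dec by auto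
      also have "\<dots> \<le> D * (2 ^ k) powr (- b)"
        using \<kappa>[of l] l assms by (intro mult_left_mono powr_mono2') auto
      finally show "w l \<le> D * (2 ^ k) powr (- b)" .
    qed
    also have "\<dots> = real (card ?G) * (D * (2 ^ k) powr (- b))" by simp
    also have "\<dots> \<le> (C * 2 ^ Suc k) * (D * (2 ^ k) powr (- b))"
    proof (rule mult_right_mono)
      have "card ?G \<le> card (F \<inter> ball \<xi> (2 ^ Suc k))"
        using F \<kappa> by (intro card_mono) (auto simp: dist_norm norm_minus_commute)
      then show "real (card ?G) \<le> C * 2 ^ Suc k" using card[of k] k by simp
    qed (use assms in auto)
    also have "\<dots> = 2 * C * D * \<rho> ^ k"
    proof -
      have "\<rho> ^ k = 2 ^ k * (2 ^ k) powr (- b)"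
        by (simp add: \<rho>_def powr_realpow[symmetric] powr_powr powr_add[symmetric] algebra_simps)
      then show ?thesis by (simp add: algebra_simps)
    qed
    finally show "(\<Sum>l\<in>?G. w l) \<le> 2 * C * D * \<rho> ^ k" .
  qed
  also have "\<dots> = 2 * C * D * (\<Sum>k\<in>{K..<M}. \<rho> ^ k)" by (simp add: sum_distrib_left)
  also have "\<dots> \<le> 2 * C * D * (\<rho> ^ K / (1 - \<rho>))"
  proof (rule mult_left_mono)
    show "(\<Sum>k\<in>{K..<M}. \<rho> ^ k) \<le> \<rho> ^ K / (1 - \<rho>)"
    proof (cases "K < M")
      case True
      then have "K \<le> M" by simp
      then have "(\<Sum>k\<in>{K..<M}. \<rho> ^ k) * (1 - \<rho>) = \<rho> ^ K - \<rho> ^ M"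
        by (induction M rule: dec_induct) (auto simp: distrib_right left_diff_distrib right_diff_distrib)
      also have "\<dots> \<le> \<rho> ^ K" using \<rho> by simp
      finally show ?thesis using \<rho> by (simp add: field_simps)
    qed (use \<rho> in auto)
  qed (use assms in auto)
  finally show ?thesis by (simp add: \<rho>_def)
qed

lemma no_fourier_frame_if_decay:
  fixes \<mu> :: "(real^'n) measure"
  assumes n2: "2 \<le> CARD('n)" and "finite_measure \<mu>" and sets: "sets \<mu> = sets borel"
    and r0: "0 < r0" "\<And>r. r \<le> r0 \<Longrightarrow> ennreal r \<le> emeasure \<mu> (ball q r)"
    and g: "(\<lambda>x. complex_of_real (g x)) \<in> L2 \<mu>" "0 < (LINT x|\<mu>. (g x)\<^sup>2)"
    and decay: "\<And>\<xi>. 1 \<le> norm \<xi> \<Longrightarrow> (cmod (LINT x|\<mu>. of_real (g x) * exp_fun \<xi> x))\<^sup>2 \<le> D * norm \<xi> powr (- b)"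
    and "1 < b"
  shows "\<not> admits_fourier_frame \<mu>"
proof
  assume "admits_fourier_frame \<mu>"
  then obtain \<Lambda> A B where A: "0 < A" and B: "0 < B" and frame: "\<And>f. f \<in> L2 \<mu> \<Longrightarrow>
           (\<lambda>l. (cmod (L2_inner \<mu> f (exp_fun l)))\<^sup>2) summable_on \<Lambda> \<and>
           A * L2_norm_sq \<mu> f \<le> (\<Sum>\<^sub>\<infinity>l\<in>\<Lambda>. (cmod (L2_inner \<mu> f (exp_fun l)))\<^sup>2) \<and>
           (\<Sum>\<^sub>\<infinity>l\<in>\<Lambda>. (cmod (L2_inner \<mu> f (exp_fun l)))\<^sup>2) \<le> B * L2_norm_sq \<mu> f"
    unfolding admits_fourier_frame_def fourier_frame_def by meson
  define C where "C = 32 * B"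
  have C: "0 < C" using B by (simp add: C_def)
  \<comment> \<open>From this radius on, the test balls of radius 1/(8R) are no larger than
    r0.\<close>
  define R0 where "R0 = 1 / (8 * r0)"
  have R0: "0 < R0" using r0 by (simp add: R0_def)
  have cardF: "real (card F) \<le> C * R" if "R0 \<le> R" "finite F" "F \<subseteq> \<Lambda> \<inter> ball x R" for F R x
  proof -
    have "0 < R" using that R0 by simp
    moreover have "1 / (8 * R) \<le> r0" using that(1) r0(1) calculation by (simp add: R0_def field_simps)
    ultimately show ?thesis
      unfolding C_def using frame r0(2) B that
      by (intro frame_card_ball_le[OF \<open>finite_measure \<mu>\<close> sets, of \<Lambda> B r0 q]) auto
  qed
  define N where "N = (LINT x|\<mu>. (g x)\<^sup>2)"
  have N: "0 < N" using g by (simp add: N_def)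
  \<comment> \<open>At a unit vector the decay estimate bounds a square by D, so D cannot be
    negative.\<close>
  have D: "0 \<le> D"
  proof -
    let ?e = "axis undefined 1 :: real^'n"
    have "0 \<le> D * norm ?e powr (- b)"
      using decay[of ?e] by (smt (verit) norm_axis_1 zero_le_power2)
    then show ?thesis by simp
  qed
  define \<rho> where "\<rho> = (2::real) powr (1 - b)"
  have \<rho>: "0 < \<rho>" "\<rho> < 1" using \<open>1 < b\<close> by (auto simp: \<rho>_def powr_less_one)
  \<comment> \<open>This is the bound for the contribution of all frequencies at distance at least
    2^K. Once it is below A * N, the lower frame bound forbids a ball of radius 2^K without
    frequencies.\<close>
  have "(\<lambda>K. 2 * C * D * (\<rho> ^ K / (1 - \<rho>))) \<longlonglongrightarrow> 2 * C * D * (0 / (1 - \<rho>))"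
    using \<rho> by (intro tendsto_intros LIMSEQ_power_zero) auto
  then have "\<forall>\<^sub>F K in sequentially. 2 * C * D * (\<rho> ^ K / (1 - \<rho>)) < A * N"
    using A N by (intro order_tendstoD(2)) auto
  moreover have "\<forall>\<^sub>F K in sequentially. R0 \<le> 2 ^ K"
  proof -
    obtain K0 where "R0 < 2 ^ K0" using real_arch_pow[of 2 R0] by auto
    then have "R0 \<le> 2 ^ K" if "K0 \<le> K" for K
      using power_increasing[OF that, of "2::real"] that by linarith
    then show ?thesis by (auto simp: eventually_sequentially)
  qed
  ultimately have "\<forall>\<^sub>F K in sequentially. 2 * C * D * (\<rho> ^ K / (1 - \<rho>)) < A * N \<and> R0 \<le> 2 ^ K"
    by (rule eventually_conj)
  then obtain K where K: "2 * C * D * (\<rho> ^ K / (1 - \<rho>)) < A * N" "R0 \<le> 2 ^ K"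
    using eventually_happens'[OF sequentially_bot] by blast
  define R where "R = (2::real) ^ K"
  have R: "0 < R" "R0 \<le> R" using K(2) by (auto simp: R_def)
  have dense: "\<exists>l\<in>\<Lambda>. norm (l - \<xi>) < R" for \<xi> :: "real^'n"
  proof (rule ccontr)
    assume "\<not> ?thesis"
    then have far: "2 ^ K \<le> norm (l - \<xi>)" if "l \<in> \<Lambda>" for l using that by (auto simp: R_def)
    define f where "f x = complex_of_real (g x) * exp_fun \<xi> x" for x
    have mE: "borel_measurable \<mu> = borel_measurable borel" by (rule measurable_cong_sets[OF sets refl])
    have f2: "(cmod (f x))\<^sup>2 = (g x)\<^sup>2" for x by (simp add: f_def norm_mult)
    have fL: "f \<in> L2 \<mu>" using g(1) unfolding L2_def mem_Collect_eq f2
      unfolding f_def mE by (auto intro!: borel_measurable_times)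
    have fN: "L2_norm_sq \<mu> f = N" unfolding L2_norm_sq_def f2 N_def ..
    let ?w = "\<lambda>l. (cmod (L2_inner \<mu> f (exp_fun l)))\<^sup>2"
    have w: "?w l \<le> D * norm (l - \<xi>) powr (- b)" if "l \<in> \<Lambda>" for l
    proof -
      have "L2_inner \<mu> f (exp_fun l) = (LINT x|\<mu>. of_real (g x) * exp_fun (\<xi> - l) x)"
        unfolding L2_inner_def f_def
        using exp_fun_add[of \<xi> "- l"] by (simp add: cnj_exp_fun mult.assoc)
      moreover have "1 \<le> norm (\<xi> - l)" using far[OF that]
        by (metis norm_minus_commute one_le_numeral one_le_power order_trans)
      ultimately show ?thesis using decay[of "\<xi> - l"] by (simp add: norm_minus_commute)
    qed
    have "A * N \<le> (\<Sum>\<^sub>\<infinity>l\<in>\<Lambda>. ?w l)" using frame[OF fL] fN by simp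
    also have "\<dots> \<le> 2 * C * D * (\<rho> ^ K / (1 - \<rho>))"
    proof (rule infsum_le_finite_sums)
      show "?w summable_on \<Lambda>" using frame[OF fL] by simp
      fix F assume F: "finite F" "F \<subseteq> \<Lambda>"
      show "sum ?w F \<le> 2 * C * D * (\<rho> ^ K / (1 - \<rho>))"
        unfolding \<rho>_def
      proof (rule sum_decay_le[where \<xi> = \<xi>])
        fix k assume k: "K \<le> k"
        have "R0 \<le> 2 ^ Suc k"
          using K(2) power_increasing[of K "Suc k" "2::real"] k by simp
        then show "real (card (F \<inter> ball \<xi> (2 ^ Suc k))) \<le> C * 2 ^ Suc k"
          using F by (intro cardF) auto
      qed (use F far w C D \<open>1 < b\<close> in auto)
    qed
    finally show False using K(1) by simp
  qed
  obtain i j :: 'n where ij: "i \<noteq> j"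
    using n2 card_le_Suc0_iff_eq[of "UNIV::'n set"] by fastforce
  \<comment> \<open>A square grid of spacing 3R in the plane of the coordinates i and j. Frequencies
    within R of distinct grid points are distinct, since a common one would put the grid points less
    than 2R apart.\<close>
  define p where "p = (\<lambda>(a::nat, b::nat). (3 * R * a) *\<^sub>R axis i 1 + (3 * R * b) *\<^sub>R axis j 1 :: real^'n)"
  have pc: "p (a, b) $ i = 3 * R * a" "p (a, b) $ j = 3 * R * b" for a b
    using ij by (auto simp: p_def axis_def)
  have "\<forall>z. \<exists>l. l \<in> \<Lambda> \<and> norm (l - p z) < R" using dense by blast
  from choice[OF this] obtain pt where pt: "\<And>z. pt z \<in> \<Lambda>" "\<And>z. norm (pt z - p z) < R"
    by blast
  \<comment> \<open>The grid points have norm at most 6Rn and each chosen frequency is within R of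
    its grid point; as n >= 1, all of them lie in the ball of radius 7Rn.\<close>
  have bound: "real n * real n \<le> C * (7 * R * n)" if "1 \<le> n" for n :: nat
  proof -
    let ?Z = "{..<n} \<times> {..<n}"
    have inj: "inj_on pt ?Z"
    proof (rule inj_onI)
      fix z z' assume eq: "pt z = pt z'"
      obtain a b a' b' where z: "z = (a, b)" "z' = (a', b')" by fastforce
      have d: "norm (p z - p z') < 2 * R"
        using norm_triangle_ineq4[of "pt z' - p z'" "pt z - p z"] pt(2)[of z] pt(2)[of z'] eq by simp
      have "\<bar>3 * R * a - 3 * R * a'\<bar> < 2 * R" "\<bar>3 * R * b - 3 * R * b'\<bar> < 2 * R"
        using component_le_norm_cart[of "p z - p z'" i] component_le_norm_cart[of "p z - p z'" j] d
        by (auto simp: z pc)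
      moreover have "3 * R * u - 3 * R * v = R * (3 * (u - v))" for u v :: real
        by (simp add: algebra_simps)
      ultimately have "R * \<bar>3 * (real a - real a')\<bar> < R * 2" "R * \<bar>3 * (real b - real b')\<bar> < R * 2"
        using R(1) by (simp_all only: abs_mult abs_of_pos mult.commute)
      then have "\<bar>3 * (real a - real a')\<bar> < 2" "\<bar>3 * (real b - real b')\<bar> < 2"
        using R(1) by (auto simp only: mult_less_cancel_left_pos)
      then have "real a < real (a' + 1)" "real a' < real (a + 1)" "real b < real (b' + 1)" "real b' < real (b + 1)"
        by (simp_all add: abs_if split: if_splits)
      then have "a = a'" "b = b'" unfolding of_nat_less_iff by simp_all
      then show "z = z'" by (simp add: z)
    qed
    have "real n * real n = real (card (pt ` ?Z))" using inj by (simp add: card_image)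
    also have "\<dots> \<le> C * (7 * R * n)"
    proof (rule cardF[where x = 0])
      have "R * 1 \<le> R * (7 * real n)" using that R by (intro mult_left_mono) auto
      then have "R \<le> 7 * R * n" by (simp only: mult_1_right ac_simps)
      then show "R0 \<le> 7 * R * n" using R by linarith
      have "norm (pt z) < 7 * R * n" if z: "z \<in> ?Z" for z
      proof -
        obtain a b where ab: "z = (a, b)" by fastforce
        have "norm (p z) \<le> 3 * R * a + 3 * R * b"
          using norm_triangle_ineq[of "(3 * R * a) *\<^sub>R axis i 1 :: real^'n" "(3 * R * b) *\<^sub>R axis j 1"] R
          by (simp add: p_def ab)
        also have "\<dots> \<le> 3 * R * n + 3 * R * n"
          using z ab R by (intro add_mono mult_left_mono) auto
        finally have "norm (pt z) < 6 * R * n + R"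
          using pt(2)[of z] norm_triangle_ineq[of "pt z - p z" "p z"] by simp
        moreover have "R \<le> R * n" using \<open>1 \<le> n\<close> R by simp
        ultimately show ?thesis by simp
      qed
      then show "pt ` ?Z \<subseteq> \<Lambda> \<inter> ball 0 (7 * R * n)" using pt(1) by auto
    qed auto
    finally show ?thesis .
  qed
  obtain n :: nat where n: "C * (7 * R) < real n" using reals_Archimedean2 by blast
  have "1 \<le> n" using n C R by (cases n) (auto simp: mult_less_0_iff)
  then have "real n * real n \<le> C * (7 * R) * real n" using bound[of n] by (simp add: mult.assoc)
  then show False using n \<open>1 \<le> n\<close> by simp
qed

section \<open>Oscillatory integrals\<close>

lemma integral_lborel_translate:
  fixes f :: "'a::euclidean_space \<Rightarrow> 'b::{banach,second_countable_topology}"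
  assumes "f \<in> borel_measurable borel"
  shows "(LINT z|lborel. f (z + c)) = (LINT z|lborel. f z)"
proof -
  have "(LINT z|lborel. f z) = (LINT z|distr lborel borel ((+) c). f z)"
    by (simp add: lborel_distr_plus)
  also have "\<dots> = (LINT z|lborel. f (c + z))"
    by (rule integral_distr) (use assms in auto)
  finally show ?thesis by (simp add: add.commute)
qed

lemma integrable_continuous_compact_support:
  fixes f :: "'a::euclidean_space \<Rightarrow> 'b::{banach,second_countable_topology}"
  assumes "continuous_on UNIV f" "compact K" "\<And>z. z \<notin> K \<Longrightarrow> f z = 0"
  shows "integrable lborel f"
proof -
  have "integrable lborel (\<lambda>x. indicator K x *\<^sub>R f x)"
    by (rule borel_integrable_compact) (use assms continuous_on_subset in blast)+
  moreover have "indicator K x *\<^sub>R f x = f x" for x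
    using assms(3)[of x] by (auto split: split_indicator)
  ultimately show ?thesis by simp
qed

text \<open>Each integration by parts uses one fixed direction, so differentiability along lines
  suffices. The derivative is given as a function of the point, which lets the predicate be
  iterated.\<close>

definition has_dir_deriv :: "'a::real_normed_vector \<Rightarrow> ('a \<Rightarrow> 'b::real_normed_vector) \<Rightarrow> ('a \<Rightarrow> 'b) \<Rightarrow> 'a \<Rightarrow> bool" where
  "has_dir_deriv v f f' z \<longleftrightarrow> ((\<lambda>t. f (z + t *\<^sub>R v)) has_vector_derivative f' z) (at 0)"

lemma has_dir_deriv_at:
  assumes "has_dir_deriv v f f' (z + t *\<^sub>R v)"
  shows "((\<lambda>t. f (z + t *\<^sub>R v)) has_vector_derivative f' (z + t *\<^sub>R v)) (at t)"
proof -
  have "((\<lambda>s. f (z + t *\<^sub>R v + s *\<^sub>R v)) has_vector_derivative f' (z + t *\<^sub>R v)) (at (t - t))"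
    using assms by (simp add: has_dir_deriv_def)
  moreover have "((\<lambda>s. s - t) has_vector_derivative 1) (at t)"
    by (auto intro!: derivative_eq_intros)
  ultimately have "(((\<lambda>s. f (z + t *\<^sub>R v + s *\<^sub>R v)) \<circ> (\<lambda>s. s - t)) has_vector_derivative 1 *\<^sub>R f' (z + t *\<^sub>R v)) (at t)"
    by (intro vector_diff_chain_at)
  then show ?thesis by (simp add: comp_def algebra_simps)
qed

text \<open>By translation invariance the integral of G(z+v) - G(z) is zero. Writing the difference
  as the integral of G'(z+sv) over s in [0,1] and exchanging the integrals gives the integral of G',
  so the space need not be sliced along v.\<close>

lemma integral_dir_deriv_eq_0:
  fixes G G' :: "'a::euclidean_space \<Rightarrow> complex"
  assumes der: "\<And>z. has_dir_deriv v G G' z"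
    and cont: "continuous_on UNIV G" "continuous_on UNIV G'"
    and "compact K" and zero: "\<And>z. z \<notin> K \<Longrightarrow> G z = 0" "\<And>z. z \<notin> K \<Longrightarrow> G' z = 0"
  shows "(LINT z|lborel. G' z) = 0"
proof -
  have int: "integrable lborel G" "integrable lborel G'"
    using integrable_continuous_compact_support[OF cont(1) \<open>compact K\<close> zero(1)]
      integrable_continuous_compact_support[OF cont(2) \<open>compact K\<close> zero(2)] by auto
  have meas: "G \<in> borel_measurable borel" "G' \<in> borel_measurable borel"
    using cont by (auto intro: borel_measurable_continuous_onI)
  obtain r where r: "K \<subseteq> cball 0 r"
    using compact_imp_bounded[OF \<open>compact K\<close>] unfolding bounded_iff by (auto simp: subset_iff)
  \<comment> \<open>For s in [0,1] the function z -> G'(z+sv) vanishes outside the ball of radius r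
    + |v|, so the integrand for Fubini's theorem lives on this compact cylinder.\<close>
  define S where "S = {0..1::real} \<times> cball (0::'a) (r + norm v)"
  let ?f = "\<lambda>(s::real, z). G' (z + s *\<^sub>R v)"
  have "integrable lborel (\<lambda>x. indicator S x *\<^sub>R ?f x)"
  proof (rule borel_integrable_compact)
    show "compact S" by (auto simp: S_def intro: compact_Times)
    have "continuous_on S (\<lambda>x. G' (snd x + fst x *\<^sub>R v))"
      by (rule continuous_on_compose2[OF cont(2)]) (auto intro!: continuous_intros)
    then show "continuous_on S ?f" by (simp add: case_prod_unfold)
  qed
  moreover have eq: "indicator S (s, z) *\<^sub>R ?f (s, z) = indicator {0..1} s *\<^sub>R G' (z + s *\<^sub>R v)" for s z
  proof (cases "s \<in> {0..1} \<and> z \<notin> cball 0 (r + norm v)")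
    case True
    have "norm z \<le> norm (z + s *\<^sub>R v) + norm (s *\<^sub>R v)"
      using norm_triangle_ineq4[of "z + s *\<^sub>R v" "s *\<^sub>R v"] by simp
    also have "norm (s *\<^sub>R v) \<le> norm v" using True by (simp add: mult_left_le_one_le)
    finally have "z + s *\<^sub>R v \<notin> K" using r True by auto
    then show ?thesis using zero by simp
  qed (auto simp: S_def split: split_indicator)
  moreover have "(\<lambda>x. indicator S x *\<^sub>R ?f x) = (\<lambda>(s, z). indicator {0..1} s *\<^sub>R G' (z + s *\<^sub>R v))"
    by (intro ext) (use eq in auto)
  ultimately have int2: "integrable (lborel \<Otimes>\<^sub>M lborel) (\<lambda>(s, z). indicator {0..1} s *\<^sub>R G' (z + s *\<^sub>R v))"
    unfolding lborel_prod by simp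
  have ftc: "G (z + v) - G z = (LINT s|lborel. indicator {0..1} s *\<^sub>R G' (z + s *\<^sub>R v))" for z
  proof -
    have "has_bochner_integral lborel (\<lambda>s. indicator {0..1} s *\<^sub>R G' (z + s *\<^sub>R v)) (G (z + 1 *\<^sub>R v) - G (z + 0 *\<^sub>R v))"
    proof (rule has_bochner_integral_FTC_Icc)
      fix s :: real
      show "((\<lambda>s. G (z + s *\<^sub>R v)) has_vector_derivative G' (z + s *\<^sub>R v)) (at s within {0..1})"
        using has_dir_deriv_at[OF der] by (rule has_vector_derivative_at_within)
      show "continuous_on {0..1} (\<lambda>s. G' (z + s *\<^sub>R v))"
        by (rule continuous_on_compose2[OF cont(2)]) (auto intro!: continuous_intros)
    qed simp
    then show ?thesis by (simp add: has_bochner_integral_integral_eq)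
  qed
  have "(LINT z|lborel. (LINT s|lborel. indicator {0..1} s *\<^sub>R G' (z + s *\<^sub>R v)))
      = (LINT s|lborel. (LINT z|lborel. indicator {0..1} s *\<^sub>R G' (z + s *\<^sub>R v)))"
    using lborel_pair.Fubini_integral[OF int2] by simp
  also have "\<dots> = (LINT s|lborel. indicator {0..1::real} s *\<^sub>R (LINT z|lborel. G' z))"
    using meas by (simp add: integral_lborel_translate)
  also have "\<dots> = (LINT z|lborel. G' z)" by simp
  finally have "(LINT z|lborel. G' z) = (LINT z|lborel. G (z + v) - G z)" by (simp add: ftc)
  also have "\<dots> = (LINT z|lborel. G (z + v)) - (LINT z|lborel. G z)"
  proof (rule Bochner_Integration.integral_diff)
    show "integrable lborel (\<lambda>z. G (z + v))"
      using integrable_distr[of "(+) v" lborel borel G] int(1)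
      by (simp add: lborel_distr_plus add.commute)
  qed (rule int)
  also have "\<dots> = 0" using meas by (simp add: integral_lborel_translate)
  finally show ?thesis .
qed

lemma norm_integral_le_bound_on_compact:
  fixes f :: "'a::euclidean_space \<Rightarrow> 'b::{banach,second_countable_topology}"
  assumes "compact K" "\<And>z. z \<notin> K \<Longrightarrow> f z = 0" "\<And>z. z \<in> K \<Longrightarrow> norm (f z) \<le> B" "0 \<le> B"
  shows "norm (LINT z|lborel. f z) \<le> B * measure lborel K"
proof -
  have K: "K \<in> sets lborel" "emeasure lborel K < \<infinity>"
    using \<open>compact K\<close> emeasure_bounded_finite[OF compact_imp_bounded] by (auto intro: borel_compact)
  have "norm (LINT z|lborel. f z) \<le> (LINT z|lborel. norm (f z))" by (rule integral_norm_bound)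
  also have "\<dots> \<le> (LINT z|lborel. B * indicator K z)"
    using K assms(2-4) by (intro integral_mono') (auto split: split_indicator)
  also have "\<dots> = B * measure lborel K" using K by simp
  finally show ?thesis .
qed

text \<open>Phases are controlled only on the open set W; a factor supported in a closed subset of W
  removes their arbitrary values elsewhere.\<close>

lemma continuous_on_mult_support:
  fixes c :: "'a::topological_space \<Rightarrow> 'b::real_normed_algebra"
  assumes "open W" "closed K" "K \<subseteq> W" "continuous_on UNIV c" "continuous_on W f" "\<And>z. z \<notin> K \<Longrightarrow> c z = 0"
  shows "continuous_on UNIV (\<lambda>z. c z * f z)"
proof -
  have "continuous_on (W \<union> - K) (\<lambda>z. c z * f z)"
  proof (rule continuous_on_open_Un)
    show "continuous_on W (\<lambda>z. c z * f z)"
      by (intro continuous_intros continuous_on_subset[OF assms(4)] assms) auto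
    have "continuous_on (- K) (\<lambda>z. 0 :: 'b)" by simp
    then show "continuous_on (- K) (\<lambda>z. c z * f z)"
      by (rule continuous_on_eq) (simp add: assms(6))
  qed (use assms in auto)
  moreover have "W \<union> - K = UNIV" using assms(3) by auto
  ultimately show ?thesis by simp
qed

lemma has_dir_deriv_0_off_closed:
  assumes "closed K" "z \<notin> K" "\<And>z. z \<notin> K \<Longrightarrow> G z = 0" "G' z = 0"
  shows "has_dir_deriv v G G' z"
proof -
  have "open ((\<lambda>t. z + t *\<^sub>R v) -` (- K))"
    using \<open>closed K\<close> by (intro continuous_open_vimage) (auto intro!: continuous_intros)
  moreover have "0 \<in> (\<lambda>t. z + t *\<^sub>R v) -` (- K)" using assms by simp
  ultimately have "((\<lambda>t. G (z + t *\<^sub>R v)) has_vector_derivative 0) (at 0)"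
    using assms(3)
    by (intro has_vector_derivative_transform_within_open[OF has_vector_derivative_const[of 0]]) auto
  then show ?thesis by (simp add: has_dir_deriv_def assms(4))
qed

lemma has_dir_deriv_mult:
  fixes f g :: "'a::real_normed_vector \<Rightarrow> real"
  assumes "has_dir_deriv v f f' z" "has_dir_deriv v g g' z"
  shows "has_dir_deriv v (\<lambda>z. f z * g z) (\<lambda>z. f' z * g z + f z * g' z) z"
  using has_vector_derivative_mult[OF assms[unfolded has_dir_deriv_def]]
  by (simp add: has_dir_deriv_def add.commute)

lemma has_dir_deriv_diff:
  assumes "has_dir_deriv v f f' z" "has_dir_deriv v g g' z"
  shows "has_dir_deriv v (\<lambda>z. f z - g z) (\<lambda>z. f' z - g' z) z"
  using has_vector_derivative_diff[OF assms[unfolded has_dir_deriv_def]]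
  by (simp add: has_dir_deriv_def)

lemma has_dir_deriv_add:
  assumes "has_dir_deriv v f f' z" "has_dir_deriv v g g' z"
  shows "has_dir_deriv v (\<lambda>z. f z + g z) (\<lambda>z. f' z + g' z) z"
  using has_vector_derivative_add[OF assms[unfolded has_dir_deriv_def]]
  by (simp add: has_dir_deriv_def)

lemma has_dir_deriv_const: "has_dir_deriv v (\<lambda>z. c) (\<lambda>z. 0) z"
  by (simp add: has_dir_deriv_def)

lemma has_dir_deriv_cmult:
  fixes f :: "'a::real_normed_vector \<Rightarrow> real"
  assumes "has_dir_deriv v f f' z"
  shows "has_dir_deriv v (\<lambda>z. c * f z) (\<lambda>z. c * f' z) z"
  using has_dir_deriv_mult[OF has_dir_deriv_const assms, of c] by simp

lemma has_dir_deriv_translate: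
  assumes "has_dir_deriv v f f' (z + u)"
  shows "has_dir_deriv v (\<lambda>z. f (z + u)) (\<lambda>z. f' (z + u)) z"
  using assms by (simp add: has_dir_deriv_def add.assoc add.commute[of u])

lemma has_dir_deriv_inverse:
  fixes f :: "'a::real_normed_vector \<Rightarrow> real"
  assumes "has_dir_deriv v f f' z" "f z \<noteq> 0"
  shows "has_dir_deriv v (\<lambda>z. inverse (f z)) (\<lambda>z. - (f' z * inverse (f z) ^ 2)) z"
  using assms unfolding has_dir_deriv_def has_real_derivative_iff_has_vector_derivative[symmetric]
  by (auto intro!: derivative_eq_intros simp: power2_eq_square)

lemma has_dir_deriv_cis:
  fixes c \<theta> :: "'a::real_normed_vector \<Rightarrow> real"
  assumes "has_dir_deriv v c c' z" "has_dir_deriv v \<theta> \<theta>1 z"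
  shows "has_dir_deriv v (\<lambda>z. of_real (c z) * cis (\<theta> z))
           (\<lambda>z. of_real (c' z) * cis (\<theta> z) + \<i> * (of_real (c z * \<theta>1 z) * cis (\<theta> z))) z"
proof -
  have 1: "((\<lambda>t. complex_of_real (c (z + t *\<^sub>R v))) has_vector_derivative of_real (c' z)) (at 0)"
    using bounded_linear.has_vector_derivative[OF bounded_linear_of_real assms(1)[unfolded has_dir_deriv_def]] .
  have "(exp has_field_derivative exp (\<i> * of_real (\<theta> z))) (at (\<i> * of_real (\<theta> (z + 0 *\<^sub>R v))))"
    by (simp add: DERIV_exp)
  moreover have "((\<lambda>t. \<i> * of_real (\<theta> (z + t *\<^sub>R v))) has_vector_derivative \<i> * of_real (\<theta>1 z)) (at 0)"
    using bounded_linear.has_vector_derivative[OF bounded_linear_of_real assms(2)[unfolded has_dir_deriv_def]]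
    by (intro has_vector_derivative_mult_right)
  ultimately have 2: "((exp \<circ> (\<lambda>t. \<i> * of_real (\<theta> (z + t *\<^sub>R v)))) has_vector_derivative
      \<i> * of_real (\<theta>1 z) * exp (\<i> * of_real (\<theta> z))) (at 0)"
    by (intro field_vector_diff_chain_at)
  have "(\<lambda>t. cis (\<theta> (z + t *\<^sub>R v))) = exp \<circ> (\<lambda>t. \<i> * of_real (\<theta> (z + t *\<^sub>R v)))"
    by (auto simp: cis_conv_exp)
  with 2 have 2: "((\<lambda>t. cis (\<theta> (z + t *\<^sub>R v))) has_vector_derivative \<i> * of_real (\<theta>1 z) * cis (\<theta> z)) (at 0)"
    by (simp add: cis_conv_exp)
  show ?thesis
    using has_vector_derivative_mult[OF 1 2] by (simp add: has_dir_deriv_def algebra_simps)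
qed

section \<open>Integration by parts against an oscillating factor\<close>

abbreviation osc_int :: "('a::euclidean_space \<Rightarrow> real) \<Rightarrow> ('a \<Rightarrow> real) \<Rightarrow> complex" where
  "osc_int b \<theta> \<equiv> (LINT z|lborel. of_real (b z) * cis (\<theta> z))"

text \<open>For c = b / \<theta>1, with derivative c' along v, the derivative of c cis \<theta> is
  (c' + i b) cis \<theta>, and its integral is zero.\<close>

lemma oscillatory_by_parts:
  fixes b b1 c' \<theta> \<theta>1 \<theta>2 :: "'a::euclidean_space \<Rightarrow> real"
  assumes W: "open W" "compact K" "K \<subseteq> W"
    and cont: "continuous_on UNIV b" "continuous_on UNIV b1"
      "continuous_on W \<theta>" "continuous_on W \<theta>1" "continuous_on W \<theta>2"
    and zero: "\<And>z. z \<notin> K \<Longrightarrow> b z = 0" "\<And>z. z \<notin> K \<Longrightarrow> b1 z = 0"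
    and der: "\<And>z. z \<in> W \<Longrightarrow> has_dir_deriv v b b1 z"
      "\<And>z. z \<in> W \<Longrightarrow> has_dir_deriv v \<theta> \<theta>1 z" "\<And>z. z \<in> W \<Longrightarrow> has_dir_deriv v \<theta>1 \<theta>2 z"
    and nz: "\<And>z. z \<in> W \<Longrightarrow> \<theta>1 z \<noteq> 0"
    and c'_def: "c' = (\<lambda>z. b1 z * inverse (\<theta>1 z) - b z * (\<theta>2 z * inverse (\<theta>1 z) ^ 2))"
  shows "osc_int b \<theta> = \<i> * osc_int c' \<theta>"
    and "continuous_on UNIV c'" and "\<And>z. z \<notin> K \<Longrightarrow> c' z = 0"
proof -
  define c where "c z = b z * inverse (\<theta>1 z)" for z
  have K: "closed K" using W by (simp add: compact_imp_closed)
  have cinv: "continuous_on W (\<lambda>z. inverse (\<theta>1 z))"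
    using cont nz by (intro continuous_intros) auto
  have cc: "continuous_on UNIV c" unfolding c_def
    by (rule continuous_on_mult_support[OF W(1) K W(3) cont(1) cinv zero(1)])
  show cc': "continuous_on UNIV c'" unfolding c'_def
    by (intro continuous_on_diff continuous_on_mult_support[OF W(1) K W(3)] cont zero
          continuous_on_mult continuous_on_power cinv)
  show c'0: "c' z = 0" if "z \<notin> K" for z using zero that by (simp add: c'_def)
  have c0: "c z = 0" if "z \<notin> K" for z using zero that by (simp add: c_def)
  have dc: "has_dir_deriv v c c' z" if "z \<in> W" for z
    using has_dir_deriv_mult[OF der(1)[OF that] has_dir_deriv_inverse[OF der(3)[OF that] nz[OF that]]]
    by (simp add: c_def[abs_def] c'_def)
  let ?G = "\<lambda>z. of_real (c z) * cis (\<theta> z)"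
  let ?G' = "\<lambda>z. of_real (c' z) * cis (\<theta> z) + \<i> * (of_real (c z * \<theta>1 z) * cis (\<theta> z))"
  have ccis: "continuous_on W (\<lambda>z. cis (\<theta> z))" by (intro continuous_intros cont)
  have cof: "continuous_on UNIV (\<lambda>z. complex_of_real (f z))" if "continuous_on UNIV f" for f
    using that by (intro continuous_intros)
  have cG: "continuous_on UNIV ?G"
    by (rule continuous_on_mult_support[OF W(1) K W(3) cof[OF cc] ccis]) (simp add: c0)
  have ct: "continuous_on UNIV (\<lambda>z. c z * \<theta>1 z)"
    by (rule continuous_on_mult_support[OF W(1) K W(3) cc cont(4) c0])
  have cG1: "continuous_on UNIV (\<lambda>z. of_real (c' z) * cis (\<theta> z))"
    by (rule continuous_on_mult_support[OF W(1) K W(3) cof[OF cc'] ccis]) (simp add: c'0)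
  have cG2: "continuous_on UNIV (\<lambda>z. of_real (c z * \<theta>1 z) * cis (\<theta> z))"
    by (rule continuous_on_mult_support[OF W(1) K W(3) cof[OF ct] ccis]) (simp add: c0)
  have cG': "continuous_on UNIV ?G'" by (intro continuous_intros cG1 cG2)
  have "(LINT z|lborel. ?G' z) = 0"
  proof (rule integral_dir_deriv_eq_0[OF _ cG cG' W(2)])
    fix z show "has_dir_deriv v ?G ?G' z"
    proof (cases "z \<in> W")
      case True
      then show ?thesis by (intro has_dir_deriv_cis dc der)
    next
      case False
      then have "z \<notin> K" using W(3) by auto
      then show ?thesis by (intro has_dir_deriv_0_off_closed[OF K]) (simp_all add: c0 c'0)
    qed
  qed (simp_all add: c0 c'0)
  moreover have "(LINT z|lborel. ?G' z) = osc_int c' \<theta>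
      + \<i> * (LINT z|lborel. of_real (c z * \<theta>1 z) * cis (\<theta> z))"
    using integrable_continuous_compact_support[OF cG1 W(2)] integrable_continuous_compact_support[OF cG2 W(2)]
    by (simp add: c0 c'0)
  moreover have "c z * \<theta>1 z = b z" for z
    using nz[of z] zero(1)[of z] W(3) by (cases "z \<in> K") (auto simp: c_def)
  ultimately have *: "osc_int c' \<theta> + \<i> * osc_int b \<theta> = 0"
    by simp
  then have "\<i> * (osc_int c' \<theta> + \<i> * osc_int b \<theta>) = 0"
    by simp
  then show "osc_int b \<theta> = \<i> * osc_int c' \<theta>"
    by (simp add: distrib_left mult.assoc[symmetric])
qed

text \<open>The second derivative of the phase is measured in units of lam, so an integration by
  parts gains 1/lam and costs a factor depending only on B.\<close>

lemma oscillatory_bound_1: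
  fixes b b1 \<theta> \<theta>1 \<theta>2 :: "'a::euclidean_space \<Rightarrow> real"
  assumes W: "open W" "compact K" "K \<subseteq> W"
    and cont: "continuous_on UNIV b" "continuous_on UNIV b1"
      "continuous_on W \<theta>" "continuous_on W \<theta>1" "continuous_on W \<theta>2"
    and zero: "\<And>z. z \<notin> K \<Longrightarrow> b z = 0" "\<And>z. z \<notin> K \<Longrightarrow> b1 z = 0"
    and der: "\<And>z. z \<in> W \<Longrightarrow> has_dir_deriv v b b1 z"
      "\<And>z. z \<in> W \<Longrightarrow> has_dir_deriv v \<theta> \<theta>1 z" "\<And>z. z \<in> W \<Longrightarrow> has_dir_deriv v \<theta>1 \<theta>2 z"
    and lam: "0 < lam" "\<And>z. z \<in> W \<Longrightarrow> lam \<le> \<bar>\<theta>1 z\<bar>" "\<And>z. z \<in> W \<Longrightarrow> \<bar>\<theta>2 z\<bar> \<le> B * lam"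
    and M: "\<And>z. \<bar>b z\<bar> \<le> M" "\<And>z. \<bar>b1 z\<bar> \<le> M" and "0 \<le> B" "0 \<le> M"
  shows "cmod (osc_int b \<theta>) \<le> M * (1 + B) / lam * measure lborel K"
proof -
  have nz: "\<And>z. z \<in> W \<Longrightarrow> \<theta>1 z \<noteq> 0" using lam by force
  define c where "c = (\<lambda>z. b1 z * inverse (\<theta>1 z) - b z * (\<theta>2 z * inverse (\<theta>1 z) ^ 2))"
  note P = oscillatory_by_parts[OF W cont zero der nz c_def]
  have P1: "osc_int b \<theta> = \<i> * osc_int c \<theta>"
    by (rule P(1))
  have "\<bar>c z\<bar> \<le> M * (1 + B) / lam" if "z \<in> K" for z
  proof -
    have zW: "z \<in> W" using that W by auto
    have inv: "\<bar>inverse (\<theta>1 z)\<bar> \<le> 1 / lam"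
      using lam zW by (simp add: abs_inverse inverse_eq_divide frac_le)
    have "\<bar>b1 z * inverse (\<theta>1 z)\<bar> \<le> M * (1 / lam)"
      unfolding abs_mult using M inv \<open>0 \<le> M\<close> by (intro mult_mono) auto
    moreover have "\<bar>b z * (\<theta>2 z * inverse (\<theta>1 z) ^ 2)\<bar> \<le> M * ((B * lam) * (1 / lam)^2)"
      unfolding abs_mult power_abs using M inv lam zW \<open>0 \<le> M\<close> \<open>0 \<le> B\<close>
      by (intro mult_mono power_mono) auto
    moreover have "M * ((B * lam) * (1 / lam)^2) = M * B / lam" using lam by (simp add: power2_eq_square)
    moreover have "M * (1 / lam) + M * B / lam = M * (1 + B) / lam" by (simp add: add_divide_distrib distrib_left)
    ultimately show ?thesis unfolding c_def
      using abs_triangle_ineq4[of "b1 z * inverse (\<theta>1 z)" "b z * (\<theta>2 z * inverse (\<theta>1 z) ^ 2)"] by linarith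
  qed
  moreover have "c z = 0" if "z \<notin> K" for z using zero that by (simp add: c_def)
  ultimately have "cmod (osc_int c \<theta>) \<le> M * (1 + B) / lam * measure lborel K"
    using lam(1) \<open>0 \<le> B\<close> \<open>0 \<le> M\<close>
    by (intro norm_integral_le_bound_on_compact W) (auto simp: norm_mult)
  then show ?thesis unfolding P1 by (simp add: norm_mult)
qed

text \<open>One integration by parts produces an amplitude c of order 1/lam, to which
  \<open>oscillatory_bound_1\<close> is applied. Its derivative \<open>c1\<close> has one term with
  \<open>b2\<close>, three terms bounded through B, and twice a term bounded through B^2, whence 1 +
  3B + 2B^2.\<close>

lemma oscillatory_bound_2:
  fixes b b1 b2 \<theta> \<theta>1 \<theta>2 \<theta>3 :: "'a::euclidean_space \<Rightarrow> real"
  assumes W: "open W" "compact K" "K \<subseteq> W"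
    and cont: "continuous_on UNIV b" "continuous_on UNIV b1" "continuous_on UNIV b2"
      "continuous_on W \<theta>" "continuous_on W \<theta>1" "continuous_on W \<theta>2" "continuous_on W \<theta>3"
    and zero: "\<And>z. z \<notin> K \<Longrightarrow> b z = 0" "\<And>z. z \<notin> K \<Longrightarrow> b1 z = 0" "\<And>z. z \<notin> K \<Longrightarrow> b2 z = 0"
    and der: "\<And>z. z \<in> W \<Longrightarrow> has_dir_deriv v b b1 z" "\<And>z. z \<in> W \<Longrightarrow> has_dir_deriv v b1 b2 z"
      "\<And>z. z \<in> W \<Longrightarrow> has_dir_deriv v \<theta> \<theta>1 z" "\<And>z. z \<in> W \<Longrightarrow> has_dir_deriv v \<theta>1 \<theta>2 z"
      "\<And>z. z \<in> W \<Longrightarrow> has_dir_deriv v \<theta>2 \<theta>3 z"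
    and lam: "0 < lam" "\<And>z. z \<in> W \<Longrightarrow> lam \<le> \<bar>\<theta>1 z\<bar>" "\<And>z. z \<in> W \<Longrightarrow> \<bar>\<theta>2 z\<bar> \<le> B * lam"
      "\<And>z. z \<in> W \<Longrightarrow> \<bar>\<theta>3 z\<bar> \<le> B * lam"
    and M: "\<And>z. \<bar>b z\<bar> \<le> M" "\<And>z. \<bar>b1 z\<bar> \<le> M" "\<And>z. \<bar>b2 z\<bar> \<le> M" and "0 \<le> B" "0 \<le> M"
  shows "cmod (osc_int b \<theta>) \<le> M * (1 + 3 * B + 2 * B^2) * (1 + B) / lam^2 * measure lborel K"
proof -
  have nz: "\<And>z. z \<in> W \<Longrightarrow> \<theta>1 z \<noteq> 0" using lam by force
  define q where "q z = inverse (\<theta>1 z)" for z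
  define c where "c = (\<lambda>z. b1 z * q z - b z * (\<theta>2 z * q z ^ 2))"
  define c1 where "c1 = (\<lambda>z. (b2 z * q z - b1 z * (\<theta>2 z * q z ^ 2)) -
     (b1 z * (\<theta>2 z * q z ^ 2) + b z * (\<theta>3 z * q z ^ 2 - 2 * (\<theta>2 z ^ 2 * q z ^ 3))))"
  have "c = (\<lambda>z. b1 z * inverse (\<theta>1 z) - b z * (\<theta>2 z * inverse (\<theta>1 z) ^ 2))"
    by (simp add: c_def q_def)
  note P = oscillatory_by_parts[OF W cont(1,2,4,5,6) zero(1,2) der(1,3,4) nz this]
  have P1: "osc_int b \<theta> = \<i> * osc_int c \<theta>"
    by (rule P(1))
  have P2: "continuous_on UNIV c" by (rule P(2))
  have P3: "c z = 0" if "z \<notin> K" for z by (rule P(3)) (use that in auto)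
  let ?M = "M * (1 + 3 * B + 2 * B^2) / lam"
  have cq: "continuous_on W q" unfolding q_def using cont nz by (intro continuous_intros) auto
  have K: "closed K" using W by (simp add: compact_imp_closed)
  have cc1: "continuous_on UNIV c1" unfolding c1_def
    by (intro continuous_on_diff continuous_on_add continuous_on_mult_support[OF W(1) K W(3)] cont zero
          continuous_on_mult continuous_on_power cq continuous_on_const)
  have c10: "c1 z = 0" if "z \<notin> K" for z using zero that by (simp add: c1_def)
  have dc: "has_dir_deriv v c c1 z" if z: "z \<in> W" for z
  proof -
    have dq: "has_dir_deriv v q (\<lambda>z. - (\<theta>2 z * q z ^ 2)) z"
      using has_dir_deriv_inverse[OF der(4)[OF z] nz[OF z]] by (simp add: q_def[abs_def])
    have "has_dir_deriv v c (\<lambda>z. (b2 z * q z + b1 z * - (\<theta>2 z * q z ^ 2)) -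
       (b1 z * (\<theta>2 z * (q z * q z)) + b z * (\<theta>3 z * (q z * q z) +
          \<theta>2 z * (- (\<theta>2 z * q z ^ 2) * q z + q z * - (\<theta>2 z * q z ^ 2))))) z"
      unfolding c_def power2_eq_square[of "q _"]
      by (intro has_dir_deriv_diff has_dir_deriv_mult der z dq[unfolded power2_eq_square])
    also have "(\<lambda>z. (b2 z * q z + b1 z * - (\<theta>2 z * q z ^ 2)) -
       (b1 z * (\<theta>2 z * (q z * q z)) + b z * (\<theta>3 z * (q z * q z) +
          \<theta>2 z * (- (\<theta>2 z * q z ^ 2) * q z + q z * - (\<theta>2 z * q z ^ 2))))) = c1"
      by (auto simp: c1_def algebra_simps power2_eq_square power3_eq_cube)
    finally show ?thesis .
  qed
  have bd: "\<bar>c z\<bar> \<le> ?M \<and> \<bar>c1 z\<bar> \<le> ?M" for z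
  proof (cases "z \<in> K")
    case True
    have zW: "z \<in> W" using True W by auto
    have inv: "\<bar>q z\<bar> \<le> 1 / lam" unfolding q_def
      using lam zW by (simp add: abs_inverse inverse_eq_divide frac_le)
    have q1: "\<bar>x * q z\<bar> \<le> M * (1 / lam)" if "\<bar>x\<bar> \<le> M" for x
      unfolding abs_mult using that inv \<open>0 \<le> M\<close> by (intro mult_mono) auto
    have q2: "\<bar>x * (y * q z ^ 2)\<bar> \<le> M * ((B * lam) * (1 / lam)^2)" if "\<bar>x\<bar> \<le> M" "\<bar>y\<bar> \<le> B * lam" for x y
      unfolding abs_mult power_abs using that inv lam \<open>0 \<le> M\<close> \<open>0 \<le> B\<close>
      by (intro mult_mono power_mono) auto
    have q3: "\<bar>b z * (\<theta>2 z ^ 2 * q z ^ 3)\<bar> \<le> M * ((B * lam)^2 * (1 / lam)^3)"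
      unfolding abs_mult power_abs using M inv lam zW \<open>0 \<le> M\<close> \<open>0 \<le> B\<close>
      by (intro mult_mono power_mono) auto
    have e: "M * ((B * lam) * (1 / lam)^2) = M * B / lam" "M * ((B * lam)^2 * (1 / lam)^3) = M * B^2 / lam"
      using lam by (simp_all add: power2_eq_square power3_eq_cube)
    have "\<bar>c z\<bar> \<le> M / lam + M * B / lam"
      unfolding c_def using q1[OF M(2), of z] q2[OF M(1) lam(3)[OF zW], of z] e by simp
    also have "\<dots> \<le> ?M" using lam(1) \<open>0 \<le> M\<close> \<open>0 \<le> B\<close> by (simp add: field_simps)
    finally have 1: "\<bar>c z\<bar> \<le> ?M" .
    have "c1 z = b2 z * q z - b1 z * (\<theta>2 z * q z ^ 2) - b1 z * (\<theta>2 z * q z ^ 2) - b z * (\<theta>3 z * q z ^ 2)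
       + 2 * (b z * (\<theta>2 z ^ 2 * q z ^ 3))"
      by (simp add: c1_def algebra_simps)
    moreover have "\<bar>p - s - s - t + 2 * r\<bar> \<le> P + 3 * S + 2 * R"
      if "\<bar>p\<bar> \<le> P" "\<bar>s\<bar> \<le> S" "\<bar>t\<bar> \<le> S" "\<bar>r\<bar> \<le> R" for p s t r P S R :: real
      using that by (simp add: abs_le_iff)
    ultimately have "\<bar>c1 z\<bar> \<le> M * (1 / lam) + 3 * (M * B / lam) + 2 * (M * B^2 / lam)"
      using q1[OF M(3), of z] q2[OF M(2) lam(3)[OF zW], of z] q2[OF M(1) lam(4)[OF zW], of z] q3
      unfolding e by metis
    also have "\<dots> = ?M" by (simp add: distrib_left add_divide_distrib mult.assoc mult.left_commute[of M])
    finally show ?thesis using 1 by blast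
  next
    case False
    then show ?thesis using P3 c10 lam(1) \<open>0 \<le> M\<close> \<open>0 \<le> B\<close> by simp
  qed
  have "cmod (osc_int b \<theta>) = cmod (osc_int c \<theta>)"
    unfolding P1 by (simp add: norm_mult)
  also have "\<dots> \<le> ?M * (1 + B) / lam * measure lborel K"
    using lam(1) \<open>0 \<le> M\<close> \<open>0 \<le> B\<close> bd
    by (intro oscillatory_bound_1[OF W P2 cc1 cont(4-6) P3 c10 dc der(3,4) lam(1-3)]) auto
  also have "\<dots> = M * (1 + 3 * B + 2 * B^2) * (1 + B) / lam^2 * measure lborel K"
    by (simp add: power2_eq_square)
  finally show ?thesis .
qed

text \<open>The squared modulus is the integral over u of the autocorrelation of H. The gain is that
  the phase of H enters only through its differences, in which linear terms become constant in
  z.\<close>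

lemma norm_integral_sq_le_autocorrelation:
  fixes H :: "'a::euclidean_space \<Rightarrow> complex"
  assumes cont: "continuous_on UNIV H" and "compact K" and zero: "\<And>z. z \<notin> K \<Longrightarrow> H z = 0"
    and bd: "\<And>u. cmod (LINT z|lborel. H (z + u) * cnj (H z)) \<le> w u" "integrable lborel w"
  shows "(cmod (LINT z|lborel. H z))\<^sup>2 \<le> (LINT u|lborel. w u)"
proof -
  let ?J = "LINT z|lborel. H z"
  let ?f = "\<lambda>(u, z). H (z + u) * cnj (H z)"
  \<comment> \<open>The pairs (u, z) for which z + u and z both lie in K, compact as an image of K x
    K.\<close>
  define S where "S = (\<lambda>(x, y). (x - y, y)) ` (K \<times> K)"
  have S: "compact S" unfolding S_def
    by (intro compact_continuous_image compact_Times \<open>compact K\<close>)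
       (auto simp: case_prod_unfold intro!: continuous_intros)
  have "continuous_on UNIV (\<lambda>x. H (snd x + fst x) * cnj (H (snd x)))"
    by (intro continuous_intros continuous_on_compose2[OF cont]) auto
  then have cf: "continuous_on UNIV ?f" by (simp add: case_prod_unfold)
  have f0: "?f x = 0" if "x \<notin> S" for x
  proof -
    obtain u z where x: "x = (u, z)" by fastforce
    have "\<not> (z + u \<in> K \<and> z \<in> K)"
    proof
      assume "z + u \<in> K \<and> z \<in> K"
      then have "(u, z) \<in> S" unfolding S_def by (intro image_eqI[of _ _ "(z + u, z)"]) auto
      then show False using that x by simp
    qed
    then show ?thesis using zero x by auto
  qed
  have int: "integrable (lborel \<Otimes>\<^sub>M lborel) ?f"
    unfolding lborel_prod by (rule integrable_continuous_compact_support[OF cf S f0])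
  have meas: "H \<in> borel_measurable borel" using cont by (rule borel_measurable_continuous_onI)
  have tr: "(LINT u|lborel. H (z + u)) = ?J" for z
    using integral_lborel_translate[OF meas, of z] by (simp add: add.commute)
  have "?J * cnj ?J = (LINT z|lborel. ?J * cnj (H z))"
    by (simp add: integral_cnj)
  also have "\<dots> = (LINT z|lborel. (LINT u|lborel. H (z + u) * cnj (H z)))"
    by (simp add: tr)
  also have "\<dots> = (LINT u|lborel. (LINT z|lborel. H (z + u) * cnj (H z)))"
    using lborel_pair.Fubini_integral[OF int] by simp
  finally have "(cmod ?J)\<^sup>2 = cmod (LINT u|lborel. (LINT z|lborel. H (z + u) * cnj (H z)))"
    by (metis norm_mult complex_mod_cnj power2_eq_square)
  also have "\<dots> \<le> (LINT u|lborel. cmod (LINT z|lborel. H (z + u) * cnj (H z)))"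
    by (rule integral_norm_bound)
  also have "\<dots> \<le> (LINT u|lborel. w u)"
    using bd by (intro integral_mono') (auto intro: order_trans[OF norm_ge_zero])
  finally show ?thesis .
qed

section \<open>Fourier decay over a curved graph\<close>

lemma DERIV_max_0_power:
  "((\<lambda>x::real. (max 0 x) ^ Suc (Suc n)) has_real_derivative real (Suc (Suc n)) * (max 0 x) ^ Suc n) (at x)"
proof -
  consider "x < 0" | "x = 0" | "0 < x" by linarith
  then show ?thesis
  proof cases
    case 1
    have "((\<lambda>x::real. 0) has_real_derivative 0) (at x)" by simp
    then have "((\<lambda>x::real. (max 0 x) ^ Suc (Suc n)) has_real_derivative 0) (at x)"
      by (rule has_field_derivative_transform_within_open[of _ _ _ "{..<0}"]) (use 1 in auto)
    then show ?thesis using 1 by simp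
  next
    case 2
    have "((\<lambda>y::real. ((max 0 y) ^ Suc (Suc n) - 0) / y) \<longlongrightarrow> 0) (at 0)"
    proof (rule Lim_null_comparison)
      show "\<forall>\<^sub>F y::real in at 0. norm (((max 0 y) ^ Suc (Suc n) - 0) / y) \<le> \<bar>y\<bar> ^ Suc n"
        by (rule always_eventually) (auto simp: max_def abs_mult power_abs mult_le_0_iff)
      show "((\<lambda>y::real. \<bar>y\<bar> ^ Suc n) \<longlongrightarrow> 0) (at 0)"
        by (auto intro!: tendsto_eq_intros)
    qed
    then show ?thesis using 2 by (simp add: has_field_derivative_iff)
  next
    case 3
    have "((\<lambda>x::real. x ^ Suc (Suc n)) has_real_derivative real (Suc (Suc n)) * x ^ Suc n) (at x)"
      using DERIV_pow[of "Suc (Suc n)" x] by simp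
    then have "((\<lambda>x::real. (max 0 x) ^ Suc (Suc n)) has_real_derivative real (Suc (Suc n)) * x ^ Suc n) (at x)"
      by (rule has_field_derivative_transform_within_open[of _ _ _ "{0<..}"]) (use 3 in auto)
    then show ?thesis using 3 by simp
  qed
qed

text \<open>The cube of the positive part is C^2 across the boundary of the ball, which is all that
  two integrations by parts consume; this avoids a smooth cutoff built from exponentials.\<close>

definition bump :: "'a::real_inner \<Rightarrow> real \<Rightarrow> 'a \<Rightarrow> real" where
  "bump z0 \<rho> z = (max 0 (\<rho>\<^sup>2 - (z - z0) \<bullet> (z - z0))) ^ 3"

definition bump1 :: "'a::real_inner \<Rightarrow> real \<Rightarrow> 'a \<Rightarrow> 'a \<Rightarrow> real" where
  "bump1 z0 \<rho> v z = 3 * (max 0 (\<rho>\<^sup>2 - (z - z0) \<bullet> (z - z0))) ^ 2 * (- 2 * (v \<bullet> (z - z0)))"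

definition bump2 :: "'a::real_inner \<Rightarrow> real \<Rightarrow> 'a \<Rightarrow> 'a \<Rightarrow> real" where
  "bump2 z0 \<rho> v z = 6 * max 0 (\<rho>\<^sup>2 - (z - z0) \<bullet> (z - z0)) * (2 * (v \<bullet> (z - z0)))\<^sup>2
     - 6 * (max 0 (\<rho>\<^sup>2 - (z - z0) \<bullet> (z - z0))) ^ 2 * (v \<bullet> v)"

lemma DERIV_inner_line:
  "((\<lambda>t. \<rho>\<^sup>2 - (z + t *\<^sub>R v - z0) \<bullet> (z + t *\<^sub>R v - z0)) has_real_derivative - 2 * (v \<bullet> (z - z0))) (at 0)"
proof -
  have "(\<lambda>t. \<rho>\<^sup>2 - (z + t *\<^sub>R v - z0) \<bullet> (z + t *\<^sub>R v - z0)) =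
     (\<lambda>t. \<rho>\<^sup>2 - (z - z0) \<bullet> (z - z0) - 2 * (v \<bullet> (z - z0)) * t - (v \<bullet> v) * t\<^sup>2)"
    by (rule ext) (simp add: inner_diff_left inner_diff_right inner_add_left inner_add_right
      inner_commute power2_eq_square algebra_simps)
  then show ?thesis by (auto intro!: derivative_eq_intros)
qed

lemma has_dir_deriv_bump: "has_dir_deriv v (bump z0 \<rho>) (bump1 z0 \<rho> v) z"
  unfolding has_dir_deriv_def has_real_derivative_iff_has_vector_derivative[symmetric] bump_def bump1_def
  using DERIV_chain'[OF DERIV_inner_line[of \<rho> z v z0] DERIV_max_0_power[of 1]]
  by (simp add: numeral_3_eq_3 numeral_2_eq_2)

lemma has_dir_deriv_bump1: "has_dir_deriv v (bump1 z0 \<rho> v) (bump2 z0 \<rho> v) z"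
proof -
  have "((\<lambda>t. - 2 * (v \<bullet> (z + t *\<^sub>R v - z0))) has_real_derivative - 2 * (v \<bullet> v)) (at 0)"
    by (auto intro!: derivative_eq_intros simp: inner_diff_right inner_add_right)
  from DERIV_mult[OF DERIV_cmult[OF DERIV_chain'[OF DERIV_inner_line[of \<rho> z v z0] DERIV_max_0_power[of 0]], of 3] this]
  show ?thesis
    unfolding has_dir_deriv_def has_real_derivative_iff_has_vector_derivative[symmetric] bump1_def bump2_def
    by (simp add: numeral_2_eq_2 algebra_simps)
qed

lemma continuous_bump [continuous_intros]: "continuous_on S (bump z0 \<rho>)"
  unfolding bump_def by (intro continuous_intros)

lemma continuous_bump1 [continuous_intros]: "continuous_on S (bump1 z0 \<rho> v)"
  unfolding bump1_def by (intro continuous_intros)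

lemma continuous_bump2 [continuous_intros]: "continuous_on S (bump2 z0 \<rho> v)"
  unfolding bump2_def by (intro continuous_intros)

lemma bump_eq_0:
  assumes "0 < \<rho>" "z \<notin> cball z0 \<rho>"
  shows "bump z0 \<rho> z = 0" "bump1 z0 \<rho> v z = 0" "bump2 z0 \<rho> v z = 0"
proof -
  have "\<rho>\<^sup>2 < (norm (z - z0))\<^sup>2" using assms by (intro power_strict_mono) (auto simp: dist_norm norm_minus_commute)
  then have "\<rho>\<^sup>2 - (z - z0) \<bullet> (z - z0) < 0" by (simp add: power2_norm_eq_inner)
  then show "bump z0 \<rho> z = 0" "bump1 z0 \<rho> v z = 0" "bump2 z0 \<rho> v z = 0"
    by (simp_all add: bump_def bump1_def bump2_def)
qed

lemma bump_nonneg: "0 \<le> bump z0 \<rho> z"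
  by (simp add: bump_def)

lemma bump_bounded:
  fixes z0 :: "'a::euclidean_space"
  assumes "finite V" "0 < \<rho>"
  obtains M where "0 < M" "\<And>z. \<bar>bump z0 \<rho> z\<bar> \<le> M" "\<And>v z. v \<in> V \<Longrightarrow> \<bar>bump1 z0 \<rho> v z\<bar> \<le> M"
    "\<And>v z. v \<in> V \<Longrightarrow> \<bar>bump2 z0 \<rho> v z\<bar> \<le> M"
proof -
  have bd: "\<exists>M. \<forall>z. \<bar>f z\<bar> \<le> M" if "continuous_on (cball z0 \<rho>) f" "\<And>z. z \<notin> cball z0 \<rho> \<Longrightarrow> f z = 0" for f :: "'a \<Rightarrow> real"
  proof -
    have "bounded (f ` cball z0 \<rho>)"
      by (intro compact_imp_bounded compact_continuous_image that) auto
    then obtain M where "\<And>z. z \<in> cball z0 \<rho> \<Longrightarrow> \<bar>f z\<bar> \<le> M"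
      unfolding bounded_iff by (metis imageI real_norm_def)
    then have "\<bar>f z\<bar> \<le> max 0 M" for z
      using that(2)[of z] by (cases "z \<in> cball z0 \<rho>") (auto simp: le_max_iff_disj simp del: mem_cball)
    then show ?thesis by blast
  qed
  obtain M0 where M0: "\<And>z. \<bar>bump z0 \<rho> z\<bar> \<le> M0"
    using bd[OF continuous_bump] bump_eq_0[OF assms(2)] by metis
  have "\<forall>v. \<exists>M. \<forall>z. \<bar>bump1 z0 \<rho> v z\<bar> \<le> M" using bd[OF continuous_bump1] bump_eq_0[OF assms(2)] by metis
  then obtain M1 where M1: "\<And>v z. \<bar>bump1 z0 \<rho> v z\<bar> \<le> M1 v" by metis
  have "\<forall>v. \<exists>M. \<forall>z. \<bar>bump2 z0 \<rho> v z\<bar> \<le> M" using bd[OF continuous_bump2] bump_eq_0[OF assms(2)] by metis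
  then obtain M2 where M2: "\<And>v z. \<bar>bump2 z0 \<rho> v z\<bar> \<le> M2 v" by metis
  define M where "M = 1 + M0 + (\<Sum>v\<in>V. M1 v) + (\<Sum>v\<in>V. M2 v)"
  have nn: "0 \<le> M0" "\<And>v. 0 \<le> M1 v" "\<And>v. 0 \<le> M2 v"
    using M0 M1 M2 by (meson abs_ge_zero order_trans)+
  have s: "M1 v \<le> (\<Sum>v\<in>V. M1 v)" "M2 v \<le> (\<Sum>v\<in>V. M2 v)" if "v \<in> V" for v
    using that assms(1) nn by (auto intro: member_le_sum)
  have s0: "0 \<le> (\<Sum>v\<in>V. M1 v)" "0 \<le> (\<Sum>v\<in>V. M2 v)" using nn by (auto intro: sum_nonneg)
  show thesis
  proof (rule that[of M])
    show "0 < M" using nn s0 by (simp add: M_def)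
    show "\<bar>bump z0 \<rho> z\<bar> \<le> M" for z using M0[of z] s0 by (simp add: M_def)
    show "\<bar>bump1 z0 \<rho> v z\<bar> \<le> M" if "v \<in> V" for v z
      using M1[of v z] s(1)[OF that] s0 nn unfolding M_def by linarith
    show "\<bar>bump2 z0 \<rho> v z\<bar> \<le> M" if "v \<in> V" for v z
      using M2[of v z] s(2)[OF that] s0 nn unfolding M_def by linarith
  qed
qed

section \<open>Graphs whose slopes separate points quantitatively\<close>

definition drop_coord :: "'n \<Rightarrow> real^'n \<Rightarrow> real^'n" where
  "drop_coord k u = u - (u $ k) *\<^sub>R axis k 1"

lemma drop_coord_nth: "drop_coord k u $ j = (if j = k then 0 else u $ j)"
  by (simp add: drop_coord_def axis_def)

lemma component_le_norm_drop_coord: "j \<noteq> k \<Longrightarrow> \<bar>u $ j\<bar> \<le> norm (drop_coord k u)"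
  using component_le_norm_cart[of "drop_coord k u" j] by (simp add: drop_coord_nth)

text \<open>The function \<open>h\<close> is meant to be independent of the \<open>k\<close>-th coordinate, so only the part
  \<open>drop_coord k u\<close> of an increment counts; \<open>h1 i\<close>, \<open>h2 i\<close>, \<open>h3 i\<close> are its iterated
  derivatives in the direction \<open>axis i 1\<close>.\<close>

locale curved_graph =
  fixes k :: "'n::finite" and W :: "(real^'n) set" and z0 :: "real^'n" and \<rho> :: real
    and h :: "real^'n \<Rightarrow> real" and h1 h2 h3 :: "'n \<Rightarrow> real^'n \<Rightarrow> real" and L c :: real
  assumes card3: "3 \<le> CARD('n)"
    and openW: "open W" and \<rho>: "0 < \<rho>" "cball z0 \<rho> \<subseteq> W" and c: "0 < c" and L: "0 < L"
    and cont_h: "continuous_on W h"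
    and cont: "\<And>i. i \<noteq> k \<Longrightarrow> continuous_on W (h1 i)" "\<And>i. i \<noteq> k \<Longrightarrow> continuous_on W (h2 i)"
      "\<And>i. i \<noteq> k \<Longrightarrow> continuous_on W (h3 i)"
    and der: "\<And>i z. i \<noteq> k \<Longrightarrow> z \<in> W \<Longrightarrow> has_dir_deriv (axis i 1) h (h1 i) z"
      "\<And>i z. i \<noteq> k \<Longrightarrow> z \<in> W \<Longrightarrow> has_dir_deriv (axis i 1) (h1 i) (h2 i) z"
      "\<And>i z. i \<noteq> k \<Longrightarrow> z \<in> W \<Longrightarrow> has_dir_deriv (axis i 1) (h2 i) (h3 i) z"
    and bd: "\<And>i z. i \<noteq> k \<Longrightarrow> z \<in> W \<Longrightarrow> \<bar>h1 i z\<bar> \<le> L" "\<And>i z. i \<noteq> k \<Longrightarrow> z \<in> W \<Longrightarrow> \<bar>h2 i z\<bar> \<le> L"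
    and lip: "\<And>i z u. i \<noteq> k \<Longrightarrow> z \<in> W \<Longrightarrow> z + u \<in> W \<Longrightarrow> \<bar>h2 i (z + u) - h2 i z\<bar> \<le> L * norm (drop_coord k u)"
      "\<And>i z u. i \<noteq> k \<Longrightarrow> z \<in> W \<Longrightarrow> z + u \<in> W \<Longrightarrow> \<bar>h3 i (z + u) - h3 i z\<bar> \<le> L * norm (drop_coord k u)"
    and curved: "\<And>u. \<exists>i. i \<noteq> k \<and> (\<forall>z. z \<in> W \<longrightarrow> z + u \<in> W \<longrightarrow> c * norm (drop_coord k u) \<le> \<bar>h1 i (z + u) - h1 i z\<bar>)"
begin

text \<open>This is 2 pi times the inner product of \<xi> with the graph point obtained from z by
  replacing its k-th coordinate by h z.\<close>

definition phase :: "real^'n \<Rightarrow> real^'n \<Rightarrow> real" where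
  "phase \<xi> z = 2 * pi * (\<xi> \<bullet> z + \<xi> $ k * (h z - z $ k))"

abbreviation wave :: "real^'n \<Rightarrow> real^'n \<Rightarrow> complex" where
  "wave \<xi> z \<equiv> of_real (bump z0 \<rho> z) * cis (phase \<xi> z)"

lemma cont_phase: "continuous_on W (phase \<xi>)"
  unfolding phase_def by (intro continuous_intros cont_h)

lemma has_dir_deriv_phase:
  assumes i: "i \<noteq> k" "z \<in> W"
  shows "has_dir_deriv (axis i 1) (phase \<xi>) (\<lambda>z. 2 * pi * (\<xi> $ i + \<xi> $ k * h1 i z)) z"
proof -
  have 1: "has_dir_deriv (axis i 1) (\<lambda>z. \<xi> \<bullet> z) (\<lambda>z. \<xi> $ i) z"
    unfolding has_dir_deriv_def has_real_derivative_iff_has_vector_derivative[symmetric]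
    by (auto intro!: derivative_eq_intros simp: inner_add_right inner_axis)
  have 2: "has_dir_deriv (axis i 1) (\<lambda>z. z $ k) (\<lambda>z. 0) z"
    unfolding has_dir_deriv_def using i by (simp add: axis_def)
  have "has_dir_deriv (axis i 1) (\<lambda>z. 2 * pi * (\<xi> \<bullet> z + \<xi> $ k * (h z - z $ k)))
      (\<lambda>z. 2 * pi * (\<xi> $ i + \<xi> $ k * (h1 i z - 0))) z"
    by (intro has_dir_deriv_cmult has_dir_deriv_add has_dir_deriv_diff 1 2 der i)
  then show ?thesis by (simp add: phase_def[abs_def])
qed

text \<open>When \<xi> is nearly tangential, some component i other than k has size at least
  |\<xi>|/d. It dominates the contribution of the k-th component, so the linear part alone makes the
  phase derivative in direction i large, and one integration by parts suffices.\<close>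

lemma decay_tangential:
  obtains \<kappa> D where "0 < \<kappa>" "0 \<le> D"
    "\<And>\<xi>. \<xi> \<noteq> 0 \<Longrightarrow> \<bar>\<xi> $ k\<bar> \<le> \<kappa> * norm \<xi> \<Longrightarrow>
       cmod (osc_int (bump z0 \<rho>) (phase \<xi>)) \<le> D / norm \<xi>"
proof -
  define d where "d = real CARD('n)"
  have d: "0 < d" using card3 by (simp add: d_def)
  \<comment> \<open>Chosen so that \<kappa> L <= 1/(2d), which leaves half of |\<xi>|/d after
    subtracting the contribution of \<open>h1\<close>, and so that \<kappa> < 1/d, which excludes i
    = k.\<close>
  define \<kappa> where "\<kappa> = 1 / (2 * d * (L + 1))"
  have \<kappa>: "0 < \<kappa>" "\<kappa> * L \<le> 1 / (2 * d)" "\<kappa> < 1 / d"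
  proof -
    show "0 < \<kappa>" using d L by (simp add: \<kappa>_def)
    have "\<kappa> * L = 1 / (2 * d) * (L / (L + 1))" by (simp add: \<kappa>_def)
    also have "\<dots> \<le> 1 / (2 * d) * 1" using d L by (intro mult_left_mono) auto
    finally show "\<kappa> * L \<le> 1 / (2 * d)" by simp
    have "\<kappa> = 1 / d * (1 / (2 * (L + 1)))" by (simp add: \<kappa>_def)
    also have "\<dots> < 1 / d * 1" using d L by (intro mult_strict_left_mono) auto
    finally show "\<kappa> < 1 / d" by simp
  qed
  obtain M where M: "0 < M" "\<And>z. \<bar>bump z0 \<rho> z\<bar> \<le> M" "\<And>v z. v \<in> Basis \<Longrightarrow> \<bar>bump1 z0 \<rho> v z\<bar> \<le> M"
    using bump_bounded[OF finite_Basis \<rho>(1)] by metis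
  define V where "V = measure lborel (cball z0 \<rho>)"
  show thesis
  proof (rule that[of \<kappa> "M * (1 + 4) * d * V"])
    show "0 \<le> M * (1 + 4) * d * V" using M d by (simp add: V_def)
    fix \<xi> :: "real^'n"
    assume \<xi>: "\<xi> \<noteq> 0" "\<bar>\<xi> $ k\<bar> \<le> \<kappa> * norm \<xi>"
    have "\<exists>i. norm \<xi> / d \<le> \<bar>\<xi> $ i\<bar>"
    proof (rule ccontr)
      assume "\<not> ?thesis"
      then have "(\<Sum>i\<in>UNIV. \<bar>\<xi> $ i\<bar>) < (\<Sum>i\<in>(UNIV::'n set). norm \<xi> / d)"
        by (intro sum_strict_mono) (auto simp: not_le)
      then show False using norm_le_l1_cart[of \<xi>] d by (simp add: d_def)
    qed
    then obtain i where i: "norm \<xi> / d \<le> \<bar>\<xi> $ i\<bar>" by blast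
    define lam where "lam = norm \<xi> / d"
    have lam: "0 < lam" using \<xi> d by (simp add: lam_def)
    have ik: "i \<noteq> k"
    proof
      assume "i = k"
      then have "norm \<xi> / d \<le> \<kappa> * norm \<xi>" using i \<xi> by simp
      also have "\<dots> < 1 / d * norm \<xi>" using \<kappa> \<xi> by (intro mult_strict_right_mono) auto
      finally show False by simp
    qed
    have kb: "\<bar>\<xi> $ k\<bar> * L \<le> lam / 2"
    proof -
      have "\<bar>\<xi> $ k\<bar> * L \<le> (\<kappa> * L) * norm \<xi>" using \<xi> L by (simp add: mult_right_mono mult.commute mult.left_commute)
      also have "\<dots> \<le> 1 / (2 * d) * norm \<xi>" using \<kappa> by (intro mult_right_mono) auto
      finally show ?thesis by (simp add: lam_def)
    qed
    \<comment> \<open>The 4 stands for pi: the second derivative of the phase is at most 2 pi *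
      lam/2.\<close>
    have "cmod (osc_int (bump z0 \<rho>) (phase \<xi>)) \<le> M * (1 + 4) / lam * measure lborel (cball z0 \<rho>)"
    proof (rule oscillatory_bound_1[where v = "axis i 1" and W = W and ?b1.0 = "bump1 z0 \<rho> (axis i 1)"
          and ?\<theta>1.0 = "\<lambda>z. 2 * pi * (\<xi> $ i + \<xi> $ k * h1 i z)" and ?\<theta>2.0 = "\<lambda>z. 2 * pi * (\<xi> $ k * h2 i z)"])
      show "continuous_on W (\<lambda>z. 2 * pi * (\<xi> $ i + \<xi> $ k * h1 i z))" "continuous_on W (\<lambda>z. 2 * pi * (\<xi> $ k * h2 i z))"
        using cont ik by (auto intro!: continuous_intros)
      fix z assume z: "z \<in> W"
      show "has_dir_deriv (axis i 1) (phase \<xi>) (\<lambda>z. 2 * pi * (\<xi> $ i + \<xi> $ k * h1 i z)) z"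
        by (rule has_dir_deriv_phase[OF ik z])
      have "has_dir_deriv (axis i 1) (\<lambda>z. 2 * pi * (\<xi> $ i + \<xi> $ k * h1 i z)) (\<lambda>z. 2 * pi * (0 + \<xi> $ k * h2 i z)) z"
        by (intro has_dir_deriv_cmult has_dir_deriv_add has_dir_deriv_const der ik z)
      then show "has_dir_deriv (axis i 1) (\<lambda>z. 2 * pi * (\<xi> $ i + \<xi> $ k * h1 i z)) (\<lambda>z. 2 * pi * (\<xi> $ k * h2 i z)) z"
        by simp
      have *: "\<bar>\<xi> $ k * x\<bar> \<le> lam / 2" if "\<bar>x\<bar> \<le> L" for x
        using mult_left_mono[OF that, of "\<bar>\<xi> $ k\<bar>"] kb by (simp add: abs_mult)
      have "lam / 2 \<le> \<bar>\<xi> $ i + \<xi> $ k * h1 i z\<bar>"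
        using *[OF bd(1)[OF ik z]] i[folded lam_def] by linarith
      then have "2 * 1 * (lam / 2) \<le> 2 * pi * \<bar>\<xi> $ i + \<xi> $ k * h1 i z\<bar>"
        using lam pi_ge_two by (intro mult_mono) auto
      then show "lam \<le> \<bar>2 * pi * (\<xi> $ i + \<xi> $ k * h1 i z)\<bar>" by (simp add: abs_mult)
      have "2 * pi * \<bar>\<xi> $ k * h2 i z\<bar> \<le> 2 * 4 * (lam / 2)"
        using *[OF bd(2)[OF ik z]] pi_less_4 lam by (intro mult_mono) auto
      then show "\<bar>2 * pi * (\<xi> $ k * h2 i z)\<bar> \<le> 4 * lam" by (simp add: abs_mult)
    qed (use openW \<rho> M lam bump_eq_0 in \<open>auto intro!: continuous_intros cont_phase has_dir_deriv_bump simp: axis_in_Basis_iff\<close>)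
    also have "\<dots> = M * (1 + 4) * d * V / norm \<xi>" by (simp add: lam_def V_def)
    finally show "cmod (osc_int (bump z0 \<rho>) (phase \<xi>)) \<le> M * (1 + 4) * d * V / norm \<xi>" .
  qed (rule \<kappa>)
qed

text \<open>In the derivative of the phase difference the linear terms cancel, leaving 2 pi \<xi> $
  k times an increment of \<open>h1 i\<close>. With i from \<open>curved\<close> this is at least of
  order |\<xi> $ k| |u'|, where u' is \<open>drop_coord k u\<close>. The increments of
  \<open>h2 i\<close> and \<open>h3 i\<close> are at most L |u'|, so B = L/c serves in the double
  integration by parts, which yields the square.\<close>

lemma autocorrelation_le:
  obtains D where "0 \<le> D"
    "\<And>\<xi> u. \<xi> $ k \<noteq> 0 \<Longrightarrow> drop_coord k u \<noteq> 0 \<Longrightarrow>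
       cmod (LINT z|lborel. wave \<xi> (z + u) *
          cnj (wave \<xi> z)) \<le> D / (\<bar>\<xi> $ k\<bar> * norm (drop_coord k u))\<^sup>2"
    "\<And>\<xi> u. cmod (LINT z|lborel. wave \<xi> (z + u) *
          cnj (wave \<xi> z)) \<le> D"
proof -
  obtain M where M: "0 < M" "\<And>z. \<bar>bump z0 \<rho> z\<bar> \<le> M" "\<And>v z. v \<in> Basis \<Longrightarrow> \<bar>bump1 z0 \<rho> v z\<bar> \<le> M"
      "\<And>v z. v \<in> Basis \<Longrightarrow> \<bar>bump2 z0 \<rho> v z\<bar> \<le> M"
    using bump_bounded[OF finite_Basis \<rho>(1)] by metis
  define V where "V = measure lborel (cball z0 \<rho>)"
  have V: "0 \<le> V" by (simp add: V_def)
  define B where "B = L / c"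
  have B: "0 \<le> B" using L c by (simp add: B_def)
  \<comment> \<open>The second derivative of a product of two bumps is a sum of four products, each
    at most M^2.\<close>
  define N where "N = 4 * M\<^sup>2"
  have N: "0 \<le> N" by (simp add: N_def)
  define D1 where "D1 = N * (1 + 3 * B + 2 * B^2) * (1 + B) * V / c\<^sup>2"
  define D where "D = D1 + M\<^sup>2 * V"
  have D1: "0 \<le> D1" using N B V by (simp add: D1_def)
  show thesis
  proof (rule that[of D])
    show "0 \<le> D" using D1 V by (simp add: D_def)
    have eq: "wave \<xi> (z + u) * cnj (wave \<xi> z) = of_real (bump z0 \<rho> (z + u) * bump z0 \<rho> z) * cis (phase \<xi> (z + u) - phase \<xi> z)" for \<xi> z u
      by (simp add: cis_cnj cis_mult[symmetric] diff_conv_add_uminus del: add_uminus_conv_diff)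
    show "cmod (LINT z|lborel. wave \<xi> (z + u) * cnj (wave \<xi> z)) \<le> D" for \<xi> u
    proof -
      have "cmod (LINT z|lborel. wave \<xi> (z + u) * cnj (wave \<xi> z)) \<le> M\<^sup>2 * measure lborel (cball z0 \<rho>)"
      proof (rule norm_integral_le_bound_on_compact)
        fix z
        show "z \<notin> cball z0 \<rho> \<Longrightarrow> wave \<xi> (z + u) * cnj (wave \<xi> z) = 0" using bump_eq_0(1)[OF \<rho>(1), of z z0] by simp
        show "cmod (wave \<xi> (z + u) * cnj (wave \<xi> z)) \<le> M\<^sup>2"
          unfolding eq using M(2)[of "z + u"] M(2)[of z] M(1)
          by (auto simp: norm_mult abs_mult power2_eq_square intro!: mult_mono)
      qed auto
      then show ?thesis using D1 by (simp add: D_def V_def)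
    qed
    fix \<xi> u :: "real^'n"
    assume nz: "\<xi> $ k \<noteq> 0" "drop_coord k u \<noteq> 0"
    obtain i where ik: "i \<noteq> k" and low: "\<And>z. z \<in> W \<Longrightarrow> z + u \<in> W \<Longrightarrow> c * norm (drop_coord k u) \<le> \<bar>h1 i (z + u) - h1 i z\<bar>"
      using curved[of u] by blast
    let ?v = "axis i 1 :: real^'n"
    have vB: "?v \<in> Basis" by simp
    \<comment> \<open>The points z for which z and z + u both lie in W; K is the analogue for the
      support of the bump.\<close>
    define W' where "W' = W \<inter> (\<lambda>z. z + u) -` W"
    define K where "K = cball z0 \<rho> \<inter> (\<lambda>z. z + u) -` cball z0 \<rho>"
    have W': "open W'" unfolding W'_def
      by (intro open_Int openW continuous_open_vimage) (auto intro!: continuous_intros)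
    have K: "compact K" unfolding K_def
      by (intro compact_Int_closed continuous_closed_vimage) (auto intro!: continuous_intros)
    have KW: "K \<subseteq> W'" using \<rho>(2) by (auto simp: K_def W'_def)
    have KV: "measure lborel K \<le> V"
      unfolding V_def using K by (intro measure_mono_fmeasurable fmeasurable_compact) (auto simp: K_def borel_compact)
    define lam where "lam = 2 * pi * \<bar>\<xi> $ k\<bar> * (c * norm (drop_coord k u))"
    have lam: "0 < lam" using nz c by (simp add: lam_def)
    define a where "a = bump z0 \<rho>"
    define a1 where "a1 = bump1 z0 \<rho> ?v"
    define a2 where "a2 = bump2 z0 \<rho> ?v"
    have ca: "continuous_on S a" "continuous_on S a1" "continuous_on S a2" for S
      by (auto simp: a_def a1_def a2_def intro!: continuous_intros)
    have da: "has_dir_deriv ?v a a1 z" "has_dir_deriv ?v a1 a2 z" for z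
      by (simp_all add: a_def a1_def a2_def has_dir_deriv_bump has_dir_deriv_bump1)
    have a0: "a z = 0" "a1 z = 0" "a2 z = 0" if "z \<notin> cball z0 \<rho>" for z
      using bump_eq_0[OF \<rho>(1) that] by (simp_all add: a_def a1_def a2_def)
    have aM: "\<bar>a z\<bar> \<le> M" "\<bar>a1 z\<bar> \<le> M" "\<bar>a2 z\<bar> \<le> M" for z
      using M vB by (simp_all add: a_def a1_def a2_def)
    define b where "b = (\<lambda>z. a (z + u) * a z)"
    define b1 where "b1 = (\<lambda>z. a1 (z + u) * a z + a (z + u) * a1 z)"
    define b2 where "b2 = (\<lambda>z. (a2 (z + u) * a z + a1 (z + u) * a1 z) + (a1 (z + u) * a1 z + a (z + u) * a2 z))"
    define \<theta> where "\<theta> = (\<lambda>z. phase \<xi> (z + u) - phase \<xi> z)"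
    define g where "g = (\<lambda>f z. 2 * pi * (\<xi> $ k * (f (z + u) - f z :: real)))"
    have cu: "continuous_on W' (\<lambda>z. f (z + u))" if "continuous_on W f" for f :: "real^'n \<Rightarrow> real"
      by (rule continuous_on_compose2[OF that]) (auto simp: W'_def intro!: continuous_intros)
    have cw: "continuous_on W' f" if "continuous_on W f" for f :: "real^'n \<Rightarrow> real"
      using that by (rule continuous_on_subset) (auto simp: W'_def)
    have cau: "continuous_on S (\<lambda>z. f (z + u))" if "continuous_on UNIV f" for S and f :: "real^'n \<Rightarrow> real"
      by (rule continuous_on_compose2[OF that]) (auto intro!: continuous_intros)
    have cg: "continuous_on W' (g f)" if "continuous_on W f" for f
      unfolding g_def using cu[OF that] cw[OF that] by (intro continuous_intros)
    have dg: "has_dir_deriv ?v (g f) (g f') z" if "\<And>z. z \<in> W \<Longrightarrow> has_dir_deriv ?v f f' z" "z \<in> W'" for f f' z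
      unfolding g_def using that
      by (intro has_dir_deriv_cmult has_dir_deriv_diff has_dir_deriv_translate) (auto simp: W'_def)
    have gB: "\<bar>g f z\<bar> \<le> B * lam" if "z \<in> W'" and "\<And>z u. z \<in> W \<Longrightarrow> z + u \<in> W \<Longrightarrow> \<bar>f (z + u) - f z\<bar> \<le> L * norm (drop_coord k u)" for f z
    proof -
      have "\<bar>g f z\<bar> = 2 * pi * \<bar>\<xi> $ k\<bar> * \<bar>f (z + u) - f z\<bar>" by (simp add: g_def abs_mult)
      also have "\<dots> \<le> 2 * pi * \<bar>\<xi> $ k\<bar> * (L * norm (drop_coord k u))"
        using that by (intro mult_left_mono) (auto simp: W'_def)
      also have "\<dots> = B * lam" using c by (simp add: B_def lam_def)
      finally show ?thesis .
    qed
    have "cmod (osc_int b \<theta>) \<le> N * (1 + 3 * B + 2 * B^2) * (1 + B) / lam^2 * measure lborel K"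
    proof (rule oscillatory_bound_2[OF W' K KW, where v = ?v and ?b1.0 = b1 and ?b2.0 = b2
          and ?\<theta>1.0 = "g (h1 i)" and ?\<theta>2.0 = "g (h2 i)" and ?\<theta>3.0 = "g (h3 i)"])
      show "continuous_on UNIV b" "continuous_on UNIV b1" "continuous_on UNIV b2"
        unfolding b_def b1_def b2_def by (intro continuous_intros ca cau)+
      show "continuous_on W' \<theta>" unfolding \<theta>_def by (intro continuous_intros cu cw cont_phase)
      show "continuous_on W' (g (h1 i))" "continuous_on W' (g (h2 i))" "continuous_on W' (g (h3 i))"
        using cont ik by (auto intro: cg)
      show "b z = 0" "b1 z = 0" "b2 z = 0" if "z \<notin> K" for z
        using that a0[of z] a0[of "z + u"] by (auto simp: K_def b_def b1_def b2_def simp del: mem_cball)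
      fix z assume z: "z \<in> W'"
      show "has_dir_deriv ?v b b1 z" "has_dir_deriv ?v b1 b2 z"
        unfolding b_def b1_def b2_def
        by (intro has_dir_deriv_mult has_dir_deriv_add has_dir_deriv_translate da)+
      have "has_dir_deriv ?v \<theta> (\<lambda>z. 2 * pi * (\<xi> $ i + \<xi> $ k * h1 i (z + u)) - 2 * pi * (\<xi> $ i + \<xi> $ k * h1 i z)) z"
        unfolding \<theta>_def using z
        by (intro has_dir_deriv_diff has_dir_deriv_translate[of _ "phase \<xi>" "\<lambda>z. 2 * pi * (\<xi> $ i + \<xi> $ k * h1 i z)"]
             has_dir_deriv_phase ik) (auto simp: W'_def)
      also have "(\<lambda>z. 2 * pi * (\<xi> $ i + \<xi> $ k * h1 i (z + u)) - 2 * pi * (\<xi> $ i + \<xi> $ k * h1 i z)) = g (h1 i)"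
        by (auto simp: g_def algebra_simps)
      finally show "has_dir_deriv ?v \<theta> (g (h1 i)) z" .
      show "has_dir_deriv ?v (g (h1 i)) (g (h2 i)) z" "has_dir_deriv ?v (g (h2 i)) (g (h3 i)) z"
        using der ik z by (auto intro!: dg)
      have "lam \<le> 2 * pi * \<bar>\<xi> $ k\<bar> * \<bar>h1 i (z + u) - h1 i z\<bar>"
        unfolding lam_def using low z by (intro mult_left_mono) (auto simp: W'_def)
      then show "lam \<le> \<bar>g (h1 i) z\<bar>" by (simp add: g_def abs_mult)
      show "\<bar>g (h2 i) z\<bar> \<le> B * lam" "\<bar>g (h3 i) z\<bar> \<le> B * lam"
        using lip ik z by (auto intro!: gB)
    next
      fix z
      have p: "\<bar>x * y\<bar> \<le> M\<^sup>2" if "\<bar>x\<bar> \<le> M" "\<bar>y\<bar> \<le> M" for x y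
        unfolding abs_mult power2_eq_square using that M(1) by (intro mult_mono) auto
      show "\<bar>b z\<bar> \<le> N" unfolding b_def N_def using p[OF aM(1) aM(1), of "z + u" z] by simp
      show "\<bar>b1 z\<bar> \<le> N" unfolding b1_def N_def
        using p[OF aM(2) aM(1), of "z + u" z] p[OF aM(1) aM(2), of "z + u" z] by (simp add: abs_le_iff)
      show "\<bar>b2 z\<bar> \<le> N" unfolding b2_def N_def
        using p[OF aM(3) aM(1), of "z + u" z] p[OF aM(2) aM(2), of "z + u" z] p[OF aM(1) aM(3), of "z + u" z]
        unfolding abs_le_iff by linarith
    qed (use lam B N in auto)
    also have "\<dots> \<le> N * (1 + 3 * B + 2 * B^2) * (1 + B) / lam^2 * V"
      using N B lam KV by (intro mult_left_mono) auto
    also have "\<dots> \<le> N * (1 + 3 * B + 2 * B^2) * (1 + B) / (\<bar>\<xi> $ k\<bar> * (c * norm (drop_coord k u)))^2 * V"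
    proof (intro mult_right_mono divide_left_mono power_mono V)
      have "1 * (\<bar>\<xi> $ k\<bar> * (c * norm (drop_coord k u))) \<le> 2 * pi * (\<bar>\<xi> $ k\<bar> * (c * norm (drop_coord k u)))"
        using pi_ge_two c by (intro mult_right_mono) auto
      then show "\<bar>\<xi> $ k\<bar> * (c * norm (drop_coord k u)) \<le> lam" by (simp add: lam_def mult.assoc)
    qed (use N B lam nz c in auto)
    also have "\<dots> = D1 / (\<bar>\<xi> $ k\<bar> * norm (drop_coord k u))^2"
      by (simp add: D1_def power_mult_distrib)
    also have "\<dots> \<le> D / (\<bar>\<xi> $ k\<bar> * norm (drop_coord k u))^2"
      using V by (intro divide_right_mono) (auto simp: D_def)
    finally show "cmod (LINT z|lborel. wave \<xi> (z + u) * cnj (wave \<xi> z)) \<le> D / (\<bar>\<xi> $ k\<bar> * norm (drop_coord k u))\<^sup>2"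
      unfolding eq by (simp add: b_def a_def \<theta>_def)
  qed
qed

text \<open>Nearly tangential \<xi> are settled by \<open>decay_tangential\<close>. Otherwise |\<xi>
  $ k| is of order |\<xi>|, and the autocorrelation is bounded by a multiple of min(1, 1/(|\<xi>|
  |u'|)^2) with u' the tangential part of u. Integrated over two tangential coordinates this would
  give |\<xi>|^(-2) up to a logarithm; a step function on three nested boxes keeps enough of
  it.\<close>

lemma fourier_decay:
  obtains D where "\<And>\<xi>. 1 \<le> norm \<xi> \<Longrightarrow>
    (cmod (osc_int (bump z0 \<rho>) (phase \<xi>)))\<^sup>2 \<le> D * norm \<xi> powr (- (4/3))"
proof -
  obtain \<kappa> D0 where \<kappa>: "0 < \<kappa>" and D0: "0 \<le> D0" "\<And>\<xi>. \<xi> \<noteq> 0 \<Longrightarrow> \<bar>\<xi> $ k\<bar> \<le> \<kappa> * norm \<xi> \<Longrightarrow>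
       cmod (osc_int (bump z0 \<rho>) (phase \<xi>)) \<le> D0 / norm \<xi>"
    by (rule decay_tangential) (rule that)
  obtain D1 where D1: "0 \<le> D1" "\<And>\<xi> u. \<xi> $ k \<noteq> 0 \<Longrightarrow> drop_coord k u \<noteq> 0 \<Longrightarrow>
       cmod (LINT z|lborel. wave \<xi> (z + u) * cnj (wave \<xi> z)) \<le> D1 / (\<bar>\<xi> $ k\<bar> * norm (drop_coord k u))\<^sup>2"
      "\<And>\<xi> u. cmod (LINT z|lborel. wave \<xi> (z + u) * cnj (wave \<xi> z)) \<le> D1"
    by (rule autocorrelation_le) (rule that)
  define D2 where "D2 = D1 / \<kappa>\<^sup>2"
  have D2: "0 \<le> D2" using D1 by (simp add: D2_def)
  \<comment> \<open>Two tangential coordinates exist since the dimension is at least 3; smallness in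
    both makes the volume of the boxes below quadratic in s.\<close>
  obtain i j where ij: "i \<noteq> k" "j \<noteq> k" "i \<noteq> j"
  proof -
    have "2 \<le> card (UNIV - {k})" using card3 by (simp add: card_Diff_singleton)
    then have "\<not> card (UNIV - {k}) \<le> Suc 0" by simp
    then obtain i j where "i \<in> UNIV - {k}" "j \<in> UNIV - {k}" "i \<noteq> j"
      by (subst (asm) card_le_Suc0_iff_eq) auto
    then show thesis using that by blast
  qed
  \<comment> \<open>Increments are restricted by s only in i and j; in all other coordinates, k
    included, 2 \<rho> bounds the difference of two points of the support.\<close>
  define S where "S s = {u::real^'n. \<forall>l. \<bar>u $ l\<bar> \<le> (if l \<in> {i, j} then s else 2 * \<rho>)}" for s
  have S_box: "S s = cbox (\<chi> l. - (if l \<in> {i, j} then s else 2 * \<rho>)) (\<chi> l. if l \<in> {i, j} then s else 2 * \<rho>)" for s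
    by (auto simp: S_def mem_box_cart abs_le_iff) (metis minus_le_iff)+
  define G where "G = (4 * \<rho>) ^ card (UNIV - {i, j})"
  have G: "0 \<le> G" using \<rho> by (simp add: G_def)
  have S_meas: "measure lborel (S s) = (2 * s)\<^sup>2 * G" if "0 \<le> s" for s
  proof -
    have ne: "S s \<noteq> {}" using that \<rho> by (auto simp: S_def intro!: exI[of _ 0])
    have "measure lborel (S s) = (\<Prod>l\<in>UNIV. if l \<in> {i, j} then 2 * s else 4 * \<rho>)"
      unfolding S_box using ne[unfolded S_box]
      by (subst content_cbox_cart) (simp, intro prod.cong, auto split: if_splits)
    also have "\<dots> = (2 * s)\<^sup>2 * G"
    proof -
      have "UNIV \<inter> {l. l \<in> {i, j}} = {i, j}" "UNIV \<inter> - {l. l \<in> {i, j}} = UNIV - {i, j}" by auto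
      moreover have "card {i, j} = 2" using ij(3) by simp
      ultimately show ?thesis
        unfolding G_def by (subst prod.If_cases) (simp_all only: prod_constant finite)
    qed
    finally show ?thesis .
  qed
  have S_set: "S s \<in> sets borel" "emeasure lborel (S s) < \<infinity>" for s
    unfolding S_box by (auto simp: emeasure_lborel_cbox_eq)
  define E where "E = D1 * 4 * G + D2 * 4 * G + D2 * (4 * \<rho>)\<^sup>2 * G + D0\<^sup>2"
  show thesis
  proof (rule that[of E])
    fix \<xi> :: "real^'n" assume \<xi>: "1 \<le> norm \<xi>"
    define T where "T = norm \<xi> powr (1/3)"
    have T: "1 \<le> T" using \<xi> by (simp add: T_def ge_one_powr_ge_zero)
    have pos: "0 < norm \<xi>" using \<xi> by linarith
    have Tn: "T ^ n = norm \<xi> powr (real n / 3)" for n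
    proof -
      have "T ^ n = T powr real n" using T by (intro powr_realpow[symmetric]) simp
      then show ?thesis by (simp add: T_def powr_powr)
    qed
    have T3: "T ^ 3 = norm \<xi>" using pos by (simp add: Tn)
    have T4: "norm \<xi> powr (- (4/3)) = 1 / T ^ 4"
      by (simp add: Tn powr_minus_divide)
    have "(cmod (osc_int (bump z0 \<rho>) (phase \<xi>)))\<^sup>2 \<le> E * (1 / T ^ 4)"
    proof (cases "\<bar>\<xi> $ k\<bar> \<le> \<kappa> * norm \<xi>")
      case True
      have "(cmod (osc_int (bump z0 \<rho>) (phase \<xi>)))\<^sup>2 \<le> (D0 / norm \<xi>)\<^sup>2"
        using D0(2)[of \<xi>] pos True by (intro power_mono) auto
      also have "\<dots> = D0\<^sup>2 * (1 / T ^ 6)"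
        by (simp add: T3[symmetric] power_divide power_mult[symmetric])
      also have "\<dots> \<le> D0\<^sup>2 * (1 / T ^ 4)"
        using T by (intro mult_left_mono divide_left_mono power_increasing) auto
      also have "\<dots> \<le> E * (1 / T ^ 4)"
        using T D1 D2 G by (intro mult_right_mono) (auto simp: E_def)
      finally show ?thesis .
    next
      case False
      have k0: "\<xi> $ k \<noteq> 0" using False \<kappa> by (auto simp: mult_less_0_iff)
      \<comment> \<open>Increments smaller than \<open>1 / T\<^sup>2\<close> contribute by volume, the others by the decay of the
        autocorrelation; the cut at \<open>1 / T\<close> makes all three contributions \<open>O(1 / T ^ 4)\<close>.\<close>
      define w where "w u = D1 * indicator (S (1 / T\<^sup>2)) u + (D2 / T\<^sup>2) * indicator (S (1 / T)) u
          + (D2 / T ^ 4) * indicator (S (2 * \<rho>)) u" for u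
      have int: "integrable lborel (\<lambda>u. indicator (S s) u :: real)" for s
        using S_set[of s] by (intro integrable_real_indicator) auto
      have "(cmod (osc_int (bump z0 \<rho>) (phase \<xi>)))\<^sup>2 \<le> (LINT u|lborel. w u)"
      proof (rule norm_integral_sq_le_autocorrelation)
        show "continuous_on UNIV (wave \<xi>)"
          by (rule continuous_on_mult_support[OF openW closed_cball \<rho>(2)])
             (auto intro!: continuous_intros cont_phase simp: bump_eq_0[OF \<rho>(1)] simp del: mem_cball)
        show "compact (cball z0 \<rho>)" by simp
        show "wave \<xi> z = 0" if "z \<notin> cball z0 \<rho>" for z using bump_eq_0(1)[OF \<rho>(1) that] by simp
        show "integrable lborel w" unfolding w_def by (intro Bochner_Integration.integrable_add integrable_mult_right int)
        fix u
        have wnn: "0 \<le> w u" using D1 D2 T by (auto simp: w_def split: split_indicator)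
        have far: "cmod (LINT z|lborel. wave \<xi> (z + u) * cnj (wave \<xi> z)) \<le> D2 / (T ^ 3 * s)\<^sup>2"
          if s: "0 < s" "s \<le> norm (drop_coord k u)" for s
        proof -
          have "cmod (LINT z|lborel. wave \<xi> (z + u) * cnj (wave \<xi> z)) \<le> D1 / (\<bar>\<xi> $ k\<bar> * norm (drop_coord k u))\<^sup>2"
            using s by (intro D1(2) k0) auto
          also have "\<dots> \<le> D1 / (\<kappa> * T ^ 3 * s)\<^sup>2"
            using False s \<kappa> T D1(1) k0 pos unfolding T3
            by (intro divide_left_mono power_mono mult_mono mult_pos_pos zero_less_power) auto
          also have "\<dots> = D2 / (T ^ 3 * s)\<^sup>2" by (simp add: D2_def power_mult_distrib)
          finally show ?thesis .
        qed
        \<comment> \<open>Leaving the small box while staying in the large one means exceeding s in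
          coordinate i or j, and these two survive \<open>drop_coord k\<close>.\<close>
        have big: "s < norm (drop_coord k u)" if "u \<notin> S s" "u \<in> S (2 * \<rho>)" for s
        proof -
          have "\<exists>l. \<not> \<bar>u $ l\<bar> \<le> (if l \<in> {i, j} then s else 2 * \<rho>)" using that(1) unfolding S_def by blast
          then obtain l where l: "\<not> \<bar>u $ l\<bar> \<le> (if l \<in> {i, j} then s else 2 * \<rho>)" by blast
          moreover have "\<bar>u $ l\<bar> \<le> 2 * \<rho>" using that(2) by (auto simp: S_def split: if_splits)
          ultimately have "l \<in> {i, j}" "s < \<bar>u $ l\<bar>" by (auto split: if_splits)
          then show ?thesis using component_le_norm_drop_coord[of l k u] ij by force
        qed
        consider "u \<notin> S (2 * \<rho>)" | "u \<in> S (1 / T\<^sup>2)" | "u \<in> S (2 * \<rho>)" "u \<notin> S (1 / T\<^sup>2)" "u \<in> S (1 / T)"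
          | "u \<in> S (2 * \<rho>)" "u \<notin> S (1 / T)" by blast
        then show "cmod (LINT z|lborel. wave \<xi> (z + u) * cnj (wave \<xi> z)) \<le> w u"
        proof cases
          case 1
          then obtain l where "2 * \<rho> < \<bar>u $ l\<bar>" by (auto simp: S_def not_le)
          then have nu: "2 * \<rho> < norm u" using component_le_norm_cart[of u l] by linarith
          have "wave \<xi> (z + u) * cnj (wave \<xi> z) = 0" for z
          proof -
            have "\<not> (z + u \<in> cball z0 \<rho> \<and> z \<in> cball z0 \<rho>)"
              using nu norm_triangle_ineq4[of "z + u - z0" "z - z0"] by (auto simp: dist_norm norm_minus_commute)
            then show ?thesis using bump_eq_0(1)[OF \<rho>(1), of z z0] bump_eq_0(1)[OF \<rho>(1), of "z + u" z0] by auto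
          qed
          then show ?thesis using wnn by (simp only: integral_zero norm_zero)
        next
          case 2
          have "D1 \<le> w u" using 2 D1 D2 T by (auto simp: w_def split: split_indicator)
          then show ?thesis by (rule order_trans[OF D1(3)])
        next
          case 3
          have "D2 / T\<^sup>2 \<le> w u" using 3 D1 D2 T by (auto simp: w_def split: split_indicator)
          moreover have "(T ^ 3 * (1 / T\<^sup>2))\<^sup>2 = T\<^sup>2" using T by (simp add: power3_eq_cube power2_eq_square)
          ultimately show ?thesis using far[of "1 / T\<^sup>2"] big[OF 3(2,1)] T by simp
        next
          case 4
          have "D2 / T ^ 4 \<le> w u" using 4 D1 D2 T by (auto simp: w_def split: split_indicator)
          moreover have "(T ^ 3 * (1 / T))\<^sup>2 = T ^ 4" using T by (simp add: power3_eq_cube power2_eq_square power4_eq_xxxx)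
          ultimately show ?thesis using far[of "1 / T"] big[OF 4(2,1)] T by simp
        qed
      qed
      also have "(LINT u|lborel. w u) = D1 * measure lborel (S (1 / T\<^sup>2)) + (D2 / T\<^sup>2) * measure lborel (S (1 / T))
          + (D2 / T ^ 4) * measure lborel (S (2 * \<rho>))"
        unfolding w_def using int S_set by simp
      also have "\<dots> = (D1 * 4 * G + D2 * 4 * G + D2 * (4 * \<rho>)\<^sup>2 * G) * (1 / T ^ 4)"
        using T \<rho>(1) by (simp add: S_meas power_mult_distrib power_divide field_simps power2_eq_square power4_eq_xxxx)
      also have "\<dots> \<le> E * (1 / T ^ 4)"
        using T by (intro mult_right_mono) (auto simp: E_def)
      finally show ?thesis .
    qed
    then show "(cmod (osc_int (bump z0 \<rho>) (phase \<xi>)))\<^sup>2 \<le> E * norm \<xi> powr (- (4/3))" by (simp add: T4)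
  qed
qed

end

section \<open>Curved hypersurfaces as graphs\<close>

lemma frechet_derivative_cong_open:
  assumes "open S" "x \<in> S" "\<And>y. y \<in> S \<Longrightarrow> f y = g y"
  shows "frechet_derivative f (at x) = frechet_derivative g (at x)"
proof -
  have "(f has_derivative D) (at x) \<longleftrightarrow> (g has_derivative D) (at x)" for D
    using assms has_derivative_transform_within_open[of f D x UNIV S g]
      has_derivative_transform_within_open[of g D x UNIV S f] by metis
  then show ?thesis by (simp add: frechet_derivative_def)
qed

lemma differentiable_cong_open:
  assumes "open S" "x \<in> S" "\<And>y. y \<in> S \<Longrightarrow> f y = g y" "f differentiable (at x)"
  shows "g differentiable (at x)"
  using assms has_derivative_transform_within_open[of f _ x UNIV S g]
  unfolding differentiable_def by metis

text \<open>\<open>Ck_on\<close> recurses on the derivative as a function of the base point, but the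
  differentiation rules identify that function only at points of S. This congruence bridges the
  two.\<close>

lemma Ck_on_cong:
  assumes "open S" "\<And>x. x \<in> S \<Longrightarrow> f x = g x" "Ck_on n S f"
  shows "Ck_on n S g"
  using assms
proof (induction n arbitrary: f g)
  case 0
  then show ?case by (auto intro: continuous_on_eq)
next
  case (Suc n)
  have "g differentiable (at x)" if "x \<in> S" for x
    using Suc.prems that differentiable_cong_open[of S x f g] by auto
  moreover have "Ck_on n S (\<lambda>x. frechet_derivative g (at x) v)" for v
  proof (rule Suc.IH[OF Suc.prems(1)])
    show "Ck_on n S (\<lambda>x. frechet_derivative f (at x) v)" using Suc.prems(3) by simp
    show "frechet_derivative f (at x) v = frechet_derivative g (at x) v" if "x \<in> S" for x
      using frechet_derivative_cong_open[OF Suc.prems(1) that, of f g] Suc.prems(2) by simp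
  qed
  ultimately show ?case by simp
qed

lemma Ck_on_SucD: "Ck_on (Suc n) S f \<Longrightarrow> Ck_on n S f"
proof (induction n arbitrary: f)
  case 0
  then show ?case
    by (auto intro!: continuous_at_imp_continuous_on differentiable_imp_continuous_within)
next
  case (Suc n)
  have "Ck_on n S (\<lambda>x. frechet_derivative f (at x) v)" for v
    using Suc.prems by (intro Suc.IH) simp
  then show ?case using Suc.prems by simp
qed

lemma Ck_on_const: "Ck_on n S (\<lambda>x. c)"
proof (induction n arbitrary: c)
  case (Suc n)
  have "(\<lambda>x. frechet_derivative (\<lambda>x. c) (at x) v) = (\<lambda>x. 0)" for v :: 'a
    by (simp add: frechet_derivative_const)
  then show ?case using Suc by simp
qed simp

lemma Ck_on_add:
  assumes "open S" "Ck_on n S f" "Ck_on n S g"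
  shows "Ck_on n S (\<lambda>x. f x + g x)"
  using assms
proof (induction n arbitrary: f g)
  case (Suc n)
  have "Ck_on n S (\<lambda>x. frechet_derivative (\<lambda>x. f x + g x) (at x) v)" for v
  proof (rule Ck_on_cong[OF \<open>open S\<close>])
    show "Ck_on n S (\<lambda>x. frechet_derivative f (at x) v + frechet_derivative g (at x) v)"
      using Suc by simp
    show "frechet_derivative f (at x) v + frechet_derivative g (at x) v = frechet_derivative (\<lambda>x. f x + g x) (at x) v" if "x \<in> S" for x
    proof -
      have "((\<lambda>x. f x + g x) has_derivative (\<lambda>v. frechet_derivative f (at x) v + frechet_derivative g (at x) v)) (at x)"
        using Suc.prems that by (intro has_derivative_add) (auto simp: frechet_derivative_works[symmetric])
      from frechet_derivative_at[OF this] show ?thesis by metis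
    qed
  qed
  then show ?case using Suc.prems by (auto intro: differentiable_add)
qed (auto intro: continuous_on_add)

lemma Ck_on_mult:
  fixes f g :: "'a::real_normed_vector \<Rightarrow> real"
  assumes "open S" "Ck_on n S f" "Ck_on n S g"
  shows "Ck_on n S (\<lambda>x. f x * g x)"
  using assms
proof (induction n arbitrary: f g)
  case (Suc n)
  have "Ck_on n S (\<lambda>x. frechet_derivative (\<lambda>x. f x * g x) (at x) v)" for v
  proof (rule Ck_on_cong[OF \<open>open S\<close>])
    show "Ck_on n S (\<lambda>x. f x * frechet_derivative g (at x) v + frechet_derivative f (at x) v * g x)"
      using Suc.prems by (intro Ck_on_add Suc.IH) (auto dest: Ck_on_SucD simp del: Ck_on.simps, auto)
    show "f x * frechet_derivative g (at x) v + frechet_derivative f (at x) v * g x = frechet_derivative (\<lambda>x. f x * g x) (at x) v" if "x \<in> S" for x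
    proof -
      have "((\<lambda>x. f x * g x) has_derivative (\<lambda>v. f x * frechet_derivative g (at x) v + frechet_derivative f (at x) v * g x)) (at x)"
        using Suc.prems that by (intro has_derivative_mult) (auto simp: frechet_derivative_works[symmetric])
      from frechet_derivative_at[OF this] show ?thesis by metis
    qed
  qed
  then show ?case using Suc.prems by (auto intro: differentiable_mult)
qed (auto intro: continuous_on_mult)

text \<open>Induction with f fixed: the derivative of 1/f is -(1/f)^2 times that of f, and at order
  n the factors 1/f are covered by the induction hypothesis.\<close>

lemma Ck_on_inverse:
  fixes f :: "'a::real_normed_vector \<Rightarrow> real"
  assumes "open S" "Ck_on n S f" and nz: "\<And>x. x \<in> S \<Longrightarrow> f x \<noteq> 0"
  shows "Ck_on n S (\<lambda>x. inverse (f x))"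
  using assms(2)
proof (induction n)
  case (Suc n)
  have IH: "Ck_on n S (\<lambda>x. inverse (f x))" using Suc Ck_on_SucD by blast
  have "Ck_on n S (\<lambda>x. frechet_derivative (\<lambda>x. inverse (f x)) (at x) v)" for v
  proof (rule Ck_on_cong[OF \<open>open S\<close>])
    show "Ck_on n S (\<lambda>x. (-1) * ((inverse (f x) * frechet_derivative f (at x) v) * inverse (f x)))"
      using Suc.prems by (intro Ck_on_mult[OF \<open>open S\<close>] IH Ck_on_const) auto
    show "(-1) * ((inverse (f x) * frechet_derivative f (at x) v) * inverse (f x)) = frechet_derivative (\<lambda>x. inverse (f x)) (at x) v" if "x \<in> S" for x
    proof -
      have "((\<lambda>x. inverse (f x)) has_derivative (\<lambda>v. - (inverse (f x) * frechet_derivative f (at x) v * inverse (f x)))) (at x)"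
        using Suc.prems that nz by (intro Deriv.has_derivative_inverse) (auto simp: frechet_derivative_works[symmetric])
      from frechet_derivative_at[OF this] show ?thesis by (metis mult_minus1)
    qed
  qed
  then show ?case using Suc.prems nz by (auto intro: differentiable_inverse)
qed (use nz in \<open>auto intro: continuous_on_inverse\<close>)

definition partial :: "'n \<Rightarrow> (real^'n \<Rightarrow> real) \<Rightarrow> real^'n \<Rightarrow> real" where
  "partial i F x = frechet_derivative F (at x) (axis i 1)"

lemma grad_nth: "grad F x $ i = partial i F x"
  by (simp add: grad_def partial_def)

lemma smooth_on_partial: "smooth_on S F \<Longrightarrow> smooth_on S (partial i F)"
  unfolding smooth_on_def partial_def by (metis Ck_on.simps(2))

lemma smooth_on_mult:
  fixes f g :: "'a::real_normed_vector \<Rightarrow> real"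
  shows "open S \<Longrightarrow> smooth_on S f \<Longrightarrow> smooth_on S g \<Longrightarrow> smooth_on S (\<lambda>x. f x * g x)"
  unfolding smooth_on_def by (blast intro: Ck_on_mult)

lemma smooth_on_add: "open S \<Longrightarrow> smooth_on S f \<Longrightarrow> smooth_on S g \<Longrightarrow> smooth_on S (\<lambda>x. f x + g x)"
  unfolding smooth_on_def by (blast intro: Ck_on_add)

lemma smooth_on_const: "smooth_on S (\<lambda>x. c)"
  unfolding smooth_on_def by (blast intro: Ck_on_const)

lemma smooth_on_inverse:
  fixes f :: "'a::real_normed_vector \<Rightarrow> real"
  shows "open S \<Longrightarrow> smooth_on S f \<Longrightarrow> (\<And>x. x \<in> S \<Longrightarrow> f x \<noteq> 0) \<Longrightarrow> smooth_on S (\<lambda>x. inverse (f x))"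
  unfolding smooth_on_def by (blast intro: Ck_on_inverse)

lemma Ck_on_subset: "Ck_on n S f \<Longrightarrow> T \<subseteq> S \<Longrightarrow> Ck_on n T f"
  by (induction n arbitrary: f) (auto intro: continuous_on_subset)

lemma smooth_on_subset: "smooth_on S f \<Longrightarrow> T \<subseteq> S \<Longrightarrow> smooth_on T f"
  unfolding smooth_on_def by (blast intro: Ck_on_subset)

lemma smooth_on_imp_continuous_on: "smooth_on S f \<Longrightarrow> continuous_on S f"
  unfolding smooth_on_def by (metis Ck_on.simps(1))

lemma smooth_on_has_derivative:
  fixes F :: "real^'n \<Rightarrow> real"
  assumes "smooth_on S F" "x \<in> S"
  shows "(F has_derivative (\<lambda>v. \<Sum>i\<in>UNIV. v $ i * partial i F x)) (at x)"
proof -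
  have "Ck_on (Suc 0) S F" using assms(1) unfolding smooth_on_def by blast
  then have "F differentiable (at x)" using assms(2) by simp
  then have D: "(F has_derivative frechet_derivative F (at x)) (at x)" by (simp add: frechet_derivative_works)
  then interpret linear "frechet_derivative F (at x)" by (rule has_derivative_linear)
  have "frechet_derivative F (at x) v = (\<Sum>i\<in>UNIV. v $ i * partial i F x)" for v
  proof -
    have "v = (\<Sum>i\<in>UNIV. v $ i *\<^sub>R axis i 1)"
      using basis_expansion[of v] by (simp add: scalar_mult_eq_scaleR)
    then have "frechet_derivative F (at x) v = frechet_derivative F (at x) (\<Sum>i\<in>UNIV. v $ i *\<^sub>R axis i 1)" by simp
    also have "\<dots> = (\<Sum>i\<in>UNIV. v $ i * partial i F x)"
      by (simp add: sum scale partial_def)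
    finally show ?thesis .
  qed
  then have "frechet_derivative F (at x) = (\<lambda>v. \<Sum>i\<in>UNIV. v $ i * partial i F x)" by (rule ext)
  with D show ?thesis by simp
qed

lemma has_dir_derivI:
  assumes "(f has_derivative D) (at z)" "D v = f' z"
  shows "has_dir_deriv v f f' z"
proof -
  have "((\<lambda>t. z + t *\<^sub>R v) has_vector_derivative v) (at 0)"
    by (auto intro!: derivative_eq_intros)
  moreover have "(f has_derivative D) (at (z + 0 *\<^sub>R v))" using assms(1) by simp
  ultimately have "((f \<circ> (\<lambda>t. z + t *\<^sub>R v)) has_derivative (D \<circ> (\<lambda>t. t *\<^sub>R v))) (at 0)"
    unfolding has_vector_derivative_def by (intro diff_chain_at)
  moreover have "D \<circ> (\<lambda>t. t *\<^sub>R v) = (\<lambda>t. t *\<^sub>R f' z)"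
    using linear_scale[OF has_derivative_linear[OF assms(1)]] assms(2) by auto
  ultimately show ?thesis
    unfolding has_dir_deriv_def has_vector_derivative_def by (simp add: comp_def)
qed

text \<open>Mean value inequality, on a small ball, for f minus its linear part at
  \<open>z0\<close>. The error is uniform over pairs of points, which turns injectivity of a
  derivative at one point into lower bounds for increments nearby; the eventual form lets finitely
  many functions share one radius.\<close>

lemma strictly_differentiable:
  fixes f :: "real^'n \<Rightarrow> real"
  assumes "open W" "z0 \<in> W" and der: "\<And>z. z \<in> W \<Longrightarrow> (f has_derivative (\<lambda>u. \<Sum>i\<in>UNIV. u $ i * d i z)) (at z)"
    and cont: "\<And>i. continuous_on W (d i)" and "0 < e"
  shows "\<forall>\<^sub>F r in at_right 0. ball z0 r \<subseteq> W \<and>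
     (\<forall>x\<in>ball z0 r. \<forall>y\<in>ball z0 r. \<bar>f x - f y - (\<Sum>i\<in>UNIV. (x - y) $ i * d i z0)\<bar> \<le> e * norm (x - y))"
proof -
  let ?n = "real CARD('n)"
  have "\<forall>\<^sub>F z in nhds z0. \<bar>d i z - d i z0\<bar> < e / ?n" for i
  proof -
    have "isCont (d i) z0" using cont assms by (simp add: continuous_on_eq_continuous_at)
    then have "((\<lambda>z. \<bar>d i z - d i z0\<bar>) \<longlongrightarrow> \<bar>d i z0 - d i z0\<bar>) (nhds z0)"
      unfolding isCont_def by (intro tendsto_intros) (simp add: tendsto_at_iff_tendsto_nhds)
    then show ?thesis using \<open>0 < e\<close> by (intro order_tendstoD(2)) auto
  qed
  then have "\<forall>\<^sub>F z in nhds z0. \<forall>i\<in>UNIV. \<bar>d i z - d i z0\<bar> < e / ?n"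
    by (intro eventually_ball_finite) auto
  moreover have "\<forall>\<^sub>F z in nhds z0. z \<in> W" using assms by (simp add: eventually_nhds_in_open)
  ultimately have "\<forall>\<^sub>F z in nhds z0. z \<in> W \<and> (\<forall>i\<in>UNIV. \<bar>d i z - d i z0\<bar> < e / ?n)" by eventually_elim auto
  then obtain r0 where r0: "0 < r0" "\<And>z. dist z z0 < r0 \<Longrightarrow> z \<in> W \<and> (\<forall>i. \<bar>d i z - d i z0\<bar> < e / ?n)"
    unfolding eventually_nhds_metric by auto
  have main: "ball z0 r \<subseteq> W \<and> (\<forall>x\<in>ball z0 r. \<forall>y\<in>ball z0 r. \<bar>f x - f y - (\<Sum>i\<in>UNIV. (x - y) $ i * d i z0)\<bar> \<le> e * norm (x - y))"
    if "r < r0" for r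
  proof (intro conjI ballI)
    show "ball z0 r \<subseteq> W" using r0 that by (auto simp: dist_commute)
    fix x y assume xy: "x \<in> ball z0 r" "y \<in> ball z0 r"
    let ?g = "\<lambda>z. f z - (\<Sum>i\<in>UNIV. z $ i * d i z0)"
    have "norm (?g x - ?g y) \<le> e * norm (x - y)"
    proof (rule differentiable_bound[where f = ?g and S = "ball z0 r" and
          f' = "\<lambda>z u. (\<Sum>i\<in>UNIV. u $ i * d i z) - (\<Sum>i\<in>UNIV. u $ i * d i z0)"])
      show "convex (ball z0 r)" "x \<in> ball z0 r" "y \<in> ball z0 r" using xy by auto
      fix z assume "z \<in> ball z0 r"
      then have z: "z \<in> W" "\<And>i. \<bar>d i z - d i z0\<bar> < e / ?n" using r0 that by (auto simp: dist_commute)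
      show "(?g has_derivative (\<lambda>u. (\<Sum>i\<in>UNIV. u $ i * d i z) - (\<Sum>i\<in>UNIV. u $ i * d i z0))) (at z within ball z0 r)"
      proof (rule has_derivative_at_withinI, rule has_derivative_diff)
        show "(f has_derivative (\<lambda>u. \<Sum>i\<in>UNIV. u $ i * d i z)) (at z)" by (rule der[OF z(1)])
        show "((\<lambda>z. \<Sum>i\<in>UNIV. z $ i * d i z0) has_derivative (\<lambda>u. \<Sum>i\<in>UNIV. u $ i * d i z0)) (at z)"
          by (intro has_derivative_sum has_derivative_mult_left bounded_linear_imp_has_derivative bounded_linear_vec_nth)
      qed
      show "onorm (\<lambda>u. (\<Sum>i\<in>UNIV. u $ i * d i z) - (\<Sum>i\<in>UNIV. u $ i * d i z0)) \<le> e"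
      proof (rule onorm_le)
        fix u :: "real^'n"
        have "\<bar>(\<Sum>i\<in>UNIV. u $ i * d i z) - (\<Sum>i\<in>UNIV. u $ i * d i z0)\<bar> = \<bar>\<Sum>i\<in>UNIV. u $ i * (d i z - d i z0)\<bar>"
          by (simp add: sum_subtractf right_diff_distrib)
        also have "\<dots> \<le> (\<Sum>i\<in>UNIV. \<bar>u $ i * (d i z - d i z0)\<bar>)" by (rule sum_abs)
        also have "\<dots> \<le> (\<Sum>i\<in>(UNIV::'n set). norm u * (e / ?n))"
          unfolding abs_mult using z(2) component_le_norm_cart[of u]
          by (intro sum_mono mult_mono) (auto intro: less_imp_le)
        also have "\<dots> = e * norm u" by simp
        finally show "norm ((\<Sum>i\<in>UNIV. u $ i * d i z) - (\<Sum>i\<in>UNIV. u $ i * d i z0)) \<le> e * norm u" by simp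
      qed
    qed
    then show "\<bar>f x - f y - (\<Sum>i\<in>UNIV. (x - y) $ i * d i z0)\<bar> \<le> e * norm (x - y)"
      by (simp add: sum_subtractf left_diff_distrib algebra_simps)
  qed
  show ?thesis
    unfolding eventually_at_right_field using r0(1) main by blast
qed

text \<open>Implicit differentiation: on the zero set of F this is the i-th partial derivative of
  the graph function, but written as a function on the ambient space. For i = k it is -1, so the
  slopes together form a normal vector with k-th entry -1.\<close>

definition slope :: "'n \<Rightarrow> (real^'n \<Rightarrow> real) \<Rightarrow> 'n \<Rightarrow> real^'n \<Rightarrow> real" where
  "slope k F i x = (- 1) * (partial i F x * inverse (partial k F x))"

lemma smooth_on_slope:
  assumes "open U" "smooth_on U F" "\<And>x. x \<in> U \<Longrightarrow> partial k F x \<noteq> 0"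
  shows "smooth_on U (slope k F i)"
  unfolding slope_def[abs_def]
  by (intro smooth_on_mult smooth_on_const smooth_on_inverse smooth_on_partial assms)

text \<open>Near \<open>p\<close> the unit normal is a function of the slopes alone, so it is stationary in every
  direction in which all slopes are.\<close>

lemma gauss_curvature_nondegenerate:
  fixes F :: "real^'n \<Rightarrow> real"
  assumes U: "open U" "p \<in> U" "smooth_on U F" and k: "\<And>x. x \<in> U \<Longrightarrow> partial k F x \<noteq> 0"
    and curv: "gauss_curvature F p \<noteq> 0"
    and tangent: "(\<Sum>i\<in>UNIV. w $ i * partial i F p) = 0"
    and flat: "\<And>i. (\<Sum>j\<in>UNIV. w $ j * partial j (slope k F i) p) = 0"
  shows "w = 0"
proof -
  define G where "G x = (\<chi> i. slope k F i x)" for x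
  \<comment> \<open>The gradient is -\<open>partial k F\<close> times the slope vector, so
    normalizing the slopes may reverse the normal; s is the sign to restore, and it is constant on
    V.\<close>
  define s where "s = sgn (- partial k F p)"
  define V where "V = {x\<in>U. 0 < s * (- partial k F x)}"
  have s: "s = 1 \<or> s = -1" using k[OF U(2)] by (auto simp: s_def sgn_if)
  have cpk: "continuous_on U (\<lambda>x. s * (- partial k F x))"
    by (intro continuous_intros smooth_on_imp_continuous_on smooth_on_partial U)
  have "V = U \<inter> (\<lambda>x. s * (- partial k F x)) -` {0<..}" by (auto simp: V_def)
  then have V: "open V" using continuous_open_preimage[OF cpk U(1), of "{0<..}"] by simp
  have pV: "p \<in> V" using U(2) k[OF U(2)] by (simp add: V_def s_def sgn_if)
  have gradG: "grad F x = (- partial k F x) *\<^sub>R G x" if "x \<in> U" for x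
    using k[OF that] by (simp add: vec_eq_iff grad_nth G_def slope_def)
  define q where "q v = (s * inverse (norm v)) *\<^sub>R v" for v :: "real^'n"
  have N: "unit_normal F x = q (G x)" if x: "x \<in> V" for x
  proof -
    have xU: "x \<in> U" using x by (simp add: V_def)
    have "\<bar>partial k F x\<bar> = s * (- partial k F x)" using s x by (auto simp: V_def)
    then have "norm (grad F x) = s * (- partial k F x) * norm (G x)" by (simp add: gradG[OF xU])
    moreover have "inverse (s * (- partial k F x)) * (- partial k F x) = s" using s k[OF xU] by auto
    ultimately show ?thesis
      by (simp add: unit_normal_def q_def gradG[OF xU] inverse_mult_distrib mult.assoc mult.left_commute)
  qed
  \<comment> \<open>The k-th entry keeps the slope vector away from 0, where the normalization q
    would not be differentiable.\<close>
  have "G p $ k = -1" using k[OF U(2)] by (simp add: G_def slope_def)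
  then have Gp: "G p \<noteq> 0" by (metis zero_index zero_neq_neg_one)
  have "q differentiable (at (G p))"
    unfolding q_def using Gp
    by (intro differentiable_scaleR differentiable_mult differentiable_const differentiable_inverse
         differentiable_norm_at differentiable_ident) auto
  then obtain q' where q': "(q has_derivative q') (at (G p))" by (auto simp: differentiable_def)
  define G' where "G' v = (\<chi> i. \<Sum>j\<in>UNIV. v $ j * partial j (slope k F i) p)" for v
  have G': "(G has_derivative G') (at p)"
    unfolding has_derivative_componentwise_within[of G]
  proof
    fix b :: "real^'n" assume "b \<in> Basis"
    then obtain i where b: "b = axis i 1" by (auto simp: Basis_vec_def)
    show "((\<lambda>x. G x \<bullet> b) has_derivative (\<lambda>x. G' x \<bullet> b)) (at p)"
      using smooth_on_has_derivative[OF smooth_on_slope[OF U(1,3) k, of i] U(2)]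
      by (simp add: b inner_axis G_def G'_def)
  qed
  have "((q \<circ> G) has_derivative (q' \<circ> G')) (at p)" using G' q' by (rule diff_chain_at)
  then have DN: "(unit_normal F has_derivative (q' \<circ> G')) (at p)"
    by (rule has_derivative_transform_within_open[OF _ V pV]) (simp add: N)
  have fN: "frechet_derivative (unit_normal F) (at p) = q' \<circ> G'"
    using frechet_derivative_at[OF DN] by simp
  define n where "n = unit_normal F p"
  define L where "L = (\<lambda>v. frechet_derivative (unit_normal F) (at p) (v - (v \<bullet> n) *\<^sub>R n) + (v \<bullet> n) *\<^sub>R n)"
  have linN: "linear (q' \<circ> G')" using DN by (rule has_derivative_linear)
  have linL: "linear L"
  proof (rule linearI)
    fix x y :: "real^'n" and r :: real
    have "x + y - ((x + y) \<bullet> n) *\<^sub>R n = (x - (x \<bullet> n) *\<^sub>R n) + (y - (y \<bullet> n) *\<^sub>R n)"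
      by (simp add: inner_add_left scaleR_add_left)
    then show "L (x + y) = L x + L y"
      unfolding L_def fN by (simp only: linear_add[OF linN]) (simp add: inner_add_left scaleR_add_left)
    have "r *\<^sub>R x - ((r *\<^sub>R x) \<bullet> n) *\<^sub>R n = r *\<^sub>R (x - (x \<bullet> n) *\<^sub>R n)"
      by (simp add: scaleR_diff_right)
    then show "L (r *\<^sub>R x) = r *\<^sub>R L x"
      unfolding L_def fN by (simp only: linear_scale[OF linN]) (simp add: scaleR_add_right)
  qed
  have "det (matrix L) \<noteq> 0" using curv by (simp add: gauss_curvature_def L_def n_def Let_def)
  then have inj: "inj L" using det_nz_iff_inj[OF linL] by blast
  have "w \<bullet> grad F p = 0" using tangent by (simp add: inner_vec_def grad_nth)
  then have "w \<bullet> n = 0" by (simp add: n_def unit_normal_def)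
  moreover have "G' w = 0" using flat by (simp add: G'_def vec_eq_iff)
  ultimately have "L w = 0" using linear_0[OF has_derivative_linear[OF q']] by (simp add: L_def fN)
  then have "L w = L 0" using linear_0[OF linL] by simp
  then show "w = 0" by (rule injD[OF inj])
qed

section \<open>Graph parametrization over a coordinate hyperplane\<close>

lemma linear_drop_coord: "linear (drop_coord k)"
  by (rule linearI) (simp_all add: drop_coord_def algebra_simps)

lemma drop_coord_idem: "drop_coord k (drop_coord k u) = drop_coord k u"
  by (simp add: vec_eq_iff drop_coord_nth)

lemma has_derivative_drop_coord: "(drop_coord k has_derivative drop_coord k) F"
  using linear_drop_coord by (intro bounded_linear_imp_has_derivative) (simp add: linear_conv_bounded_linear)

lemma norm_drop_coord_le: "norm (drop_coord k u) \<le> norm u"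
  by (rule norm_le_componentwise_cart) (simp add: drop_coord_nth)

lemma axis_coord_sum:
  "(\<Sum>i\<in>UNIV. (v + c *\<^sub>R axis k (1::real)) $ i * f i) = (\<Sum>i\<in>UNIV. v $ i * f i) + c * f k"
proof -
  have "(\<Sum>i\<in>UNIV. (v + c *\<^sub>R axis k 1) $ i * f i) = (\<Sum>i\<in>UNIV. v $ i * f i + (if i = k then c * f k else 0))"
    by (intro sum.cong) (auto simp: axis_def algebra_simps)
  then show ?thesis by (simp add: sum.distrib)
qed

text \<open>The differential of a graph parametrization with slopes s: it forgets the k-th component
  of u and lifts the rest to the tangent space.\<close>

abbreviation graph_tangent :: "'n \<Rightarrow> ('n \<Rightarrow> real) \<Rightarrow> real^'n \<Rightarrow> real^'n" where
  "graph_tangent k s \<equiv> (\<lambda>u. drop_coord k u + (\<Sum>j\<in>UNIV. drop_coord k u $ j * s j) *\<^sub>R axis k 1)"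

text \<open>The map \<open>\<Psi>\<close> replaces the k-th coordinate of x by F x, so it is locally
  invertible and sends zeros of F into the hyperplane of vectors with k-th coordinate 0. Its local
  inverse, preceded by the projection to that hyperplane, is the parametrization.\<close>

lemma implicit_graph:
  fixes F :: "real^'n \<Rightarrow> real"
  assumes U: "open U" "p \<in> U" "smooth_on U F" and k: "\<And>x. x \<in> U \<Longrightarrow> partial k F x \<noteq> 0" and Fp: "F p = 0"
  obtains V \<Phi> where "open V" "drop_coord k p \<in> V" "\<Phi> (drop_coord k p) = p"
    "\<And>z. \<Phi> (drop_coord k z) = \<Phi> z"
    "\<And>z. z \<in> V \<Longrightarrow> \<Phi> z \<in> U" "\<And>z. z \<in> V \<Longrightarrow> F (\<Phi> z) = 0"
    "\<And>z. z \<in> V \<Longrightarrow> drop_coord k (\<Phi> z) = drop_coord k z"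
    "\<And>z. z \<in> V \<Longrightarrow> (\<Phi> has_derivative
        (graph_tangent k (\<lambda>j. slope k F j (\<Phi> z)))) (at z)"
proof -
  define \<Psi> where "\<Psi> x = x + (F x - x $ k) *\<^sub>R axis k (1::real)" for x
  define D where "D x u = u + ((\<Sum>i\<in>UNIV. u $ i * partial i F x) - u $ k) *\<^sub>R axis k (1::real)" for x u
  have linD: "linear (D x)" for x
    by (rule linearI) (simp_all add: D_def algebra_simps sum.distrib sum_distrib_left)
  define f' where "f' x = Blinfun (D x)" for x
  have f': "blinfun_apply (f' x) = D x" for x
    unfolding f'_def using linD by (simp add: bounded_linear_Blinfun_apply linear_conv_bounded_linear)
  have derF: "(F has_derivative (\<lambda>u. \<Sum>i\<in>UNIV. u $ i * partial i F x)) (at x)" if "x \<in> U" for x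
    by (rule smooth_on_has_derivative[OF U(3) that])
  have der: "(\<Psi> has_derivative blinfun_apply (f' x)) (at x)" if "x \<in> U" for x
    unfolding f' \<Psi>_def D_def
    by (intro has_derivative_add has_derivative_ident has_derivative_scaleR_left has_derivative_diff derF that
        bounded_linear_imp_has_derivative bounded_linear_vec_nth)
  have contf: "continuous_on U f'"
  proof (rule continuous_on_blinfun_componentwise)
    fix b :: "real^'n"
    show "continuous_on U (\<lambda>x. blinfun_apply (f' x) b)"
      unfolding f' D_def by (intro continuous_intros smooth_on_imp_continuous_on smooth_on_partial U)
  qed
  have "inj (D p)"
  proof (rule linear_injective_0[OF linD, THEN iffD2], intro allI impI)
    fix u assume u: "D p u = 0"
    have "u $ j = 0" if "j \<noteq> k" for j
      using arg_cong[OF u, of "\<lambda>v. v $ j"] that by (simp add: D_def axis_def)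
    moreover have "(\<Sum>i\<in>UNIV. u $ i * partial i F p) = 0"
      using arg_cong[OF u, of "\<lambda>v. v $ k"] by (simp add: D_def)
    moreover have "(\<Sum>i\<in>UNIV. u $ i * partial i F p) = (\<Sum>i\<in>UNIV. if i = k then u $ k * partial k F p else 0)"
      using calculation(1) by (intro sum.cong) auto
    ultimately have "u $ k = 0" using k[OF U(2)] by simp
    then show "u = 0" using \<open>\<And>j. j \<noteq> k \<Longrightarrow> u $ j = 0\<close> by (metis vec_eq_iff zero_index)
  qed
  then obtain g0 where g0: "linear g0" "g0 \<circ> D p = id"
    using linear_injective_left_inverse[OF linD] by blast
  have invf: "Blinfun g0 o\<^sub>L f' p = id_blinfun"
    using g0 by (intro blinfun_eqI) (simp add: f' bounded_linear_Blinfun_apply linear_conv_bounded_linear fun_eq_iff)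
  obtain U' V g g' where U': "open U'" "U' \<subseteq> U" "p \<in> U'" and V: "open V" "\<Psi> p \<in> V"
    and hom: "homeomorphism U' V \<Psi> g" and derg: "\<And>y. y \<in> V \<Longrightarrow> (g has_derivative (g' y)) (at y)"
    by (rule inverse_function_theorem[OF U(1) der contf U(2) invf]) blast+
  have \<Psi>p: "\<Psi> p = drop_coord k p" by (simp add: \<Psi>_def drop_coord_def Fp)
  have drop_\<Psi>: "drop_coord k (\<Psi> x) = drop_coord k x" and \<Psi>_k: "\<Psi> x $ k = F x" for x
    by (auto simp: vec_eq_iff drop_coord_nth \<Psi>_def axis_def)
  define W where "W = drop_coord k -` V"
  define \<Phi> where "\<Phi> z = g (drop_coord k z)" for z
  have "continuous_on UNIV (drop_coord k)"
    using linear_drop_coord by (intro linear_continuous_on) (simp add: linear_conv_bounded_linear)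
  then have W: "open W" unfolding W_def using V(1) by (simp add: open_vimage)
  have \<Phi>\<Psi>: "\<Psi> (\<Phi> z) = drop_coord k z" "\<Phi> z \<in> U" if "z \<in> W" for z
    using hom that U'(2) unfolding homeomorphism_def \<Phi>_def W_def by auto
  have F0: "F (\<Phi> z) = 0" if "z \<in> W" for z
    using \<Psi>_k[of "\<Phi> z"] \<Phi>\<Psi>(1)[OF that] by (simp add: drop_coord_nth)
  have drop\<Phi>: "drop_coord k (\<Phi> z) = drop_coord k z" if "z \<in> W" for z
    using drop_\<Psi>[of "\<Phi> z"] \<Phi>\<Psi>(1)[OF that] by (simp add: drop_coord_idem)
  have der\<Phi>: "(\<Phi> has_derivative
        (graph_tangent k (\<lambda>j. slope k F j (\<Phi> z)))) (at z)"
    if z: "z \<in> W" for z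
  proof -
    \<comment> \<open>E is not computed from an inverse matrix: differentiating
      \<open>drop_coord k (\<Phi> z) = drop_coord k z\<close> and \<open>F (\<Phi> z) = 0\<close>
      determines it.\<close>
    define E where "E = g' (drop_coord k z) \<circ> drop_coord k"
    have "((g \<circ> drop_coord k) has_derivative E) (at z)"
      unfolding E_def using z
      by (intro diff_chain_at has_derivative_drop_coord derg) (simp add: W_def)
    then have E: "(\<Phi> has_derivative E) (at z)" by (simp add: \<Phi>_def[abs_def] comp_def)
    have "((drop_coord k \<circ> \<Phi>) has_derivative (drop_coord k \<circ> E)) (at z)"
      by (intro diff_chain_at has_derivative_drop_coord E)
    moreover have "((drop_coord k \<circ> \<Phi>) has_derivative drop_coord k) (at z)"
      by (rule has_derivative_transform_within_open[OF has_derivative_drop_coord W z]) (simp add: drop\<Phi>)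
    ultimately have "drop_coord k \<circ> E = drop_coord k" by (rule has_derivative_unique)
    then have dE: "drop_coord k (E u) = drop_coord k u" for u by (simp add: fun_eq_iff)
    have "((F \<circ> \<Phi>) has_derivative ((\<lambda>u. \<Sum>i\<in>UNIV. u $ i * partial i F (\<Phi> z)) \<circ> E)) (at z)"
      using \<Phi>\<Psi>(2)[OF z] by (intro diff_chain_at E derF)
    moreover have "((F \<circ> \<Phi>) has_derivative (\<lambda>u. 0)) (at z)"
      by (rule has_derivative_transform_within_open[OF has_derivative_const[of 0] W z]) (simp add: F0)
    ultimately have "(\<lambda>u. \<Sum>i\<in>UNIV. u $ i * partial i F (\<Phi> z)) \<circ> E = (\<lambda>u. 0)"
      by (rule has_derivative_unique)
    then have FE: "(\<Sum>i\<in>UNIV. E u $ i * partial i F (\<Phi> z)) = 0" for u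
      by (simp add: fun_eq_iff)
    have "E u = graph_tangent k (\<lambda>j. slope k F j (\<Phi> z)) u" for u
    proof -
      have Eu: "E u = drop_coord k u + (E u $ k) *\<^sub>R axis k 1"
        using dE[of u] by (simp add: drop_coord_def[of k "E u"] algebra_simps)
      have "(\<Sum>j\<in>UNIV. drop_coord k u $ j * partial j F (\<Phi> z)) + E u $ k * partial k F (\<Phi> z) = 0"
        using FE[of u] by (subst (asm) Eu) (simp only: axis_coord_sum)
      then have "E u $ k = - (\<Sum>j\<in>UNIV. drop_coord k u $ j * partial j F (\<Phi> z)) * inverse (partial k F (\<Phi> z))"
        using k[OF \<Phi>\<Psi>(2)[OF z]] by (simp add: field_simps)
      also have "\<dots> = (\<Sum>j\<in>UNIV. drop_coord k u $ j * slope k F j (\<Phi> z))"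
        by (simp add: slope_def sum_negf sum_distrib_right mult.assoc)
      finally show ?thesis using Eu by simp
    qed
    then have "E = (graph_tangent k (\<lambda>j. slope k F j (\<Phi> z)))"
      by (rule ext)
    then show ?thesis using E by simp
  qed
  show thesis
  proof (rule that[of W \<Phi>])
    show "\<Phi> (drop_coord k p) = p"
    proof -
      have "\<Phi> (drop_coord k p) = g (\<Psi> p)" by (simp only: \<Phi>_def drop_coord_idem \<Psi>p)
      then show ?thesis using hom U'(3) unfolding homeomorphism_def by simp
    qed
    show "drop_coord k p \<in> W" using V(2) by (simp add: W_def drop_coord_idem \<Psi>p)
    show "\<Phi> (drop_coord k z) = \<Phi> z" for z by (simp add: \<Phi>_def drop_coord_idem)
    show "open W" by (rule W)
    fix z assume z: "z \<in> W"
    show "\<Phi> z \<in> U" by (rule \<Phi>\<Psi>(2)[OF z])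
    show "F (\<Phi> z) = 0" by (rule F0[OF z])
    show "drop_coord k (\<Phi> z) = drop_coord k z" by (rule drop\<Phi>[OF z])
    show "(\<Phi> has_derivative
        (graph_tangent k (\<lambda>j. slope k F j (\<Phi> z)))) (at z)"
      by (rule der\<Phi>[OF z])
  qed
qed

lemma smooth_on_comp_graph:
  fixes H :: "real^'n \<Rightarrow> real"
  assumes H: "smooth_on U H" "\<Phi> z \<in> U"
    and der: "(\<Phi> has_derivative
        (graph_tangent k (\<lambda>j. G j (\<Phi> z)))) (at z)"
  shows "((\<lambda>z. H (\<Phi> z)) has_derivative
      (\<lambda>u. \<Sum>j\<in>UNIV. drop_coord k u $ j * (partial j H (\<Phi> z) + G j (\<Phi> z) * partial k H (\<Phi> z)))) (at z)"
proof -
  have 1: "((H \<circ> \<Phi>) has_derivative ((\<lambda>u. \<Sum>i\<in>UNIV. u $ i * partial i H (\<Phi> z)) \<circ>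
      (graph_tangent k (\<lambda>j. G j (\<Phi> z))))) (at z)"
    by (rule diff_chain_at[OF der smooth_on_has_derivative[OF H]])
  have 2: "((\<lambda>u. \<Sum>i\<in>UNIV. u $ i * partial i H (\<Phi> z)) \<circ>
      (graph_tangent k (\<lambda>j. G j (\<Phi> z))))
     = (\<lambda>u. \<Sum>j\<in>UNIV. drop_coord k u $ j * (partial j H (\<Phi> z) + G j (\<Phi> z) * partial k H (\<Phi> z)))"
  proof (rule ext, unfold comp_apply)
    fix u :: "real^'n"
    show "(\<Sum>i\<in>UNIV. graph_tangent k (\<lambda>j. G j (\<Phi> z)) u $ i * partial i H (\<Phi> z))
       = (\<Sum>j\<in>UNIV. drop_coord k u $ j * (partial j H (\<Phi> z) + G j (\<Phi> z) * partial k H (\<Phi> z)))"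
      using axis_coord_sum[of "drop_coord k u" "\<Sum>j\<in>UNIV. drop_coord k u $ j * G j (\<Phi> z)" k "\<lambda>i. partial i H (\<Phi> z)"]
      by (simp add: distrib_left sum.distrib sum_distrib_right mult.assoc)
  qed
  from 1[unfolded 2] show ?thesis by (simp add: comp_def)
qed

text \<open>Differentiation along the lift of coordinate direction i to a vector field tangent to
  the level sets of F. By \<open>smooth_on_comp_graph\<close>, for i other than k, differentiating H
  o \<Phi> in direction i gives K o \<Phi> with K smooth on the ambient space. So iterated
  derivatives along the graph require only the first derivative of \<Phi>.\<close>

definition graph_partial :: "'n \<Rightarrow> (real^'n \<Rightarrow> real) \<Rightarrow> 'n \<Rightarrow> (real^'n \<Rightarrow> real) \<Rightarrow> real^'n \<Rightarrow> real" where
  "graph_partial k F i H x = partial i H x + slope k F i x * partial k H x"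

lemma smooth_on_graph_partial:
  assumes "open U" "smooth_on U F" "\<And>x. x \<in> U \<Longrightarrow> partial k F x \<noteq> 0" "smooth_on U H"
  shows "smooth_on U (graph_partial k F i H)"
  unfolding graph_partial_def[abs_def]
  by (intro smooth_on_add smooth_on_mult smooth_on_partial smooth_on_slope assms)

lemma sum_drop_coord_axis: "i \<noteq> k \<Longrightarrow> (\<Sum>j\<in>UNIV. drop_coord k (axis i 1) $ j * f j) = (f i :: real)"
proof -
  assume "i \<noteq> k"
  then have "(\<Sum>j\<in>UNIV. drop_coord k (axis i 1) $ j * f j) = (\<Sum>j\<in>UNIV. if j = i then f i else 0)"
    by (intro sum.cong) (auto simp: drop_coord_nth axis_def)
  then show ?thesis by simp
qed

text \<open>The coefficients are the Hessian of the graph function, a multiple of the second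
  fundamental form. A non-zero vector in its kernel would lift to a tangent vector along which all
  slopes are stationary, which \<open>gauss_curvature_nondegenerate\<close> excludes.\<close>

lemma slope_tangent_space_inj:
  fixes F :: "real^'n \<Rightarrow> real"
  assumes U: "open U" "p \<in> U" "smooth_on U F" and k: "\<And>x. x \<in> U \<Longrightarrow> partial k F x \<noteq> 0"
    and curv: "gauss_curvature F p \<noteq> 0"
  obtains c where "0 < c" "\<And>u. \<exists>i. i \<noteq> k \<and> c * norm (drop_coord k u) \<le>
      \<bar>\<Sum>j\<in>UNIV. drop_coord k u $ j * graph_partial k F j (slope k F i) p\<bar> \<or> drop_coord k u = 0"
proof -
  let ?d = "\<lambda>i u. \<Sum>j\<in>UNIV. drop_coord k u $ j * graph_partial k F j (slope k F i) p"
  \<comment> \<open>Keeping \<open>u $ k\<close> completes the Hessian to an endomorphism of the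
    whole space, for which injectivity gives a bound from below.\<close>
  define T where "T u = (\<chi> i. if i = k then u $ k else ?d i u)" for u
  have linT: "linear T"
    by (rule linearI)
       (auto simp: T_def vec_eq_iff linear_add[OF linear_drop_coord] linear_scale[OF linear_drop_coord]
          algebra_simps sum.distrib sum_distrib_left)
  have "inj T"
  proof (rule linear_injective_0[OF linT, THEN iffD2], intro allI impI)
    fix u assume T0: "T u = 0"
    have uk: "u $ k = 0" using arg_cong[OF T0, of "\<lambda>v. v $ k"] by (simp add: T_def)
    have d0: "?d i u = 0" if "i \<noteq> k" for i
      using arg_cong[OF T0, of "\<lambda>v. v $ i"] that by (simp add: T_def)
    define w where "w = graph_tangent k (\<lambda>j. slope k F j p) u"
    have w: "(\<Sum>j\<in>UNIV. w $ j * partial j H p) = (\<Sum>j\<in>UNIV. drop_coord k u $ j * graph_partial k F j H p)" for H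
      unfolding w_def axis_coord_sum
      by (simp add: graph_partial_def distrib_left sum.distrib sum_distrib_right mult.assoc)
    have "w = 0"
    proof (rule gauss_curvature_nondegenerate[OF U k curv])
      have "graph_partial k F j F p = 0" for j using k[OF U(2)] by (simp add: graph_partial_def slope_def)
      then show "(\<Sum>i\<in>UNIV. w $ i * partial i F p) = 0" by (simp add: w)
      show "(\<Sum>j\<in>UNIV. w $ j * partial j (slope k F i) p) = 0" for i
      proof (cases "i = k")
        case True
        \<comment> \<open>The kernel condition says nothing about index k, but the k-th slope is
          constantly -1 on U.\<close>
        have "frechet_derivative (slope k F k) (at p) = frechet_derivative (\<lambda>x. -1) (at p)"
          by (rule frechet_derivative_cong_open[OF U(1,2)]) (simp add: slope_def k)
        then have "partial j (slope k F k) p = 0" for j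
          by (simp add: partial_def frechet_derivative_const)
        then show ?thesis using True by simp
      qed (simp add: w d0)
    qed
    then have "drop_coord k w = 0" by (simp add: vec_eq_iff drop_coord_nth)
    moreover have "drop_coord k w = u" using uk by (auto simp: w_def vec_eq_iff drop_coord_nth axis_def)
    ultimately show "u = 0" by simp
  qed
  then obtain B where B: "0 < B" "\<And>u. B * norm u \<le> norm (T u)"
    using linear_inj_bounded_below_pos[OF linT] by metis
  \<comment> \<open>Some component of a vector is at least its norm divided by the
    dimension.\<close>
  define c where "c = B / real CARD('n)"
  have c: "0 < c" using B by (simp add: c_def)
  show thesis
  proof (rule that[OF c])
    fix u :: "real^'n"
    show "\<exists>i. i \<noteq> k \<and> c * norm (drop_coord k u) \<le> \<bar>?d i u\<bar> \<or> drop_coord k u = 0"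
    proof (cases "drop_coord k u = 0")
      case False
      let ?v = "drop_coord k u"
      have "\<exists>i. c * norm ?v \<le> \<bar>T ?v $ i\<bar>"
      proof (rule ccontr)
        assume "\<not> ?thesis"
        then have "(\<Sum>i\<in>UNIV. \<bar>T ?v $ i\<bar>) < (\<Sum>i\<in>(UNIV::'n set). c * norm ?v)"
          by (intro sum_strict_mono) (auto simp: not_le)
        then show False using norm_le_l1_cart[of "T ?v"] B(2)[of ?v] by (simp add: c_def)
      qed
      then obtain i where i: "c * norm ?v \<le> \<bar>T ?v $ i\<bar>" by blast
      have "i \<noteq> k"
      proof
        assume "i = k"
        then have "c * norm ?v \<le> 0" using i by (simp add: T_def drop_coord_nth)
        moreover have "0 < c * norm ?v" using c False by simp
        ultimately show False by linarith
      qed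
      then show ?thesis using i by (auto simp: T_def drop_coord_idem)
    qed auto
  qed
qed

text \<open>The quantitative assumptions of \<open>curved_graph\<close> all come from strict
  differentiability at \<open>z0\<close>, on one common ball, of the slopes and of their first and
  second derivatives along the graph.\<close>

lemma curved_hypersurface_graph:
  fixes S :: "(real^'n) set"
  assumes n3: "3 \<le> CARD('n)" and loc: "local_defining_function S U0 F p" and curv: "gauss_curvature F p \<noteq> 0"
    and \<Omega>: "openin (top_of_set S) \<Omega>" "p \<in> \<Omega>"
  obtains k :: 'n and W z0 \<rho> h h1 h2 h3 L c \<Phi> where "curved_graph k W z0 \<rho> h h1 h2 h3 L c"
    "continuous_on W \<Phi>" "\<And>z. z \<in> W \<Longrightarrow> \<Phi> z \<in> \<Omega>"
    "\<And>z. z \<in> W \<Longrightarrow> \<Phi> z = z + (h z - z $ k) *\<^sub>R axis k 1"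
proof -
  have F: "open U0" "p \<in> U0" "smooth_on U0 F" "grad F p \<noteq> 0" "S \<inter> U0 = {x\<in>U0. F x = 0}"
    using loc unfolding local_defining_function_def by auto
  obtain T where T: "open T" "\<Omega> = S \<inter> T" using \<Omega>(1) by (auto simp: openin_open)
  obtain k where kp: "partial k F p \<noteq> 0"
    using F(4) by (auto simp: vec_eq_iff grad_nth)
  \<comment> \<open>Intersecting with T keeps the graph inside \<Omega>; the preimage keeps the k-th
    partial derivative non-zero.\<close>
  define U where "U = (U0 \<inter> T) \<inter> partial k F -` (- {0})"
  have U: "open U"
    unfolding U_def
    by (intro continuous_open_preimage continuous_on_subset[OF smooth_on_imp_continuous_on[OF smooth_on_partial[OF F(3)]]])
       (use F T in auto)
  have pU: "p \<in> U" using F(2) T \<Omega>(2) kp by (auto simp: U_def)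
  have FU: "smooth_on U F" using F(3) by (rule smooth_on_subset) (auto simp: U_def)
  have k: "partial k F x \<noteq> 0" if "x \<in> U" for x using that by (simp add: U_def)
  have "p \<in> S \<inter> U0" using \<Omega>(2) T F(2) by auto
  then have Fp: "F p = 0" unfolding F(5) by simp
  define z0 where "z0 = drop_coord k p"
  obtain V \<Phi> where V: "open V" "z0 \<in> V" "\<Phi> z0 = p"
    and \<Phi>_drop: "\<And>z. \<Phi> (drop_coord k z) = \<Phi> z"
    and \<Phi>: "\<And>z. z \<in> V \<Longrightarrow> \<Phi> z \<in> U" "\<And>z. z \<in> V \<Longrightarrow> F (\<Phi> z) = 0"
      "\<And>z. z \<in> V \<Longrightarrow> drop_coord k (\<Phi> z) = drop_coord k z"
    and der\<Phi>: "\<And>z. z \<in> V \<Longrightarrow> (\<Phi> has_derivative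
        (graph_tangent k (\<lambda>j. slope k F j (\<Phi> z)))) (at z)"
  proof (rule implicit_graph[OF U pU FU k Fp])
    fix V \<Phi>
    assume "open V" "drop_coord k p \<in> V" "\<Phi> (drop_coord k p) = p" "\<And>z. \<Phi> (drop_coord k z) = \<Phi> z"
      "\<And>z. z \<in> V \<Longrightarrow> \<Phi> z \<in> U" "\<And>z. z \<in> V \<Longrightarrow> F (\<Phi> z) = 0"
      "\<And>z. z \<in> V \<Longrightarrow> drop_coord k (\<Phi> z) = drop_coord k z"
      "\<And>z. z \<in> V \<Longrightarrow> (\<Phi> has_derivative graph_tangent k (\<lambda>j. slope k F j (\<Phi> z))) (at z)"
    then show thesis using that[of V \<Phi>] unfolding z0_def by blast
  qed
  have cont\<Phi>: "continuous_on V \<Phi>"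
    using der\<Phi> has_derivative_continuous by (intro continuous_at_imp_continuous_on) blast
  let ?X = "graph_partial k F"
  have contH: "continuous_on V (\<lambda>z. H (\<Phi> z))" if "smooth_on U H" for H :: "real^'n \<Rightarrow> real"
    by (rule continuous_on_compose2[OF smooth_on_imp_continuous_on[OF that] cont\<Phi>]) (use \<Phi> in auto)
  have derH: "((\<lambda>z. H (\<Phi> z)) has_derivative (\<lambda>u. \<Sum>j\<in>UNIV. drop_coord k u $ j * ?X j H (\<Phi> z))) (at z)"
    if "smooth_on U H" "z \<in> V" for H z
    unfolding graph_partial_def by (rule smooth_on_comp_graph[where \<Phi> = \<Phi> and G = "slope k F" and U = U, OF that(1) \<Phi>(1)[OF that(2)] der\<Phi>[OF that(2)]])
  have dirH: "has_dir_deriv (axis i 1) (\<lambda>z. H (\<Phi> z)) (\<lambda>z. ?X i H (\<Phi> z)) z"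
    if "smooth_on U H" "z \<in> V" "i \<noteq> k" for H z i
    by (rule has_dir_derivI[OF derH[OF that(1,2)]]) (simp add: sum_drop_coord_axis that(3))
  have smX: "smooth_on U (?X i H)" if "smooth_on U H" for i H
    by (rule smooth_on_graph_partial[OF U FU k that])
  have smG: "smooth_on U (slope k F i)" for i by (rule smooth_on_slope[OF U FU k])
  define N where "N H e r \<longleftrightarrow> (\<forall>x u. x \<in> ball z0 r \<longrightarrow> x + u \<in> ball z0 r \<longrightarrow>
      \<bar>H (\<Phi> (x + u)) - H (\<Phi> x) - (\<Sum>j\<in>UNIV. drop_coord k u $ j * ?X j H p)\<bar> \<le> e * norm (drop_coord k u))"
    for H e r
  have strict: "\<forall>\<^sub>F r in at_right 0. N H e r" if H: "smooth_on U H" and "0 < e" for H e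
  proof -
    define d where "d j z = (if j = k then 0 else ?X j H (\<Phi> z))" for j z
    have eq: "(\<Sum>j\<in>UNIV. drop_coord k u $ j * ?X j H (\<Phi> z)) = (\<Sum>j\<in>UNIV. u $ j * d j z)" for u z
      by (intro sum.cong) (auto simp: d_def drop_coord_nth)
    have "\<forall>\<^sub>F r in at_right 0. ball z0 r \<subseteq> V \<and>
     (\<forall>x\<in>ball z0 r. \<forall>y\<in>ball z0 r. \<bar>H (\<Phi> x) - H (\<Phi> y) - (\<Sum>i\<in>UNIV. (x - y) $ i * d i z0)\<bar> \<le> e * norm (x - y))"
    proof (rule strictly_differentiable[OF V(1,2) _ _ \<open>0 < e\<close>])
      show "((\<lambda>z. H (\<Phi> z)) has_derivative (\<lambda>u. \<Sum>j\<in>UNIV. u $ j * d j z)) (at z)" if "z \<in> V" for z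
        using derH[OF H that] by (simp only: eq)
      show "continuous_on V (d j)" for j
        using contH[OF smX[OF H, of j]] by (cases "j = k") (auto simp: d_def[abs_def])
    qed
    then show ?thesis
    proof eventually_elim
      case (elim r)
      show ?case
        unfolding N_def
      proof (intro allI impI)
        fix x u assume x: "x \<in> ball z0 r" "x + u \<in> ball z0 r"
        \<comment> \<open>Since \<Phi> ignores the k-th coordinate, the estimate is applied to the
          projections of x and x + u, which makes the error proportional to
          \<open>norm (drop_coord k u)\<close>. The projections stay in the ball because its centre
          has k-th coordinate 0.\<close>
        have db: "drop_coord k y \<in> ball z0 r" if "y \<in> ball z0 r" for y
        proof -
          have "drop_coord k y - z0 = drop_coord k (y - z0)"
            by (simp add: linear_diff[OF linear_drop_coord] z0_def drop_coord_idem)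
          then have "norm (drop_coord k y - z0) \<le> norm (y - z0)" by (simp add: norm_drop_coord_le)
          then show ?thesis using that by (simp add: dist_norm norm_minus_commute)
        qed
        have "drop_coord k (x + u) - drop_coord k x = drop_coord k u"
          by (simp add: linear_add[OF linear_drop_coord])
        then have "\<bar>H (\<Phi> (x + u)) - H (\<Phi> x) - (\<Sum>i\<in>UNIV. drop_coord k u $ i * d i z0)\<bar> \<le> e * norm (drop_coord k u)"
          using elim db[OF x(1)] db[OF x(2)] by (metis \<Phi>_drop)
        then show "\<bar>H (\<Phi> (x + u)) - H (\<Phi> x) - (\<Sum>j\<in>UNIV. drop_coord k u $ j * ?X j H p)\<bar> \<le> e * norm (drop_coord k u)"
          unfolding eq[symmetric] by (simp add: drop_coord_idem eq[symmetric] V(3)[symmetric] flip: eq)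
      qed
    qed
  qed
  obtain c where c: "0 < c" and low: "\<And>u. \<exists>i. i \<noteq> k \<and> c * norm (drop_coord k u) \<le>
      \<bar>\<Sum>j\<in>UNIV. drop_coord k u $ j * ?X j (slope k F i) p\<bar> \<or> drop_coord k u = 0"
    by (rule slope_tangent_space_inj[OF U pU FU k curv], assumption) (rule that)
  \<comment> \<open>A Lipschitz constant: the coefficients at p, plus 1 for the error term.\<close>
  define M where "M H = 1 + (\<Sum>j\<in>UNIV. \<bar>?X j H p\<bar>)" for H
  have M: "\<bar>a\<bar> \<le> M H * norm (drop_coord k u)"
    if "\<bar>a - (\<Sum>j\<in>UNIV. drop_coord k u $ j * ?X j H p)\<bar> \<le> 1 * norm (drop_coord k u)" for a H u
  proof -
    have "\<bar>\<Sum>j\<in>UNIV. drop_coord k u $ j * ?X j H p\<bar> \<le> (\<Sum>j\<in>UNIV. norm (drop_coord k u) * \<bar>?X j H p\<bar>)"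
      using component_le_norm_cart[of "drop_coord k u"]
      by (intro order_trans[OF sum_abs] sum_mono) (auto simp: abs_mult intro: mult_right_mono)
    also have "\<dots> = norm (drop_coord k u) * (\<Sum>j\<in>UNIV. \<bar>?X j H p\<bar>)" by (simp add: sum_distrib_left)
    finally show ?thesis using that by (simp add: M_def algebra_simps)
  qed
  let ?G = "slope k F"
  define h1 where "h1 i z = ?G i (\<Phi> z)" for i z
  define h2 where "h2 i z = ?X i (?G i) (\<Phi> z)" for i z
  define h3 where "h3 i z = ?X i (?X i (?G i)) (\<Phi> z)" for i z
  define h where "h z = \<Phi> z $ k" for z
  \<comment> \<open>Error c/2 preserves half of the lower bound c for increments of the slopes; the
    cap 1 makes the same estimate yield their Lipschitz bound.\<close>
  have ev1: "\<forall>\<^sub>F r in at_right 0. \<forall>i\<in>UNIV. N (?G i) (min 1 (c/2)) r"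
    using c by (intro eventually_ball_finite ballI strict smG) auto
  have ev2: "\<forall>\<^sub>F r in at_right 0. \<forall>i\<in>UNIV. N (?X i (?G i)) 1 r"
    by (intro eventually_ball_finite ballI strict smX smG) auto
  have ev3: "\<forall>\<^sub>F r in at_right 0. \<forall>i\<in>UNIV. N (?X i (?X i (?G i))) 1 r"
    by (intro eventually_ball_finite ballI strict smX smG) auto
  obtain r0 where r0: "0 < r0" "ball z0 r0 \<subseteq> V" using V(1,2) open_contains_ball by blast
  \<comment> \<open>On a ball of radius below 1, Lipschitz bounds and the values at
    \<open>z0\<close> bound \<open>h1\<close> and \<open>h2\<close> themselves.\<close>
  have ev4: "\<forall>\<^sub>F r::real in at_right 0. r < min 1 r0"
    unfolding eventually_at_right_field using r0 by (intro exI[of _ "min 1 r0"]) auto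
  have "\<forall>\<^sub>F r::real in at_right 0. 0 < r" by (simp add: eventually_at_right_less)
  with ev1 ev2 ev3 ev4 have "\<forall>\<^sub>F r in at_right 0. 0 < r \<and> r < min 1 r0 \<and> (\<forall>i\<in>UNIV. N (?G i) (min 1 (c/2)) r) \<and>
    (\<forall>i\<in>UNIV. N (?X i (?G i)) 1 r) \<and> (\<forall>i\<in>UNIV. N (?X i (?X i (?G i))) 1 r)"
    by (intro eventually_conj) auto
  then obtain r where r: "0 < r" "r < min 1 r0" and N: "\<And>i. N (?G i) (min 1 (c/2)) r"
    "\<And>i. N (?X i (?G i)) 1 r" "\<And>i. N (?X i (?X i (?G i))) 1 r"
    using eventually_happens'[OF trivial_limit_at_right_real] by blast
  define W where "W = ball z0 r"
  have WV: "W \<subseteq> V" using r r0 by (auto simp: W_def)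
  have s: "\<bar>H (\<Phi> (x + u)) - H (\<Phi> x) - (\<Sum>j\<in>UNIV. drop_coord k u $ j * ?X j H p)\<bar> \<le> e * norm (drop_coord k u)"
    if "N H e r" "x \<in> W" "x + u \<in> W" for H e x u
    using that unfolding N_def W_def by blast
  have l1: "\<bar>h1 i (x + u) - h1 i x\<bar> \<le> M (?G i) * norm (drop_coord k u)" if "x \<in> W" "x + u \<in> W" for i x u
    unfolding h1_def
  proof (rule M, rule order_trans[OF s[OF N(1) that]])
    show "min 1 (c/2) * norm (drop_coord k u) \<le> 1 * norm (drop_coord k u)" by (intro mult_right_mono) auto
  qed
  have l2: "\<bar>h2 i (x + u) - h2 i x\<bar> \<le> M (?X i (?G i)) * norm (drop_coord k u)" if "x \<in> W" "x + u \<in> W" for i x u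
    unfolding h2_def by (rule M[OF s[OF N(2) that]])
  have l3: "\<bar>h3 i (x + u) - h3 i x\<bar> \<le> M (?X i (?X i (?G i))) * norm (drop_coord k u)" if "x \<in> W" "x + u \<in> W" for i x u
    unfolding h3_def by (rule M[OF s[OF N(3) that]])
  have M0: "0 \<le> M H" for H by (simp add: M_def sum_nonneg)
  define L where "L = 1 + (\<Sum>i\<in>UNIV. \<bar>h1 i z0\<bar> + \<bar>h2 i z0\<bar> + M (?G i) + M (?X i (?G i)) + M (?X i (?X i (?G i))))"
  have L_le: "\<bar>h1 i z0\<bar> + \<bar>h2 i z0\<bar> + M (?G i) + M (?X i (?G i)) + M (?X i (?X i (?G i))) \<le> L" for i
    unfolding L_def
    using member_le_sum[of i UNIV "\<lambda>i. \<bar>h1 i z0\<bar> + \<bar>h2 i z0\<bar> + M (?G i) + M (?X i (?G i)) + M (?X i (?X i (?G i)))"] M0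
    by simp
  have Mle: "M (?G i) \<le> L" "M (?X i (?G i)) \<le> L" "M (?X i (?X i (?G i))) \<le> L"
    "\<bar>h1 i z0\<bar> + M (?G i) \<le> L" "\<bar>h2 i z0\<bar> + M (?X i (?G i)) \<le> L" for i
    using L_le[of i] M0[of "?G i"] M0[of "?X i (?G i)"] M0[of "?X i (?X i (?G i))"] by linarith+
  have Lpos: "0 < L" by (simp add: L_def sum_nonneg M0 add_pos_nonneg)
  have z0W: "z0 \<in> W" using r by (simp add: W_def)
  have near: "norm (drop_coord k (z - z0)) \<le> 1" if "z \<in> W" for z
    using that r norm_drop_coord_le[of k "z - z0"] by (simp add: W_def dist_norm norm_minus_commute)
  have bnd: "\<bar>f z\<bar> \<le> L" if "\<And>x u. x \<in> W \<Longrightarrow> x + u \<in> W \<Longrightarrow> \<bar>f (x + u) - f x\<bar> \<le> N * norm (drop_coord k u)"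
      "\<bar>f z0\<bar> + N \<le> L" "0 \<le> N" "z \<in> W" for f :: "real^'n \<Rightarrow> real" and N z
  proof -
    have "\<bar>f z - f z0\<bar> \<le> N * norm (drop_coord k (z - z0))" using that(1)[of z0 "z - z0"] that(4) z0W by simp
    also have "\<dots> \<le> N * 1" using near[OF that(4)] that(3) by (intro mult_left_mono)
    finally show ?thesis using that(2) by linarith
  qed
  have lipL: "N * norm (drop_coord k u) \<le> L * norm (drop_coord k u)" if "N \<le> L" for N u
    using that by (intro mult_right_mono) auto
  have der\<Phi>k: "has_dir_deriv (axis i 1) h (h1 i) z" if "i \<noteq> k" "z \<in> V" for i z
  proof (rule has_dir_derivI)
    show "(h has_derivative (\<lambda>u. graph_tangent k (\<lambda>j. slope k F j (\<Phi> z)) u $ k)) (at z)"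
      unfolding h_def using der\<Phi>[OF that(2)] by (rule bounded_linear.has_derivative[OF bounded_linear_vec_nth])
    show "graph_tangent k (\<lambda>j. slope k F j (\<Phi> z)) (axis i 1) $ k = h1 i z"
      unfolding sum_drop_coord_axis[OF that(1)] using that(1) by (simp add: h1_def drop_coord_nth)
  qed
  have "curved_graph k W z0 (r/2) h h1 h2 h3 L (c/2)"
  proof
    show "3 \<le> CARD('n)" by (rule n3)
    show "open W" "0 < r/2" "cball z0 (r/2) \<subseteq> W" "0 < c/2" "0 < L" using r c Lpos by (auto simp: W_def)
    show "continuous_on W h"
      unfolding h_def by (intro continuous_intros continuous_on_subset[OF cont\<Phi> WV])
    fix i assume ik: "i \<noteq> k"
    show "continuous_on W (h1 i)" "continuous_on W (h2 i)" "continuous_on W (h3 i)"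
      unfolding h1_def h2_def h3_def by (intro continuous_on_subset[OF contH WV] smX smG)+
    fix z assume z: "z \<in> W"
    then have zV: "z \<in> V" using WV by auto
    show "has_dir_deriv (axis i 1) h (h1 i) z" by (rule der\<Phi>k[OF ik zV])
    show "has_dir_deriv (axis i 1) (h1 i) (h2 i) z" "has_dir_deriv (axis i 1) (h2 i) (h3 i) z"
      unfolding h1_def h2_def h3_def by (intro dirH smX smG zV ik)+
    show "\<bar>h1 i z\<bar> \<le> L" by (rule bnd[OF l1 Mle(4) M0 z])
    show "\<bar>h2 i z\<bar> \<le> L" by (rule bnd[OF l2 Mle(5) M0 z])
    fix u assume u: "z + u \<in> W"
    show "\<bar>h2 i (z + u) - h2 i z\<bar> \<le> L * norm (drop_coord k u)"
      by (rule order_trans[OF l2[OF z u] lipL[OF Mle(2)]])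
    show "\<bar>h3 i (z + u) - h3 i z\<bar> \<le> L * norm (drop_coord k u)"
      by (rule order_trans[OF l3[OF z u] lipL[OF Mle(3)]])
  next
    fix u :: "real^'n"
    show "\<exists>i. i \<noteq> k \<and> (\<forall>z. z \<in> W \<longrightarrow> z + u \<in> W \<longrightarrow> c/2 * norm (drop_coord k u) \<le> \<bar>h1 i (z + u) - h1 i z\<bar>)"
    proof (cases "drop_coord k u = 0")
      case True
      have "\<exists>i. i \<noteq> k"
      proof (rule ccontr)
        assume "\<nexists>i. i \<noteq> k"
        then have "UNIV = {k}" by auto
        then have "CARD('n) = 1" by (metis card_1_singleton_iff One_nat_def)
        then show False using n3 by simp
      qed
      then obtain i where "i \<noteq> k" by blast
      then show ?thesis using True by auto
    next
      case False
      then obtain i where i: "i \<noteq> k" "c * norm (drop_coord k u) \<le> \<bar>\<Sum>j\<in>UNIV. drop_coord k u $ j * ?X j (?G i) p\<bar>"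
        using low[of u] by auto
      have "c/2 * norm (drop_coord k u) \<le> \<bar>h1 i (z + u) - h1 i z\<bar>" if "z \<in> W" "z + u \<in> W" for z
      proof -
        have "min 1 (c/2) * norm (drop_coord k u) \<le> c/2 * norm (drop_coord k u)" by (intro mult_right_mono) auto
        then have "\<bar>h1 i (z + u) - h1 i z - (\<Sum>j\<in>UNIV. drop_coord k u $ j * ?X j (?G i) p)\<bar> \<le> c/2 * norm (drop_coord k u)"
          using s[OF N(1) that, of i] by (simp add: h1_def)
        then show ?thesis using i(2) by linarith
      qed
      then show ?thesis using i(1) by blast
    qed
  qed
  then show thesis
  proof (rule that)
    show "continuous_on W \<Phi>" by (rule continuous_on_subset[OF cont\<Phi> WV])
    fix z assume "z \<in> W"
    then have z: "z \<in> V" using WV by auto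
    have "\<Phi> z \<in> {x\<in>U0. F x = 0}" using \<Phi>[OF z] by (auto simp: U_def)
    then show "\<Phi> z \<in> \<Omega>" unfolding F(5)[symmetric] T(2) using \<Phi>(1)[OF z] by (auto simp: U_def)
    show "\<Phi> z = z + (h z - z $ k) *\<^sub>R axis k 1"
      using \<Phi>(3)[OF z] by (auto simp: vec_eq_iff drop_coord_nth h_def axis_def split: if_splits)
  qed
qed

section \<open>Densities on the hypersurface\<close>

text \<open>The projection does not increase distances, so a covering set of diameter \<delta>
  accounts only for points z in a box with d - 1 sides 2 \<delta> and one side 2 \<rho>. Its volume
  is a multiple of \<delta>^(d-1), the power in the Hausdorff sum, and the constant is the ratio of
  the two factors.\<close>

lemma graph_lborel_le_hausdorff:
  fixes \<Phi> :: "real^'n \<Rightarrow> real^'n"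
  assumes n2: "2 \<le> CARD('n)" and "0 < \<rho>"
  obtains c where "0 < c"
    "\<And>E X. E \<subseteq> cball z0 \<rho> \<Longrightarrow> E \<in> sets borel \<Longrightarrow> \<Phi> ` E \<subseteq> X \<Longrightarrow>
      (\<And>z. z \<in> E \<Longrightarrow> drop_coord k (\<Phi> z) = drop_coord k z) \<Longrightarrow>
      ennreal c * emeasure lborel E \<le> hausdorff_outer (real CARD('n) - 1) X"
proof -
  define n where "n = CARD('n) - 1"
  have n: "1 \<le> n" "real CARD('n) - 1 = real n" using n2 by (auto simp: n_def)
  let ?s = "real CARD('n) - 1"
  define hc where "hc = hausdorff_const ?s"
  have hc: "0 < hc" using n by (simp add: hc_def hausdorff_const_def)
  define b where "b = 2 ^ n * (2 * \<rho>)"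
  have b: "0 < b" using \<open>0 < \<rho>\<close> by (simp add: b_def)
  show thesis
  proof (rule that[of "hc / b"])
    show "0 < hc / b" using hc b by simp
    fix E X :: "(real^'n) set"
    assume E: "E \<subseteq> cball z0 \<rho>" "E \<in> sets borel" and EX: "\<Phi> ` E \<subseteq> X"
      and drop: "\<And>z. z \<in> E \<Longrightarrow> drop_coord k (\<Phi> z) = drop_coord k z"
    have "ennreal (hc / b) * emeasure lborel E \<le> hausdorff_pre ?s 1 X"
    proof (rule hausdorff_pre_geI)
      fix C :: "nat \<Rightarrow> (real^'n) set"
      assume C: "X \<subseteq> (\<Union>i. C i)" "\<And>i. bounded (C i)" "\<And>i. diameter (C i) \<le> 1"
      \<comment> \<open>For empty \<open>C i\<close> the choice is arbitrary; its box then has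
        volume 0 and adds nothing to the sum.\<close>
      define x where "x i = (SOME x. x \<in> C i)" for i
      define \<delta> where "\<delta> i = diameter (C i)" for i
      have \<delta>: "0 \<le> \<delta> i" for i using C(2) by (simp add: \<delta>_def diameter_ge_0)
      define lo where "lo i = (\<chi> j. if j = k then z0 $ k - \<rho> else x i $ j - \<delta> i)" for i
      define hi where "hi i = (\<chi> j. if j = k then z0 $ k + \<rho> else x i $ j + \<delta> i)" for i
      have cover: "E \<subseteq> (\<Union>i. cbox (lo i) (hi i))"
      proof
        fix z assume z: "z \<in> E"
        then obtain i where i: "\<Phi> z \<in> C i" using EX C(1) by blast
        then have "x i \<in> C i" unfolding x_def by (rule someI)
        then have d: "dist (\<Phi> z) (x i) \<le> \<delta> i" unfolding \<delta>_def using C(2) i by (intro diameter_bounded_bound)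
        have "\<bar>z $ j - x i $ j\<bar> \<le> \<delta> i" if "j \<noteq> k" for j
        proof -
          have "\<Phi> z $ j = z $ j" using arg_cong[OF drop[OF z], of "\<lambda>v. v $ j"] that by (simp add: drop_coord_nth)
          then show ?thesis using component_le_norm_cart[of "\<Phi> z - x i" j] d by (simp add: dist_norm)
        qed
        moreover have "\<bar>z $ k - z0 $ k\<bar> \<le> \<rho>"
          using component_le_norm_cart[of "z - z0" k] E(1) z by (auto simp: dist_norm norm_minus_commute)
        ultimately have "z \<in> cbox (lo i) (hi i)"
          by (auto simp: mem_box_cart lo_def hi_def abs_le_iff algebra_simps)
        then show "z \<in> (\<Union>i. cbox (lo i) (hi i))" by blast
      qed
      have box: "emeasure lborel (cbox (lo i) (hi i)) = ennreal (b / hc) * ennreal (hc * \<delta> i powr ?s)" for i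
      proof -
        have ne: "cbox (lo i) (hi i) \<noteq> {}"
          using \<delta>[of i] \<open>0 < \<rho>\<close> by (auto simp: interval_ne_empty_cart lo_def hi_def)
        have "measure lborel (cbox (lo i) (hi i)) = (\<Prod>j\<in>UNIV. if j = k then 2 * \<rho> else 2 * \<delta> i)"
          using ne by (subst content_cbox_cart) (simp, intro prod.cong, auto simp: lo_def hi_def)
        also have "\<dots> = (2 * \<rho>) * (\<Prod>j\<in>UNIV - {k}. 2 * \<delta> i)"
          by (subst prod.remove[of _ k]) (auto intro!: prod.cong)
        also have "\<dots> = (2 * \<rho>) * (2 * \<delta> i) ^ n" by (simp add: n_def card_Diff_singleton)
        also have "\<dots> = b * \<delta> i ^ n" by (simp add: b_def power_mult_distrib)
        \<comment> \<open>For \<open>\<delta> i = 0\<close> both sides vanish because n >= 1; with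
          exponent 0 the power would be 1 but \<open>powr\<close> still 0.\<close>
        also have "\<delta> i ^ n = \<delta> i powr ?s"
          using \<delta>[of i] n by (cases "\<delta> i = 0") (auto simp: powr_realpow)
        finally have "measure lborel (cbox (lo i) (hi i)) = (b / hc) * (hc * \<delta> i powr ?s)" using hc by simp
        moreover have "emeasure lborel (cbox (lo i) (hi i)) = ennreal (measure lborel (cbox (lo i) (hi i)))"
          using fmeasurable_cbox[of "lo i" "hi i"] by (intro emeasure_eq_measure2) auto
        ultimately show ?thesis using b hc by (simp add: ennreal_mult[symmetric])
      qed
      have "emeasure lborel E \<le> emeasure lborel (\<Union>i. cbox (lo i) (hi i))"
        using cover by (intro emeasure_mono) auto
      also have "\<dots> \<le> (\<Sum>i. emeasure lborel (cbox (lo i) (hi i)))"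
        by (rule emeasure_subadditive_countably) auto
      also have "\<dots> = ennreal (b / hc) * (\<Sum>i. ennreal (hc * \<delta> i powr ?s))"
        unfolding box by (rule ennreal_suminf_cmult)
      finally have "ennreal (hc / b) * emeasure lborel E \<le>
          ennreal (hc / b) * (ennreal (b / hc) * (\<Sum>i. ennreal (hc * \<delta> i powr ?s)))"
        by (intro mult_left_mono) auto
      also have "\<dots> = (\<Sum>i. ennreal (hc * \<delta> i powr ?s))"
        using b hc by (simp add: mult.assoc[symmetric] ennreal_mult[symmetric])
      finally show "ennreal (hc / b) * emeasure lborel E \<le> (\<Sum>i. ennreal (hausdorff_const ?s * diameter (C i) powr ?s))"
        by (simp add: hc_def \<delta>_def)
    qed
    also have "\<dots> \<le> hausdorff_outer ?s X" by (rule hausdorff_pre_le_outer) simp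
    finally show "ennreal (hc / b) * emeasure lborel E \<le> hausdorff_outer ?s X" .
  qed
qed

text \<open>The Radon-Nikodym derivative f exceeds C only on a null set: comparing N with C M on
  that set makes the integral of f - C over it vanish. Truncating f then gives a version that is
  bounded at every point.\<close>

lemma bounded_density_exists:
  assumes "finite_measure M" and sets: "sets N = sets M" and "0 \<le> C"
    and le: "\<And>E. E \<in> sets M \<Longrightarrow> emeasure N E \<le> ennreal C * emeasure M E"
  obtains g :: "'a \<Rightarrow> real" where "g \<in> borel_measurable M" "\<And>x. 0 \<le> g x" "\<And>x. g x \<le> C"
    "N = density M (\<lambda>x. ennreal (g x))"
proof -
  interpret finite_measure M by fact
  have "absolutely_continuous M N"
    unfolding absolutely_continuous_def
  proof
    fix E assume "E \<in> null_sets M"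
    then show "E \<in> null_sets N" using le[of E] sets by (auto simp: null_sets_def)
  qed
  then obtain f where f: "f \<in> borel_measurable M" "density M f = N"
    using Radon_Nikodym sets by blast
  define g where "g x = enn2real (min (f x) (ennreal C))" for x
  have gm: "g \<in> borel_measurable M" unfolding g_def using f(1) by measurable
  let ?B = "{x\<in>space M. ennreal C < f x}"
  have B: "?B \<in> sets M" using f(1) by measurable
  have "(\<integral>\<^sup>+x. (f x - ennreal C) * indicator ?B x \<partial>M) = 0"
  proof -
    have "(\<integral>\<^sup>+x. f x * indicator ?B x \<partial>M) = (\<integral>\<^sup>+x. (f x - ennreal C) * indicator ?B x + ennreal C * indicator ?B x \<partial>M)"
      by (intro nn_integral_cong) (auto split: split_indicator simp: diff_add_cancel_ennreal)
    also have "\<dots> = (\<integral>\<^sup>+x. (f x - ennreal C) * indicator ?B x \<partial>M) + (\<integral>\<^sup>+x. ennreal C * indicator ?B x \<partial>M)"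
      using f(1) B by (intro nn_integral_add) auto
    also have "(\<integral>\<^sup>+x. ennreal C * indicator ?B x \<partial>M) = ennreal C * emeasure M ?B"
      using B by (rule nn_integral_cmult_indicator)
    finally have "(\<integral>\<^sup>+x. (f x - ennreal C) * indicator ?B x \<partial>M) + ennreal C * emeasure M ?B = emeasure N ?B"
      using emeasure_density[OF f(1) B] f(2) by simp
    also have "\<dots> \<le> 0 + ennreal C * emeasure M ?B" using le[OF B] by simp
    finally show ?thesis
      using emeasure_finite[of ?B] by (simp add: ennreal_mult_eq_top_iff ennreal_add_left_cancel_le add.commute[of _ "ennreal C * _"])
  qed
  then have "AE x in M. (f x - ennreal C) * indicator ?B x = 0"
    using f(1) B by (subst (asm) nn_integral_0_iff_AE) auto
  with AE_space have "AE x in M. f x = ennreal (g x)"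
  proof eventually_elim
    case (elim x)
    have "f x \<le> ennreal C"
    proof (rule ccontr)
      assume "\<not> f x \<le> ennreal C"
      then have "x \<in> ?B" "f x - ennreal C \<noteq> 0" using elim(1) by (auto simp: not_le diff_eq_0_iff_ennreal)
      then show False using elim by simp
    qed
    then have "min (f x) (ennreal C) = f x" "f x < \<infinity>"
      by (auto simp: min_def intro: le_less_trans)
    then show ?case by (simp add: g_def)
  qed
  then have "density M f = density M (\<lambda>x. ennreal (g x))"
    using f(1) gm by (intro density_cong) auto
  show thesis
  proof (rule that[of g])
    show "g x \<le> C" for x using \<open>0 \<le> C\<close> unfolding g_def
      by (metis enn2real_ennreal enn2real_mono ennreal_less_top min.cobounded2)
  qed (use gm f(2) \<open>density M f = density M (\<lambda>x. ennreal (g x))\<close> in \<open>auto simp: g_def\<close>)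
qed

text \<open>The density g represents the push-forward of bump times Lebesgue measure, so its
  integrals against exponentials are those of \<open>fourier_decay\<close>. Domination of the
  push-forward by a multiple of \<mu> makes g bounded, hence square integrable as \<mu> is
  finite.\<close>

lemma (in curved_graph) decaying_density:
  fixes \<mu> :: "(real^'n) measure"
  assumes "finite_measure \<mu>" and sets: "sets \<mu> = sets borel"
    and \<Phi>: "continuous_on W \<Phi>" "\<And>z. z \<in> W \<Longrightarrow> \<Phi> z \<in> \<Omega>"
      "\<And>z. z \<in> W \<Longrightarrow> \<Phi> z = z + (h z - z $ k) *\<^sub>R axis k 1"
    and le: "\<And>E. E \<in> sets borel \<Longrightarrow> hausdorff_outer (real CARD('n) - 1) (E \<inter> \<Omega>) \<le> emeasure \<mu> E"
  obtains g D where "(\<lambda>x. complex_of_real (g x)) \<in> L2 \<mu>" "0 < (LINT x|\<mu>. (g x)\<^sup>2)"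
    "\<And>\<xi>. 1 \<le> norm \<xi> \<Longrightarrow> (cmod (LINT x|\<mu>. of_real (g x) * exp_fun \<xi> x))\<^sup>2 \<le> D * norm \<xi> powr (- (4/3))"
proof -
  interpret mu: finite_measure \<mu> by fact
  have mE: "borel_measurable \<mu> = borel_measurable borel" by (rule measurable_cong_sets[OF sets refl])
  let ?a = "bump z0 \<rho>"
  \<comment> \<open>Outside W the bump vanishes and the value is irrelevant; a constant makes the
    map Borel on the whole space.\<close>
  define \<Phi>' where "\<Phi>' z = (if z \<in> W then \<Phi> z else z0)" for z
  have \<Phi>'_m: "\<Phi>' \<in> borel_measurable borel"
    unfolding \<Phi>'_def using openW \<Phi>(1) by (intro borel_measurable_continuous_on_if) auto
  have am: "?a \<in> borel_measurable borel"
    by (rule borel_measurable_continuous_onI[OF continuous_bump])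
  obtain M where M: "0 < M" "\<And>z. \<bar>?a z\<bar> \<le> M"
    using bump_bounded[of "{}" \<rho> z0] \<rho>(1) by auto
  define m where "m = distr (density lborel (\<lambda>z. ennreal (?a z))) borel \<Phi>'"
  have n2: "2 \<le> CARD('n)" using card3 by simp
  obtain c where c: "0 < c"
    "\<And>E X. E \<subseteq> cball z0 \<rho> \<Longrightarrow> E \<in> sets borel \<Longrightarrow> \<Phi> ` E \<subseteq> X \<Longrightarrow>
      (\<And>z. z \<in> E \<Longrightarrow> drop_coord k (\<Phi> z) = drop_coord k z) \<Longrightarrow>
      ennreal c * emeasure lborel E \<le> hausdorff_outer (real CARD('n) - 1) X"
    using graph_lborel_le_hausdorff[OF n2 \<rho>(1), where \<Phi> = \<Phi>] by blast
  have drop: "drop_coord k (\<Phi> z) = drop_coord k z" if "z \<in> W" for z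
    using \<Phi>(3)[OF that] by (simp add: vec_eq_iff drop_coord_nth axis_def)
  have m_le: "emeasure m E \<le> ennreal (M / c) * emeasure \<mu> E" if "E \<in> sets \<mu>" for E
  proof -
    have E: "E \<in> sets borel" using that sets by simp
    let ?P = "\<Phi>' -` E \<inter> cball z0 \<rho>"
    have pre: "\<Phi>' -` E \<in> sets borel" using measurable_sets[OF \<Phi>'_m E] by simp
    have "emeasure m E = emeasure (density lborel (\<lambda>z. ennreal (?a z))) (\<Phi>' -` E)"
      unfolding m_def using \<Phi>'_m E by (simp add: emeasure_distr)
    also have "\<dots> = (\<integral>\<^sup>+z. ennreal (?a z) * indicator (\<Phi>' -` E) z \<partial>lborel)"
      using am pre by (intro emeasure_density) auto
    also have "\<dots> \<le> (\<integral>\<^sup>+z. ennreal M * indicator ?P z \<partial>lborel)"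
    proof (rule nn_integral_mono)
      fix z
      show "ennreal (?a z) * indicator (\<Phi>' -` E) z \<le> ennreal M * indicator ?P z"
        using M(2)[of z] bump_eq_0(1)[OF \<rho>(1), of z z0]
        by (cases "z \<in> cball z0 \<rho>") (auto split: split_indicator intro!: ennreal_leI simp del: mem_cball)
    qed
    also have "\<dots> = ennreal M * emeasure lborel ?P" using pre by (intro nn_integral_cmult_indicator) auto
    also have "\<dots> = ennreal (M / c) * (ennreal c * emeasure lborel ?P)"
      using M(1) c(1) by (simp add: mult.assoc[symmetric] ennreal_mult[symmetric])
    also have "\<dots> \<le> ennreal (M / c) * hausdorff_outer (real CARD('n) - 1) (E \<inter> \<Omega>)"
    proof (intro mult_left_mono c(2))
      show "\<Phi> ` ?P \<subseteq> E \<inter> \<Omega>"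
      proof
        fix y assume "y \<in> \<Phi> ` ?P"
        then obtain z where z: "y = \<Phi> z" "\<Phi>' z \<in> E" "z \<in> W" using \<rho>(2) by auto
        then show "y \<in> E \<inter> \<Omega>" using \<Phi>(2)[OF z(3)] by (simp add: \<Phi>'_def)
      qed
      show "drop_coord k (\<Phi> z) = drop_coord k z" if "z \<in> ?P" for z
        using that \<rho>(2) by (intro drop) auto
    qed (use pre in auto)
    also have "\<dots> \<le> ennreal (M / c) * emeasure \<mu> E" by (intro mult_left_mono le E) auto
    finally show ?thesis .
  qed
  have sm: "sets m = sets \<mu>" by (simp add: m_def sets)
  have "0 \<le> M / c" using M c by simp
  then obtain g :: "real^'n \<Rightarrow> real" where g: "g \<in> borel_measurable \<mu>" "\<And>x. 0 \<le> g x" "\<And>x. g x \<le> M / c"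
    "m = density \<mu> (\<lambda>x. ennreal (g x))"
    using bounded_density_exists[OF \<open>finite_measure \<mu>\<close> sm _ m_le] by blast
  have int2: "integrable \<mu> (\<lambda>x. (g x)\<^sup>2)"
    using g(1-3) by (intro mu.integrable_const_bound[of _ "(M / c)\<^sup>2"]) (auto intro!: power_mono)
  have fourier: "(LINT x|\<mu>. of_real (g x) * exp_fun \<xi> x) = osc_int ?a (phase \<xi>)" for \<xi>
  proof -
    have "(LINT x|\<mu>. of_real (g x) * exp_fun \<xi> x) = (LINT x|\<mu>. g x *\<^sub>R exp_fun \<xi> x)"
      by (simp add: scaleR_conv_of_real)
    also have "\<dots> = (LINT x|m. exp_fun \<xi> x)"
      unfolding g(4) using g(1,2) by (intro integral_density[symmetric]) (auto simp: mE)
    also have "\<dots> = (LINT z|density lborel (\<lambda>z. ennreal (?a z)). exp_fun \<xi> (\<Phi>' z))"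
      unfolding m_def using \<Phi>'_m by (intro integral_distr) auto
    also have "\<dots> = (LINT z|lborel. ?a z *\<^sub>R exp_fun \<xi> (\<Phi>' z))"
      using am \<Phi>'_m by (intro integral_density) (auto simp: bump_nonneg)
    also have "\<dots> = osc_int ?a (phase \<xi>)"
    proof (rule Bochner_Integration.integral_cong[OF refl])
      fix z
      show "?a z *\<^sub>R exp_fun \<xi> (\<Phi>' z) = of_real (?a z) * cis (phase \<xi> z)"
      proof (cases "z \<in> W")
        case True
        then have "\<xi> \<bullet> \<Phi>' z = \<xi> \<bullet> z + \<xi> $ k * (h z - z $ k)"
          by (simp add: \<Phi>'_def \<Phi>(3) inner_add_right inner_axis mult.commute)
        then show ?thesis by (simp add: exp_fun_def phase_def scaleR_conv_of_real)
      next
        case False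
        then have "?a z = 0" using \<rho> by (intro bump_eq_0) auto
        then show ?thesis by simp
      qed
    qed
    finally show ?thesis .
  qed
  obtain D where D: "\<And>\<xi>. 1 \<le> norm \<xi> \<Longrightarrow>
    (cmod (osc_int ?a (phase \<xi>)))\<^sup>2 \<le> D * norm \<xi> powr (- (4/3))"
    using fourier_decay by blast
  show thesis
  proof (rule that[of g D])
    show "(\<lambda>x. complex_of_real (g x)) \<in> L2 \<mu>" using g(1) int2 by (simp add: L2_def)
    \<comment> \<open>If g vanished almost everywhere, the push-forward would be null, but the bump
      is positive on a ball.\<close>
    show "0 < (LINT x|\<mu>. (g x)\<^sup>2)"
    proof (rule ccontr)
      assume "\<not> ?thesis"
      then have "(LINT x|\<mu>. (g x)\<^sup>2) = 0" by (simp add: order_antisym not_less)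
      then have "AE x in \<mu>. (g x)\<^sup>2 = 0" using int2 by (subst (asm) integral_nonneg_eq_0_iff_AE) auto
      then have "(\<integral>\<^sup>+x. ennreal (g x) \<partial>\<mu>) = 0"
        using g(1) by (subst nn_integral_0_iff_AE) auto
      moreover have "emeasure m UNIV = (\<integral>\<^sup>+x. ennreal (g x) \<partial>\<mu>)"
        unfolding g(4) using g(1) sets_eq_imp_space_eq[OF sets] sets
        by (subst emeasure_density) auto
      moreover have "emeasure m UNIV = (\<integral>\<^sup>+z. ennreal (?a z) \<partial>lborel)"
        unfolding m_def using \<Phi>'_m am by (simp add: emeasure_distr emeasure_density)
      ultimately have "(\<integral>\<^sup>+z. ennreal (?a z) \<partial>lborel) = 0" by simp
      then have "AE z in lborel. ennreal (?a z) = 0"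
        using am by (subst (asm) nn_integral_0_iff_AE) auto
      moreover have "0 < ?a z" if "z \<in> ball z0 \<rho>" for z
      proof -
        have "(norm (z - z0))\<^sup>2 < \<rho>\<^sup>2"
          using that by (intro power_strict_mono) (auto simp: dist_norm norm_minus_commute)
        then show ?thesis by (simp add: bump_def power2_norm_eq_inner)
      qed
      then have "ennreal (?a z) = 0 \<longrightarrow> z \<notin> ball z0 \<rho>" for z by (force simp del: mem_ball)
      ultimately have "AE z in lborel. z \<notin> ball z0 \<rho>" by (auto elim: eventually_mono)
      then have "ball z0 \<rho> \<in> null_sets lborel" by (subst AE_iff_null_sets) auto
      then show False using content_ball_pos[OF \<rho>(1), of z0] by (simp add: measure_eq_0_null_sets)
    qed
  qed (simp add: fourier D)
qed

theorem theorem1p2: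
  fixes C S A \<Omega> :: "(real^'n) set"
  assumes "CARD('n) \<ge> 3"
    and "smooth_curve C" and "A \<subseteq> C" and "openin (top_of_set C) A" and "A \<noteq> {}"
    and "smooth_hypersurface S" and "\<Omega> \<subseteq> S" and "openin (top_of_set S) \<Omega>" and "\<Omega> \<noteq> {}"
    and "\<exists>p\<in>\<Omega>. nonzero_gauss_curvature_at S p"
    and "finite_measure (add_measure (surface_measure_on 1 A)
                                     (surface_measure_on (real CARD('n) - 1) \<Omega>))"
  shows "\<not> admits_fourier_frame (add_measure (surface_measure_on 1 A)
                                              (surface_measure_on (real CARD('n) - 1) \<Omega>))"
proof -
  define \<mu> where "\<mu> = add_measure (surface_measure_on 1 A) (surface_measure_on (real CARD('n) - 1) \<Omega>)"
  have fin: "finite_measure \<mu>" using assms(11) by (simp add: \<mu>_def)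
  have sets: "sets \<mu> = sets borel" by (simp add: \<mu>_def)
  have A: "A \<in> sets borel" using assms(4) smooth_curve_borel[OF assms(2)] by (rule openin_borel)
  have \<Omega>: "\<Omega> \<in> sets borel" using assms(8) smooth_hypersurface_borel[OF assms(6)] by (rule openin_borel)
  have em: "emeasure \<mu> E = hausdorff_outer 1 (E \<inter> A) + hausdorff_outer (real CARD('n) - 1) (E \<inter> \<Omega>)"
    if "E \<in> sets borel" for E
    unfolding \<mu>_def using that A \<Omega> by (simp add: emeasure_add_measure emeasure_surface_measure_on)
  obtain q r0 where q: "0 < r0" "\<And>r. r \<le> r0 \<Longrightarrow> ennreal r \<le> hausdorff_outer 1 (ball q r \<inter> A)"
    using smooth_curve_ball_length_ge[OF assms(2,4,5)] by blast
  \<comment> \<open>Each summand alone bounds \<mu> from below: the curve gives the length of balls,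
    the hypersurface the domination used for the density.\<close>
  have low: "ennreal r \<le> emeasure \<mu> (ball q r)" if "r \<le> r0" for r
    using q(2)[OF that] by (simp add: em add_increasing2)
  obtain p U F where p: "p \<in> \<Omega>" "local_defining_function S U F p" "gauss_curvature F p \<noteq> 0"
    using assms(10) unfolding nonzero_gauss_curvature_at_def by blast
  obtain k :: 'n and W z0 \<rho> h h1 h2 h3 L c \<Phi> where "curved_graph k W z0 \<rho> h h1 h2 h3 L c"
    and \<Phi>: "continuous_on W \<Phi>" "\<And>z. z \<in> W \<Longrightarrow> \<Phi> z \<in> \<Omega>"
    "\<And>z. z \<in> W \<Longrightarrow> \<Phi> z = z + (h z - z $ k) *\<^sub>R axis k 1"
    using curved_hypersurface_graph[OF assms(1) p(2,3) assms(8) p(1)] by metis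
  then interpret curved_graph k W z0 \<rho> h h1 h2 h3 L c by simp
  have "hausdorff_outer (real CARD('n) - 1) (E \<inter> \<Omega>) \<le> emeasure \<mu> E" if "E \<in> sets borel" for E
    by (simp add: em[OF that] add_increasing)
  then obtain g D where "(\<lambda>x. complex_of_real (g x)) \<in> L2 \<mu>" "0 < (LINT x|\<mu>. (g x)\<^sup>2)"
    "\<And>\<xi>. 1 \<le> norm \<xi> \<Longrightarrow> (cmod (LINT x|\<mu>. of_real (g x) * exp_fun \<xi> x))\<^sup>2 \<le> D * norm \<xi> powr (- (4/3))"
    using decaying_density[OF fin sets \<Phi>] by blast
  then have "\<not> admits_fourier_frame \<mu>"
    using assms(1) q(1) low by (intro no_fourier_frame_if_decay[OF _ fin sets, where b = "4/3" and q = q and ?r0.0 = r0 and g = g and D = D]) auto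
  then show ?thesis by (simp add: \<mu>_def)
qed

end
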